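(* Let $n,d\ge0$ be integers, $\lambda\in\Lambda^+(n,d)$ and $\mu\in\Lambda(n,d)$. The (images of the) elements $\{h(\mathtt T) : \mathtt T\in\operatorname{Col}^\lambda_\mu\}$ give a basis for the complex vector space $C^\lambda_\mu$.
   Context: $\Lambda(n,d)$ is the set of $n$-tuples $\mu=(\mu_1,\dots,\mu_n)$ of non-negative integers with sum $d$; $\Lambda^+(n,d)$ is the subset of those with $\lambda_1\ge\cdots\ge\lambda_n$. $P=\mathbb C[x_1,\dots,x_d]$, graded with each $x_i$ in degree 2; $S_\mu=S_{\mu_1}\times\cdots\times S_{\mu_n}\le S_d$; $P_\mu=P^{S_\mu}$. Put $X_j=\{x_k:\mu_1+\cdots+\mu_{j-1}+1\le k\le\mu_1+\cdots+\mu_j\}$. For $1\le i_1<\cdots<i_m\le n$, $h_r(\mu;i_1,\dots,i_m)\in P_\mu$ is the $r$th complete symmetric function in the variables $X_{i_1}\cup\cdots\cup X_{i_m}$ ($1$ if $r=0$, $0$ if $r<0$). $I^\lambda_\mu$ is the ideal of $P_\mu$ generated by all $h_r(\mu;i_1,\dots,i_m)$ with $m\ge1$, $1\le i_1<\cdots<i_m\le n$, $r>\lambda_1+\cdots+\lambda_m-\mu_{i_1}-\cdots-\mu_{i_m}$; $C^\lambda_\mu=P_\mu/I^\lambda_\mu$. Young diagrams are drawn in the English convention. A column-strict $\lambda$-tableau is a filling of the boxes of the Young diagram of $\lambda$ by integers with entries strictly increasing down columns. $\operatorname{Col}^\lambda_\mu$ is the set of column-strict $\lambda$-tableaux having exactly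 $\mu_i$ entries equal to $i$ for each $i=1,\dots,n$ (and no other entries). For $n\ge1$ and $\mathtt T\in\operatorname{Col}^\lambda_\mu$, put $k=\mu_n$ and define: $c_1<\cdots<c_k$ are the indices of the columns of $\mathtt T$ containing the entry $n$; $\gamma=(\gamma_1\ge\cdots\ge\gamma_k)$ is the partition with $\gamma_{k+1-i}=c_i-i$; $\overline\mu=(\mu_1,\dots,\mu_{n-1})$; $\overline{\mathtt T}$ is obtained by removing all boxes labelled $n$ from $\mathtt T$ and then repeatedly interchanging columns $i$ and $i+1$ whenever the $i$th column has fewer boxes than the $(i+1)$th; $\overline\lambda\in\Lambda^+(n-1,d-k)$ is the shape of $\overline{\mathtt T}$, so $\overline{\mathtt T}\in\operatorname{Col}^{\overline\lambda}_{\overline\mu}$. The element $h(\mathtt T)\in P_\mu$ is defined inductively: $h(\mathtt T)=1$ for the empty tableau when $n=d=0$; for $n\ge1$, $h(\mathtt T)=h(\overline{\mathtt T})\,\prod_{i=1}^kh_{\gamma_i}(\mu;n)$, where $h(\overline{\mathtt T})\in P_{\overline\mu}$ is viewed in $P_\mu$ via the embedding $P_{\overline\mu}\hookrightarrow P_\mu$ induced by $\mathbb C[x_1,\dots,x_{d-k}]\hookrightarrow\mathbb C[x_1,\dots,x_d]$. The same notation is used for the image of $h(\mathtt T)$ in $C^\lambda_\mu$. *)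

theory Defs
  imports
    "HOL-Library.Poly_Mapping"
    "HOL-Combinatorics.Permutations"
    "HOL-Algebra.QuotRing"
    "Jordan_Normal_Form.VS_Connect"
begin

hide_const (open) Polynomial.degree Polynomial.monom Polynomial.order
hide_const (open) Modules.module Multiset.mult

section \<open>Compositions and partitions\<close>

text \<open>
  An \<open>n\<close>-tuple is a list of length \<open>n\<close>, so the entry \<open>\<mu>\<^sub>i\<close> is \<open>\<mu> ! (i - 1)\<close>. In particular
  \<open>n = length \<mu>\<close> and \<open>d = sum_list \<mu>\<close> are determined by \<open>\<mu>\<close>, and the definitions below do not
  take them as separate arguments.
\<close>

definition Comp :: "nat \<Rightarrow> nat \<Rightarrow> nat list set" where
  "Comp n d = {\<mu>. length \<mu> = n \<and> sum_list \<mu> = d}"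

definition Part :: "nat \<Rightarrow> nat \<Rightarrow> nat list set" where
  "Part n d = {lam \<in> Comp n d. sorted_wrt (\<ge>) lam}"

section \<open>Polynomials\<close>

text \<open>
  Finitely supported functions from monomials to coefficients; a monomial is its finitely
  supported function of exponents, and \<open>*\<close> is the polynomial (convolution) product. The type has
  the variables \<open>x\<^sub>0, x\<^sub>1, x\<^sub>2, \<dots>\<close>, and \<open>\<complex>[x\<^sub>1, \<dots>, x\<^sub>d]\<close> is a subset of it, so that the embedding of
  \<open>\<complex>[x\<^sub>1, \<dots>, x\<^sub>d\<^sub>-\<^sub>k]\<close> into \<open>\<complex>[x\<^sub>1, \<dots>, x\<^sub>d]\<close> is the inclusion.
\<close>

type_synonym cpoly = "(nat \<Rightarrow>\<^sub>0 nat) \<Rightarrow>\<^sub>0 complex"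

definition var :: "nat \<Rightarrow> cpoly" where
  "var i = Poly_Mapping.single (Poly_Mapping.single i 1) 1"

definition const :: "complex \<Rightarrow> cpoly" where
  "const c = Poly_Mapping.single 0 c"

definition Pol :: "nat \<Rightarrow> cpoly set" where
  "Pol d = {p. \<forall>m \<in> Poly_Mapping.keys p. Poly_Mapping.keys m \<subseteq> {1..d}}"

text \<open>
  For a permutation \<open>\<sigma>\<close>, this is the substitution \<open>x\<^sub>i \<mapsto> x\<^bsub>\<sigma> i\<^esub>\<close>: the coefficient of \<open>m\<close> in the
  result is the coefficient of \<open>m \<circ> \<sigma>\<close> in \<open>p\<close> (see \<open>permute_vars_var\<close> and \<open>permute_vars_mult\<close>).
\<close>

definition permute_vars :: "(nat \<Rightarrow> nat) \<Rightarrow> cpoly \<Rightarrow> cpoly" where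
  "permute_vars \<sigma> p = Poly_Mapping.map_key (Poly_Mapping.map_key \<sigma>) p"

lemma map_key_perm:
  assumes "bij \<sigma>"
  shows "Poly_Mapping.lookup (Poly_Mapping.map_key \<sigma> m) i = Poly_Mapping.lookup m (\<sigma> i)"
    and "bij (Poly_Mapping.map_key \<sigma> :: (nat \<Rightarrow>\<^sub>0 nat) \<Rightarrow> (nat \<Rightarrow>\<^sub>0 nat))"
proof -
  have inj: "inj \<sigma>" and inj': "inj (inv_into UNIV \<sigma>)"
    using assms by (auto simp: bij_is_inj bij_imp_bij_inv)
  show "Poly_Mapping.lookup (Poly_Mapping.map_key \<sigma> m) i = Poly_Mapping.lookup m (\<sigma> i)"
    using inj by (simp add: map_key.rep_eq)
  have 1: "Poly_Mapping.map_key \<sigma> (Poly_Mapping.map_key (inv_into UNIV \<sigma>) m) = m" for m :: "nat \<Rightarrow>\<^sub>0 nat"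
    by (rule poly_mapping_eqI) (simp add: map_key.rep_eq inj inj')
  have 2: "Poly_Mapping.map_key (inv_into UNIV \<sigma>) (Poly_Mapping.map_key \<sigma> m) = m" for m :: "nat \<Rightarrow>\<^sub>0 nat"
    by (rule poly_mapping_eqI)
      (use assms in \<open>simp add: map_key.rep_eq inj inj' bij_is_surj surj_f_inv_f\<close>)
  show "bij (Poly_Mapping.map_key \<sigma> :: (nat \<Rightarrow>\<^sub>0 nat) \<Rightarrow> (nat \<Rightarrow>\<^sub>0 nat))"
    by (rule o_bij[of "Poly_Mapping.map_key (inv_into UNIV \<sigma>)"]) (simp_all add: fun_eq_iff 1 2)
qed

lemma lookup_permute_vars:
  assumes "bij \<sigma>"
  shows "Poly_Mapping.lookup (permute_vars \<sigma> p) m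
    = Poly_Mapping.lookup p (Poly_Mapping.map_key \<sigma> m)"
  using map_key_perm(2)[OF assms] by (simp add: permute_vars_def map_key.rep_eq bij_is_inj)

lemma permute_vars_const:
  assumes "bij \<sigma>"
  shows "permute_vars \<sigma> (const c) = const c"
proof -
  have "permute_vars \<sigma> (const c) =
      Poly_Mapping.map_key (Poly_Mapping.map_key \<sigma>) (Poly_Mapping.single (Poly_Mapping.map_key \<sigma> 0) c)"
    using assms by (simp add: permute_vars_def const_def bij_is_inj)
  also have "\<dots> = const c"
    unfolding const_def by (rule map_key_single) (rule bij_is_inj[OF map_key_perm(2)[OF assms]])
  finally show ?thesis .
qed

lemma permute_vars_var:
  assumes "bij \<sigma>"
  shows "permute_vars \<sigma> (var i) = var (\<sigma> i)"
proof -
  have *: "Poly_Mapping.map_key \<sigma> (Poly_Mapping.single (\<sigma> i) (1::nat)) = Poly_Mapping.single i 1"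
    using assms by (simp add: bij_is_inj)
  show ?thesis
    unfolding permute_vars_def var_def *[symmetric]
    using map_key_perm(2)[OF assms] by (simp only: map_key_single[OF bij_is_inj])
qed

lemma permute_vars_add:
  assumes "bij \<sigma>"
  shows "permute_vars \<sigma> (p + q) = permute_vars \<sigma> p + permute_vars \<sigma> q"
  by (rule poly_mapping_eqI) (simp add: lookup_permute_vars[OF assms] lookup_add)

lemma permute_vars_mult:
  assumes "bij \<sigma>"
  shows "permute_vars \<sigma> (p * q) = permute_vars \<sigma> p * permute_vars \<sigma> q"
proof (rule poly_mapping_eqI)
  fix m
  let ?g = "Poly_Mapping.map_key \<sigma> :: (nat \<Rightarrow>\<^sub>0 nat) \<Rightarrow> (nat \<Rightarrow>\<^sub>0 nat)"
  have b: "bij ?g" by (rule map_key_perm(2)[OF assms])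
  have eq: "(?g m = ?g l + ?g k) = (m = l + k)" for l k
    using b assms by (metis map_key_plus bij_is_inj inj_eq)
  have inner: "(\<Sum>k. Poly_Mapping.lookup q k when ?g m = ?g l + k)
     = (\<Sum>k. Poly_Mapping.lookup q (?g k) when m = l + k)" for l
    by (rule Sum_any.reindex_cong[OF b]) (simp add: fun_eq_iff eq)
  have "Poly_Mapping.lookup (permute_vars \<sigma> (p * q)) m
     = (\<Sum>l. Poly_Mapping.lookup p l * (\<Sum>k. Poly_Mapping.lookup q k when ?g m = l + k))"
    by (simp add: lookup_permute_vars[OF assms] lookup_mult)
  also have "\<dots> = (\<Sum>l. Poly_Mapping.lookup p (?g l) *
      (\<Sum>k. Poly_Mapping.lookup q (?g k) when m = l + k))"
    by (rule Sum_any.reindex_cong[OF b]) (simp add: fun_eq_iff inner)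
  also have "\<dots> = Poly_Mapping.lookup (permute_vars \<sigma> p * permute_vars \<sigma> q) m"
    by (simp add: lookup_permute_vars[OF assms] lookup_mult)
  finally show "Poly_Mapping.lookup (permute_vars \<sigma> (p * q)) m
      = Poly_Mapping.lookup (permute_vars \<sigma> p * permute_vars \<sigma> q) m" .
qed

definition block :: "nat list \<Rightarrow> nat \<Rightarrow> nat set" where
  "block \<mu> j = {k. sum_list (take (j - 1) \<mu>) + 1 \<le> k \<and> k \<le> sum_list (take j \<mu>)}"

definition young_subgroup :: "nat list \<Rightarrow> (nat \<Rightarrow> nat) set" where
  "young_subgroup \<mu> =
     {\<sigma>. \<sigma> permutes {1..sum_list \<mu>} \<and> (\<forall>j \<in> {1..length \<mu>}. \<sigma> ` block \<mu> j = block \<mu> j)}"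

definition invariants :: "nat list \<Rightarrow> cpoly ring" where
  "invariants \<mu> =
     \<lparr>carrier = {p \<in> Pol (sum_list \<mu>). \<forall>\<sigma> \<in> young_subgroup \<mu>. permute_vars \<sigma> p = p},
      mult = (*), one = 1, zero = 0, add = (+)\<rparr>"

lemma const_in_Pol: "const c \<in> Pol d"
  by (auto simp: Pol_def const_def)

lemma Pol_add: "p \<in> Pol d \<Longrightarrow> q \<in> Pol d \<Longrightarrow> p + q \<in> Pol d"
  using Poly_Mapping.keys_add[of p q] by (auto simp: Pol_def)

lemma Pol_mult: "p \<in> Pol d \<Longrightarrow> q \<in> Pol d \<Longrightarrow> p * q \<in> Pol d"
  unfolding Pol_def
proof safe
  fix m i
  assume p: "\<forall>m\<in>Poly_Mapping.keys p. Poly_Mapping.keys m \<subseteq> {1..d}"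
    and q: "\<forall>m\<in>Poly_Mapping.keys q. Poly_Mapping.keys m \<subseteq> {1..d}"
    and m: "m \<in> Poly_Mapping.keys (p * q)" and i: "i \<in> Poly_Mapping.keys m"
  obtain a b where "m = a + b" "a \<in> Poly_Mapping.keys p" "b \<in> Poly_Mapping.keys q"
    using keys_mult[of p q] m by blast
  then show "i \<in> {1..d}"
    using p q i Poly_Mapping.keys_add[of a b] by blast
qed

lemma young_subgroup_bij: "\<sigma> \<in> young_subgroup \<mu> \<Longrightarrow> bij \<sigma>"
  by (auto simp: young_subgroup_def permutes_bij)

lemma const_closed: "const c \<in> carrier (invariants \<mu>)"
  by (simp add: invariants_def const_in_Pol permute_vars_const young_subgroup_bij)

lemma const_add: "const (a + b) = const a + const b"
  by (simp add: const_def single_add)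

lemma const_mult: "const (a * b) = const a * const b"
  by (simp add: const_def mult_single)

lemma const_one: "const 1 = 1"
  by (simp add: const_def)

lemma const_zero: "const 0 = 0"
  by (simp add: const_def)

lemma invariants_sel:
  "x \<otimes>\<^bsub>invariants \<mu>\<^esub> y = x * y" "x \<oplus>\<^bsub>invariants \<mu>\<^esub> y = x + y"
  "\<one>\<^bsub>invariants \<mu>\<^esub> = 1" "\<zero>\<^bsub>invariants \<mu>\<^esub> = 0"
  by (simp_all add: invariants_def)

lemma invariants_cring: "cring (invariants \<mu>)"
proof (rule cringI)
  let ?R = "invariants \<mu>"
  have closed: "p + q \<in> carrier ?R" "p * q \<in> carrier ?R"
    if "p \<in> carrier ?R" "q \<in> carrier ?R" for p q
    using that
    by (simp_all add: invariants_def Pol_add Pol_mult permute_vars_add permute_vars_mult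
        young_subgroup_bij)
  have c01: "0 \<in> carrier ?R" "1 \<in> carrier ?R"
    using const_closed[of 0] const_closed[of 1] by (simp_all only: const_zero const_one)
  show "abelian_group ?R"
  proof (rule abelian_groupI)
    fix p assume p: "p \<in> carrier ?R"
    have "const (- 1) * p + p = 0"
      using distrib_right[of "const (- 1)" "const 1" p] const_add[of "- 1" 1]
      by (simp add: const_zero const_one)
    then show "\<exists>q\<in>carrier ?R. q \<oplus>\<^bsub>?R\<^esub> p = \<zero>\<^bsub>?R\<^esub>"
      using closed(2)[OF const_closed p] by (auto simp only: invariants_sel)
  next
    fix p q
    show "p \<oplus>\<^bsub>?R\<^esub> q = q \<oplus>\<^bsub>?R\<^esub> p"
      by (simp only: invariants_sel add.commute)
  qed (simp_all only: invariants_sel closed c01 add.assoc add_0)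
  show "comm_monoid ?R"
  proof (rule comm_monoidI)
    fix p q
    show "p \<otimes>\<^bsub>?R\<^esub> q = q \<otimes>\<^bsub>?R\<^esub> p"
      by (simp only: invariants_sel mult.commute)
  qed (simp_all only: invariants_sel closed c01 mult.assoc mult_1_left)
qed (simp add: invariants_sel distrib_right)

text \<open>The sum of all monomials of degree \<open>r\<close> in the variables \<open>x\<^sub>k\<close> with \<open>k \<in> A\<close>, for finite \<open>A\<close>;
  it is \<open>1\<close> for \<open>r = 0\<close> and, the index set being empty, \<open>0\<close> for \<open>r < 0\<close>.\<close>

definition complete_sym :: "nat set \<Rightarrow> int \<Rightarrow> cpoly" where
  "complete_sym A r =
     (\<Sum>m \<in> {m :: nat \<Rightarrow>\<^sub>0 nat. Poly_Mapping.keys m \<subseteq> A \<and> int (\<Sum>k\<in>A. Poly_Mapping.lookup m k) = r}.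
        Poly_Mapping.single m 1)"

text \<open>\<open>h\<^sub>r(\<mu>; i\<^sub>1, \<dots>, i\<^sub>m)\<close> is \<open>hsym \<mu> {i\<^sub>1, \<dots>, i\<^sub>m} r\<close>.\<close>

definition hsym :: "nat list \<Rightarrow> nat set \<Rightarrow> int \<Rightarrow> cpoly" where
  "hsym \<mu> I r = complete_sym (\<Union>i\<in>I. block \<mu> i) r"

lemma finite_monomials:
  assumes "finite A"
  shows "finite {m :: nat \<Rightarrow>\<^sub>0 nat. Poly_Mapping.keys m \<subseteq> A
    \<and> int (\<Sum>k\<in>A. Poly_Mapping.lookup m k) = r}" (is "finite ?M")
proof (rule finite_imageD[of Poly_Mapping.lookup])
  have "Poly_Mapping.lookup ` ?M \<subseteq>
      {f. f ` A \<subseteq> {0..nat r} \<and> (\<forall>x. x \<notin> A \<longrightarrow> f x = 0)}"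
  proof safe
    fix m :: "nat \<Rightarrow>\<^sub>0 nat" and k
    assume "r = int (\<Sum>k\<in>A. Poly_Mapping.lookup m k)" "k \<in> A"
    then show "Poly_Mapping.lookup m k \<in> {0..nat (int (\<Sum>k\<in>A. Poly_Mapping.lookup m k))}"
      using member_le_sum[of k A "Poly_Mapping.lookup m"] assms by (simp del: of_nat_sum)
  qed (auto simp: in_keys_iff)
  moreover have "finite {f :: nat \<Rightarrow> nat. f ` A \<subseteq> {0..nat r} \<and> (\<forall>x. x \<notin> A \<longrightarrow> f x = 0)}"
    using finite_set_of_finite_funs[OF assms, of "{0..nat r}" 0]
    by (rule rev_finite_subset) auto
  ultimately show "finite (Poly_Mapping.lookup ` ?M)"
    by (rule finite_subset)
  show "inj_on Poly_Mapping.lookup ?M"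
    by (rule inj_onI) (metis poly_mapping_eqI)
qed

lemma lookup_complete_sym:
  assumes "finite A"
  shows "Poly_Mapping.lookup (complete_sym A r) m =
    (if Poly_Mapping.keys m \<subseteq> A \<and> int (\<Sum>k\<in>A. Poly_Mapping.lookup m k) = r then 1 else 0)"
proof -
  have "(\<Sum>x\<in>{m. Poly_Mapping.keys m \<subseteq> A \<and> int (\<Sum>k\<in>A. Poly_Mapping.lookup m k) = r}.
      Poly_Mapping.lookup (Poly_Mapping.single x (1::complex)) m) =
     (\<Sum>x\<in>{m. Poly_Mapping.keys m \<subseteq> A \<and> int (\<Sum>k\<in>A. Poly_Mapping.lookup m k) = r}.
       if x = m then 1 else 0)"
    by (rule sum.cong) (auto simp: lookup_single when_def)
  then show ?thesis
    by (simp add: complete_sym_def lookup_sum sum.delta'[OF finite_monomials[OF assms]]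
        sum.delta[OF finite_monomials[OF assms]] del: of_nat_sum)
qed

lemma complete_sym_zero:
  assumes "finite A"
  shows "complete_sym A 0 = 1"
proof (rule poly_mapping_eqI)
  fix m
  have "(Poly_Mapping.keys m \<subseteq> A \<and> int (\<Sum>k\<in>A. Poly_Mapping.lookup m k) = 0) = (m = 0)"
  proof
    assume m: "Poly_Mapping.keys m \<subseteq> A \<and> int (\<Sum>k\<in>A. Poly_Mapping.lookup m k) = 0"
    then have "(\<Sum>k\<in>A. Poly_Mapping.lookup m k) = 0"
      by linarith
    then have "\<forall>k\<in>A. Poly_Mapping.lookup m k = 0"
      using assms by simp
    then have "Poly_Mapping.keys m = {}"
      using m by (meson in_keys_iff subset_iff all_not_in_conv)
    then show "m = 0" by simp
  qed simp
  then show "Poly_Mapping.lookup (complete_sym A 0) m = Poly_Mapping.lookup 1 m"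
    by (simp only: lookup_complete_sym[OF assms] lookup_one when_def)
qed

lemma complete_sym_neg: "complete_sym A r = 0" if "r < 0"
proof -
  have *: "{m :: nat \<Rightarrow>\<^sub>0 nat. Poly_Mapping.keys m \<subseteq> A
      \<and> int (\<Sum>k\<in>A. Poly_Mapping.lookup m k) = r} = {}"
    using that of_nat_0_le_iff[where ?'a = int] by (auto simp del: of_nat_sum of_nat_0_le_iff)
  show ?thesis
    unfolding complete_sym_def * by simp
qed

lemma block_subset: "i \<in> {1..length \<mu>} \<Longrightarrow> block \<mu> i \<subseteq> {1..sum_list \<mu>}"
proof -
  have "sum_list (take i \<mu>) \<le> sum_list \<mu>"
    by (metis append_take_drop_id le_add1 sum_list_append)
  then show ?thesis by (auto simp: block_def)
qed

lemma hsym_closed: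
  assumes "I \<subseteq> {1..length \<mu>}"
  shows "hsym \<mu> I r \<in> carrier (invariants \<mu>)"
proof -
  define A where "A = (\<Union>i\<in>I. block \<mu> i)"
  have sub: "A \<subseteq> {1..sum_list \<mu>}"
    using assms block_subset unfolding A_def by blast
  then have fin: "finite A" by (rule finite_subset) simp
  have "complete_sym A r \<in> Pol (sum_list \<mu>)"
    unfolding Pol_def
  proof safe
    fix m i
    assume "m \<in> Poly_Mapping.keys (complete_sym A r)" and i: "i \<in> Poly_Mapping.keys m"
    then have "Poly_Mapping.keys m \<subseteq> A"
      by (auto simp: in_keys_iff[of _ "complete_sym A r"] lookup_complete_sym[OF fin] split: if_splits)
    then show "i \<in> {1..sum_list \<mu>}"
      using i sub by blast
  qed
  moreover have "permute_vars \<sigma> (complete_sym A r) = complete_sym A r"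
    if s: "\<sigma> \<in> young_subgroup \<mu>" for \<sigma>
  proof (rule poly_mapping_eqI)
    fix m :: "nat \<Rightarrow>\<^sub>0 nat"
    have bij: "bij \<sigma>" using s by (rule young_subgroup_bij)
    have "\<sigma> ` block \<mu> i = block \<mu> i" if "i \<in> I" for i
      using that s assms by (auto simp: young_subgroup_def)
    then have img: "\<sigma> ` A = A"
      by (simp add: A_def image_UN)
    have "bij_betw \<sigma> A A"
      using bij img by (auto simp: bij_betw_def intro: inj_on_subset)
    then have "(\<Sum>k\<in>A. Poly_Mapping.lookup m (\<sigma> k)) = (\<Sum>k\<in>A. Poly_Mapping.lookup m k)"
      by (rule sum.reindex_bij_betw)
    moreover have "Poly_Mapping.keys (Poly_Mapping.map_key \<sigma> m) \<subseteq> A \<longleftrightarrow> Poly_Mapping.keys m \<subseteq> A"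
    proof -
      have "\<sigma> -` Poly_Mapping.keys m \<subseteq> A \<longleftrightarrow> \<sigma> ` (\<sigma> -` Poly_Mapping.keys m) \<subseteq> \<sigma> ` A"
        by (rule inj_image_subset_iff[symmetric]) (use bij in \<open>rule bij_is_inj\<close>)
      also have "\<dots> \<longleftrightarrow> Poly_Mapping.keys m \<subseteq> A"
        using bij by (simp add: img bij_is_surj surj_image_vimage_eq)
      finally show ?thesis
        using bij by (simp add: keys_map_key bij_is_inj)
    qed
    ultimately show "Poly_Mapping.lookup (permute_vars \<sigma> (complete_sym A r)) m
        = Poly_Mapping.lookup (complete_sym A r) m"
      by (simp add: lookup_permute_vars[OF bij] lookup_complete_sym[OF fin] map_key_perm(1)[OF bij])
  qed
  ultimately show ?thesis
    by (simp add: invariants_def hsym_def A_def)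
qed

section \<open>The algebra\<close>

definition ideal_gens :: "nat list \<Rightarrow> nat list \<Rightarrow> cpoly set" where
  "ideal_gens lam \<mu> =
     {hsym \<mu> I r | I r. I \<noteq> {} \<and> I \<subseteq> {1..length \<mu>} \<and>
        r > int (sum_list (take (card I) lam)) - (\<Sum>i\<in>I. int (\<mu> ! (i - 1)))}"

definition ideal_I :: "nat list \<Rightarrow> nat list \<Rightarrow> cpoly set" where
  "ideal_I lam \<mu> = Idl\<^bsub>invariants \<mu>\<^esub> (ideal_gens lam \<mu>)"

definition to_C :: "nat list \<Rightarrow> nat list \<Rightarrow> cpoly \<Rightarrow> cpoly set" where
  "to_C lam \<mu> p = ideal_I lam \<mu> +>\<^bsub>invariants \<mu>\<^esub> p"

text \<open>The quotient ring, with \<open>c \<in> \<complex>\<close> acting as multiplication by the class of \<open>const c\<close>.\<close>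

definition alg_C :: "nat list \<Rightarrow> nat list \<Rightarrow> (complex, cpoly set) module" where
  "alg_C lam \<mu> =
     (let Q = invariants \<mu> Quot ideal_I lam \<mu>
      in \<lparr>carrier = carrier Q, mult = mult Q, one = one Q, zero = zero Q, add = add Q,
          smult = (\<lambda>c A. to_C lam \<mu> (const c) \<otimes>\<^bsub>Q\<^esub> A)\<rparr>)"

lemma ideal_I_ideal: "ideal (ideal_I lam \<mu>) (invariants \<mu>)"
  unfolding ideal_I_def
  by (rule ring.genideal_ideal[OF cring.axioms(1)[OF invariants_cring]])
    (auto simp: ideal_gens_def intro!: hsym_closed)

lemma alg_C_vectorspace: "vectorspace class_ring (alg_C lam \<mu>)"
proof -
  let ?R = "invariants \<mu>" and ?I = "ideal_I lam \<mu>"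
  let ?Q = "?R Quot ?I"
  interpret R: cring ?R by (rule invariants_cring)
  interpret I: ideal ?I ?R by (rule ideal_I_ideal)
  interpret Q: cring ?Q by (rule I.quotient_is_cring) (rule invariants_cring)
  interpret h: ring_hom_ring ?R ?Q "to_C lam \<mu>"
    using I.rcos_ring_hom_ring by (simp add: to_C_def[abs_def])
  have cl: "to_C lam \<mu> (const c) \<in> carrier ?Q" for c
    by (rule h.hom_closed) (rule const_closed)
  have hadd: "to_C lam \<mu> (const (a + b)) = to_C lam \<mu> (const a) \<oplus>\<^bsub>?Q\<^esub> to_C lam \<mu> (const b)" for a b
    using h.hom_add[OF const_closed const_closed, of a b] by (simp add: const_add invariants_def)
  have hmult: "to_C lam \<mu> (const (a * b)) = to_C lam \<mu> (const a) \<otimes>\<^bsub>?Q\<^esub> to_C lam \<mu> (const b)" for a b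
    using h.hom_mult[OF const_closed const_closed, of a b] by (simp add: const_mult invariants_def)
  have hone: "to_C lam \<mu> (const 1) = \<one>\<^bsub>?Q\<^esub>"
    using h.hom_one by (simp add: const_one invariants_def)
  have sel: "carrier (alg_C lam \<mu>) = carrier ?Q" "add (alg_C lam \<mu>) = add ?Q"
    "zero (alg_C lam \<mu>) = zero ?Q"
    "smult (alg_C lam \<mu>) c A = to_C lam \<mu> (const c) \<otimes>\<^bsub>?Q\<^esub> A" for c A
    by (simp_all add: alg_C_def Let_def)
  have grp: "abelian_group (alg_C lam \<mu>)"
  proof (rule abelian_groupI)
    fix A assume "A \<in> carrier (alg_C lam \<mu>)"
    then show "\<exists>B\<in>carrier (alg_C lam \<mu>). B \<oplus>\<^bsub>alg_C lam \<mu>\<^esub> A = \<zero>\<^bsub>alg_C lam \<mu>\<^esub>"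
      unfolding sel by (intro bexI[of _ "\<ominus>\<^bsub>?Q\<^esub> A"] Q.l_neg Q.a_inv_closed)
  next
    fix A B assume "A \<in> carrier (alg_C lam \<mu>)" "B \<in> carrier (alg_C lam \<mu>)"
    then show "A \<oplus>\<^bsub>alg_C lam \<mu>\<^esub> B = B \<oplus>\<^bsub>alg_C lam \<mu>\<^esub> A"
      unfolding sel by (rule Q.a_comm)
  qed (simp_all only: sel Q.a_assoc Q.l_zero Q.add.m_closed Q.zero_closed)
  have modl: "module (class_ring :: complex ring) (alg_C lam \<mu>)"
    by (rule moduleI[OF class_cring.is_cring grp])
      (auto simp: sel cl hadd hmult hone Q.l_distr Q.r_distr Q.m_assoc)
  show ?thesis
    by (rule vectorspace.intro[OF modl class_field])
qed

section \<open>Column-strict tableaux\<close>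

text \<open>
  A tableau is the list of its columns, from left to right, each column being the list of its
  entries from top to bottom. Boxes are pairs (row, column) of positive integers. Empty columns are
  excluded, so each filling of a Young diagram is represented by exactly one list. The type \<open>nat\<close>
  of entries is no restriction, as the content condition forces all entries into \<open>{1..n}\<close>.
\<close>

type_synonym tableau = "nat list list"

definition young_diagram :: "nat list \<Rightarrow> (nat \<times> nat) set" where
  "young_diagram lam = {(r, c). 1 \<le> r \<and> r \<le> length lam \<and> 1 \<le> c \<and> c \<le> lam ! (r - 1)}"

definition boxes :: "tableau \<Rightarrow> (nat \<times> nat) set" where
  "boxes T = {(r, c). 1 \<le> c \<and> c \<le> length T \<and> 1 \<le> r \<and> r \<le> length (T ! (c - 1))}"

definition Col :: "nat list \<Rightarrow> nat list \<Rightarrow> tableau set" where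
  "Col lam \<mu> =
     {T. [] \<notin> set T \<and> boxes T = young_diagram lam \<and>
         (\<forall>col \<in> set T. sorted_wrt (<) col) \<and>
         (\<forall>i. count_list (concat T) i = (if i \<in> {1..length \<mu>} then \<mu> ! (i - 1) else 0))}"

text \<open>
  Repeatedly interchanging adjacent columns of which the left one is strictly shorter is a stable
  sort by decreasing length; see \<open>straighten_reachable\<close> and \<open>straighten_unique\<close>.
\<close>

inductive col_swap :: "tableau \<Rightarrow> tableau \<Rightarrow> bool" where
  "length a < length b \<Longrightarrow> col_swap (us @ a # b # vs) (us @ b # a # vs)"

definition straighten :: "tableau \<Rightarrow> tableau" where
  "straighten T = sort_key (\<lambda>col. - int (length col)) T"

lemma col_swap_Cons: "col_swap S T \<Longrightarrow> col_swap (c # S) (c # T)"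
  by (induction rule: col_swap.induct) (metis append_Cons col_swap.intros)

lemma col_swaps_Cons: "col_swap\<^sup>*\<^sup>* S T \<Longrightarrow> col_swap\<^sup>*\<^sup>* (c # S) (c # T)"
  by (induction rule: rtranclp_induct) (auto intro: rtranclp.rtrancl_into_rtrancl col_swap_Cons)

lemma straighten_reachable: "col_swap\<^sup>*\<^sup>* T (straighten T)"
proof (induction T)
  case (Cons c T)
  have ins: "col_swap\<^sup>*\<^sup>* (c # S) (insort_key (\<lambda>col. - int (length col)) c S)" for S
  proof (induction S)
    case (Cons b S)
    show ?case
    proof (cases "length c < length b")
      case True
      then have "col_swap (c # b # S) (b # c # S)"
        using col_swap.intros[of c b "[]" S] by simp
      then show ?thesis
        using True col_swaps_Cons[OF Cons.IH, of b] by (simp add: converse_rtranclp_into_rtranclp)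
    qed simp
  qed simp
  have "col_swap\<^sup>*\<^sup>* (c # T) (c # straighten T)"
    by (rule col_swaps_Cons) (rule Cons.IH)
  also have "col_swap\<^sup>*\<^sup>* (c # straighten T) (straighten (c # T))"
    using ins[of "straighten T"] by (simp add: straighten_def)
  finally show ?case .
qed (simp add: straighten_def)

lemma straighten_unique:
  assumes "col_swap\<^sup>*\<^sup>* T S"
  shows "(\<nexists>U. col_swap S U) \<longleftrightarrow> S = straighten T"
proof -
  let ?f = "\<lambda>col :: nat list. - int (length col)"
  have step: "straighten A = straighten B" if "col_swap A B" for A B
    using that unfolding straighten_def
  proof (induction rule: col_swap.induct)
    case (1 a b us vs)
    let ?B = "us @ b # a # vs"
    show ?case
    proof (rule properties_for_sort_key)
      show "filter (\<lambda>x. ?f k = ?f x) (sort_key ?f ?B) = filter (\<lambda>x. ?f k = ?f x) (us @ a # b # vs)" for k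
      proof -
        have "filter (\<lambda>x. ?f x = ?f k) (sort_key ?f ?B) = filter (\<lambda>x. ?f x = ?f k) ?B"
          by (rule sort_key_stable)
        also have "\<dots> = filter (\<lambda>x. ?f x = ?f k) (us @ a # b # vs)"
          using 1 by auto
        moreover have "(\<lambda>x. ?f x = ?f k) = (\<lambda>x. ?f k = ?f x)" by (rule ext) (rule eq_commute)
        ultimately show ?thesis by (simp only:)
      qed
    qed auto
  qed
  have eq: "straighten T = straighten S"
    using assms by (induction rule: rtranclp_induct) (auto dest: step)
  have sorted: "sorted (map ?f (straighten T))"
    by (simp add: straighten_def)
  have noswap: "\<not> sorted (map ?f A)" if "col_swap A B" for A B
    using that by (induction rule: col_swap.induct) (auto simp: sorted_append)
  show ?thesis
  proof
    assume no: "\<nexists>U. col_swap S U"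
    have "sorted (map ?f S)"
    proof (rule ccontr)
      assume "\<not> sorted (map ?f S)"
      then obtain i where i: "Suc i < length S" "length (S ! i) < length (S ! Suc i)"
        by (force simp: sorted_iff_nth_Suc)
      have "S = take i S @ S ! i # S ! Suc i # drop (Suc (Suc i)) S"
        using i(1) by (metis Cons_nth_drop_Suc Suc_lessD append_take_drop_id)
      then show False
        using no col_swap.intros[OF i(2)] by metis
    qed
    then have "straighten S = S"
      by (simp add: straighten_def sort_key_id_if_sorted)
    then show "S = straighten T" by (simp add: eq)
  next
    assume "S = straighten T"
    then show "\<nexists>U. col_swap S U"
      using sorted noswap by metis
  qed
qed

text \<open>\<open>remove_entry n T\<close> is the tableau \<open>T\<close> with a bar: columns that have become empty are dropped.\<close>

definition remove_entry :: "nat \<Rightarrow> tableau \<Rightarrow> tableau" where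
  "remove_entry n T = filter (\<lambda>col. col \<noteq> []) (straighten (map (filter (\<lambda>e. e \<noteq> n)) T))"

definition entry_cols :: "nat \<Rightarrow> tableau \<Rightarrow> nat list" where
  "entry_cols n T = filter (\<lambda>c. n \<in> set (T ! (c - 1))) [1..<length T + 1]"

text \<open>The part \<open>\<gamma>\<^sub>i = c\<^sub>j - j\<close> with \<open>j = k + 1 - i\<close>, for \<open>1 \<le> i \<le> k\<close>.\<close>

definition gamma_part :: "nat \<Rightarrow> nat \<Rightarrow> tableau \<Rightarrow> nat \<Rightarrow> int" where
  "gamma_part n k T i = (let j = k + 1 - i in int (entry_cols n T ! (j - 1)) - int j)"

function tab_h :: "nat list \<Rightarrow> tableau \<Rightarrow> cpoly" where
  "tab_h \<mu> T =
     (if \<mu> = [] then 1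
      else let n = length \<mu>; k = last \<mu>
           in tab_h (butlast \<mu>) (remove_entry n T)
                * (\<Prod>i = 1..k. hsym \<mu> {n} (gamma_part n k T i)))"
  by pat_completeness auto
termination by (relation "measure (\<lambda>(\<mu>, T). length \<mu>)") auto

declare tab_h.simps [simp del]

end

theory Submission
  imports Defs
    "HOL-Computational_Algebra.Formal_Power_Series"
    "Jordan_Normal_Form.Determinant"
begin

text \<open>
  Put \<open>k = \<mu>\<^sub>n\<close>. Expanding \<open>f\<close> times the Vandermonde determinant of the last block \<open>X\<^sub>n\<close> into alternants
  shows that \<open>P\<^sub>\<mu>\<close> is spanned over the invariants of the other blocks by the products
  \<open>h\<^sub>g = h(g\<^sub>1) \<dots> h(g\<^sub>k)\<close> of exactly \<open>k\<close> complete symmetric functions in \<open>X\<^sub>n\<close>. Such a product lies in the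
  ideal if some \<open>g\<^sub>a > \<lambda>\<^sub>1 - k\<close>. Otherwise, with \<open>g\<close> decreasing, the column indices
  \<open>c\<^sub>j = g\<^bsub>k+1-j\<^esub> + j\<close> determine the smaller shape, and Cramer's rule, applied to the coefficients of the
  product of the generating functions of \<open>X\<^sub>I\<close> and \<open>X\<^sub>n\<close>, rewrites \<open>u h\<^sub>g\<close>, for each generator \<open>u\<close> of the ideal
  of the smaller shape, modulo the ideal into products that are larger than \<open>h\<^sub>g\<close>. Induction on \<open>n\<close>
  then shows that the \<open>h(T)\<close> span.

  For independence, attach to \<open>T\<close> a point whose coordinates in the block \<open>i\<close> are the indices of the columns
  of \<open>T\<close> containing \<open>i\<close>. Every generator of the ideal is the leading form of an invariant that vanishes at all these
  points. Hence spanning implies, degree by degree, that the restrictions of the \<open>h(T)\<close> span all functions on the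
  set of points; being as many as there are points they are independent there, and a
  relation of degree \<open>s\<close> modulo the ideal would express some \<open>h(T)\<close> on the points by others.
\<close>

section \<open>Polynomials as a complex vector space\<close>

text \<open>What makes Cramer's rule fit: take m of the first blocks, and let A be their bound in
  the ideal of \<lambda>. In the ideal of the smaller shape this bound drops by the number l of
  chosen columns beyond \<open>\<lambda>\<^sub>m\<^sub>+\<^sub>1\<close>, so l coefficients are at
  stake. The l largest parts of g supply as many equations: the coefficients of degree
  \<open>A + g ! a - a\<close> of the product with the last block exceed the bound for m + 1 blocks.
  The determinant of the system is never inverted: its diagonal is the product of the first l
  factors of \<open>h\<^sub>g\<close>, and every other term of its expansion completes to a larger
  product or to zero.

  The obstacle to independence is that no lower bound for the dimension of the quotient is available
  in advance. It is replaced by a count: there are as many points as tableaux, hence as many as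
  elements in the spanning family. The ideal itself does not vanish at the points; its elements do
  so only after a correction by terms of lower degree, which is why every comparison goes through
  the degree filtration.\<close>

interpretation cp: vector_space "\<lambda>c p. const c * p"
  by unfold_locales (simp_all add: algebra_simps const_add const_mult const_one)

abbreviation Inv :: "nat list \<Rightarrow> cpoly set" where
  "Inv \<mu> \<equiv> carrier (invariants \<mu>)"

lemma Inv_iff: "p \<in> Inv \<mu> \<longleftrightarrow> p \<in> Pol (sum_list \<mu>) \<and> (\<forall>\<sigma> \<in> young_subgroup \<mu>. permute_vars \<sigma> p = p)"
  by (simp add: invariants_def)

lemma Inv_add: "p \<in> Inv \<mu> \<Longrightarrow> q \<in> Inv \<mu> \<Longrightarrow> p + q \<in> Inv \<mu>"
  by (simp add: Inv_iff Pol_add permute_vars_add young_subgroup_bij)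

lemma Inv_mult: "p \<in> Inv \<mu> \<Longrightarrow> q \<in> Inv \<mu> \<Longrightarrow> p * q \<in> Inv \<mu>"
  by (simp add: Inv_iff Pol_mult permute_vars_mult young_subgroup_bij)

lemma Inv_zero: "0 \<in> Inv \<mu>" and Inv_one: "1 \<in> Inv \<mu>"
  using const_closed[of 0 \<mu>] const_closed[of 1 \<mu>] by (simp_all add: const_zero const_one)

lemma Inv_prod: "(\<And>i. i \<in> A \<Longrightarrow> f i \<in> Inv \<mu>) \<Longrightarrow> prod f A \<in> Inv \<mu>"
  by (induction A rule: infinite_finite_induct) (auto simp: Inv_one Inv_mult)

lemma Inv_subspace: "cp.subspace (Inv \<mu>)"
  unfolding cp.subspace_def by (simp add: Inv_zero Inv_add Inv_mult const_closed)

lemma Inv_sum: "(\<And>i. i \<in> A \<Longrightarrow> f i \<in> Inv \<mu>) \<Longrightarrow> sum f A \<in> Inv \<mu>"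
  by (rule cp.subspace_sum[OF Inv_subspace])

lemma Inv_minus: "p \<in> Inv \<mu> \<Longrightarrow> - p \<in> Inv \<mu>"
  by (rule cp.subspace_neg[OF Inv_subspace])

lemma Inv_diff: "p \<in> Inv \<mu> \<Longrightarrow> q \<in> Inv \<mu> \<Longrightarrow> p - q \<in> Inv \<mu>"
  by (rule cp.subspace_diff[OF Inv_subspace])

lemma ideal_gens_Inv: "g \<in> ideal_gens lam \<mu> \<Longrightarrow> g \<in> Inv \<mu>"
  by (auto simp: ideal_gens_def intro!: hsym_closed)

lemma ideal_span_mult:
  assumes "f \<in> cp.span {p * g | p g. p \<in> Inv \<mu> \<and> g \<in> G}" "a \<in> Inv \<mu>"
  shows "a * f \<in> cp.span {p * g | p g. p \<in> Inv \<mu> \<and> g \<in> G}"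
  using assms(1)
proof (induction f rule: cp.span_induct_alt)
  case base
  then show ?case by (simp add: cp.span_zero)
next
  case (step c x y)
  then obtain p g where pg: "x = p * g" "p \<in> Inv \<mu>" "g \<in> G" by blast
  have "a * (const c * x + y) = const c * ((a * p) * g) + a * y"
    by (simp add: pg algebra_simps)
  moreover have "(a * p) * g \<in> cp.span {p * g | p g. p \<in> Inv \<mu> \<and> g \<in> G}"
    using pg assms(2) by (intro cp.span_base) (auto intro: Inv_mult)
  ultimately show ?case
    by (simp only:) (intro cp.span_add cp.span_scale step.IH)
qed

text \<open>With the ideal as a linear span, statements that are linear in its elements reduce, by
  \<open>cp.span_induct_alt\<close>, to products of one invariant and one generator.\<close>

lemma ideal_I_eq_span:
  "ideal_I lam \<mu> = cp.span {p * g | p g. p \<in> Inv \<mu> \<and> g \<in> ideal_gens lam \<mu>}"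
    (is "_ = cp.span ?S")
proof
  interpret R: cring "invariants \<mu>" by (rule invariants_cring)
  interpret I: ideal "ideal_I lam \<mu>" "invariants \<mu>" by (rule ideal_I_ideal)
  have gens: "ideal_gens lam \<mu> \<subseteq> Inv \<mu>" using ideal_gens_Inv by blast
  have spanInv: "cp.span ?S \<subseteq> Inv \<mu>"
    by (rule cp.span_minimal[OF _ Inv_subspace]) (auto intro: Inv_mult ideal_gens_Inv)
  have ainv: "\<ominus>\<^bsub>invariants \<mu>\<^esub> a = - a" if "a \<in> Inv \<mu>" for a
    by (rule R.minus_equality) (use that in \<open>auto simp: invariants_sel Inv_minus\<close>)
  have "ideal (cp.span ?S) (invariants \<mu>)"
  proof (rule idealI)
    show "ring (invariants \<mu>)" by (rule R.ring_axioms)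
    show "subgroup (cp.span ?S) (add_monoid (invariants \<mu>))"
    proof (rule R.add.subgroupI)
      show "cp.span ?S \<subseteq> Inv \<mu>" by (rule spanInv)
      show "cp.span ?S \<noteq> {}" using cp.span_zero[of ?S] by blast
      fix a assume a: "a \<in> cp.span ?S"
      have "- a \<in> cp.span ?S" by (rule cp.span_neg[OF a])
      then show "\<ominus>\<^bsub>invariants \<mu>\<^esub> a \<in> cp.span ?S"
        using ainv[of a] a spanInv by auto
      fix b assume b: "b \<in> cp.span ?S"
      show "a \<oplus>\<^bsub>invariants \<mu>\<^esub> b \<in> cp.span ?S"
        unfolding invariants_sel by (rule cp.span_add[OF a b])
    qed
  next
    fix a x assume a: "a \<in> cp.span ?S" "x \<in> Inv \<mu>"
    show "x \<otimes>\<^bsub>invariants \<mu>\<^esub> a \<in> cp.span ?S"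
      unfolding invariants_sel by (rule ideal_span_mult[OF a])
    then show "a \<otimes>\<^bsub>invariants \<mu>\<^esub> x \<in> cp.span ?S"
      unfolding invariants_sel by (simp only: mult.commute)
  qed
  moreover have "ideal_gens lam \<mu> \<subseteq> cp.span ?S"
  proof
    fix g assume "g \<in> ideal_gens lam \<mu>"
    then have "1 * g \<in> ?S" using Inv_one by blast
    then have "1 * g \<in> cp.span ?S" by (rule cp.span_base)
    then show "g \<in> cp.span ?S" by simp
  qed
  ultimately show "ideal_I lam \<mu> \<subseteq> cp.span ?S"
    unfolding ideal_I_def by (rule R.genideal_minimal)
  have sub: "cp.subspace (ideal_I lam \<mu>)"
    unfolding cp.subspace_def
  proof (intro conjI allI ballI)
    show "0 \<in> ideal_I lam \<mu>"
      using I.zero_closed by (simp add: invariants_sel)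
  next
    fix x y assume "x \<in> ideal_I lam \<mu>" "y \<in> ideal_I lam \<mu>"
    then show "x + y \<in> ideal_I lam \<mu>"
      using I.a_closed[of x y] by (simp add: invariants_sel)
  next
    fix c x assume "x \<in> ideal_I lam \<mu>"
    then show "const c * x \<in> ideal_I lam \<mu>"
      using I.I_l_closed[of x "const c"] by (simp add: invariants_sel const_closed)
  qed
  show "cp.span ?S \<subseteq> ideal_I lam \<mu>"
  proof (rule cp.span_minimal[OF _ sub], safe)
    fix p g assume p: "p \<in> Inv \<mu>" and g: "g \<in> ideal_gens lam \<mu>"
    have "g \<in> ideal_I lam \<mu>"
      unfolding ideal_I_def using R.genideal_self[OF gens] g by blast
    then show "p * g \<in> ideal_I lam \<mu>"
      using I.I_l_closed[of g p] p by (simp add: invariants_sel)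
  qed
qed

lemma ideal_I_subspace: "cp.subspace (ideal_I lam \<mu>)"
  unfolding ideal_I_eq_span by (rule cp.subspace_span)

lemma ideal_I_mult: "a \<in> Inv \<mu> \<Longrightarrow> f \<in> ideal_I lam \<mu> \<Longrightarrow> a * f \<in> ideal_I lam \<mu>"
  unfolding ideal_I_eq_span by (rule ideal_span_mult)

lemma ideal_gens_ideal_I: "g \<in> ideal_gens lam \<mu> \<Longrightarrow> g \<in> ideal_I lam \<mu>"
  unfolding ideal_I_eq_span by (rule cp.span_base) (use Inv_one in force)

lemma ideal_I_Inv: "f \<in> ideal_I lam \<mu> \<Longrightarrow> f \<in> Inv \<mu>"
  using ideal.Icarr[OF ideal_I_ideal] .

section \<open>Generating functions of complete symmetric functions\<close>

definition Hgf :: "nat set \<Rightarrow> cpoly fps" where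
  "Hgf A = Abs_fps (\<lambda>r. complete_sym A (int r))"

lemma Hgf_nth: "fps_nth (Hgf A) r = complete_sym A (int r)"
  by (simp add: Hgf_def)

text \<open>A monomial over the larger set of variables either omits the new variable or is the new
  variable times a monomial of degree one less.\<close>

lemma complete_sym_insert:
  assumes fin: "finite A" and a: "a \<notin> A"
  shows "complete_sym (insert a A) r = complete_sym A r + var a * complete_sym (insert a A) (r - 1)"
proof -
  define M where "M A r = {m :: nat \<Rightarrow>\<^sub>0 nat. Poly_Mapping.keys m \<subseteq> A
    \<and> int (\<Sum>k\<in>A. Poly_Mapping.lookup m k) = r}" for A r
  let ?s = "Poly_Mapping.single a (1::nat)"
  have M_insert: "m \<in> M (insert a A) r \<longleftrightarrow> Poly_Mapping.keys m \<subseteq> insert a A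
      \<and> int (Poly_Mapping.lookup m a + (\<Sum>k\<in>A. Poly_Mapping.lookup m k)) = r" for m r
    using assms by (simp add: M_def)
  have split: "M (insert a A) r = M A r \<union> (\<lambda>m. m + ?s) ` M (insert a A) (r - 1)"
  proof (intro equalityI subsetI)
    fix m assume m: "m \<in> M (insert a A) r"
    show "m \<in> M A r \<union> (\<lambda>m. m + ?s) ` M (insert a A) (r - 1)"
    proof (cases "Poly_Mapping.lookup m a = 0")
      case True
      then have "a \<notin> Poly_Mapping.keys m" by (simp add: in_keys_iff)
      then show ?thesis using m True unfolding M_insert by (auto simp: M_def)
    next
      case False
      have eq: "m = (m - ?s) + ?s"
        by (rule poly_mapping_eqI) (use False in \<open>auto simp: lookup_add lookup_minus lookup_single when_def\<close>)
      have "Poly_Mapping.keys (m - ?s) \<subseteq> Poly_Mapping.keys m"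
        by (auto simp: in_keys_iff lookup_minus)
      moreover have "(\<Sum>k\<in>A. Poly_Mapping.lookup (m - ?s) k) = (\<Sum>k\<in>A. Poly_Mapping.lookup m k)"
        using a by (intro sum.cong) (auto simp: lookup_minus lookup_single when_def)
      moreover have "Poly_Mapping.lookup (m - ?s) a = Poly_Mapping.lookup m a - 1"
        by (simp add: lookup_minus)
      ultimately have "m - ?s \<in> M (insert a A) (r - 1)"
        using m False unfolding M_insert by auto
      then show ?thesis using eq by blast
    qed
  next
    fix m assume "m \<in> M A r \<union> (\<lambda>m. m + ?s) ` M (insert a A) (r - 1)"
    then show "m \<in> M (insert a A) r"
    proof
      assume m: "m \<in> M A r"
      then have "a \<notin> Poly_Mapping.keys m" using a by (auto simp: M_def)
      then show ?thesis using m unfolding M_insert by (auto simp: M_def in_keys_iff)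
    next
      assume "m \<in> (\<lambda>m. m + ?s) ` M (insert a A) (r - 1)"
      then obtain m' where m': "m = m' + ?s" "m' \<in> M (insert a A) (r - 1)" by blast
      have "(\<Sum>k\<in>A. Poly_Mapping.lookup m k) = (\<Sum>k\<in>A. Poly_Mapping.lookup m' k)"
        using a by (intro sum.cong) (auto simp: m'(1) lookup_add lookup_single when_def)
      moreover have "Poly_Mapping.lookup m a = Poly_Mapping.lookup m' a + 1"
        by (simp add: m'(1) lookup_add)
      moreover have "Poly_Mapping.keys m \<subseteq> insert a A"
        using m' Poly_Mapping.keys_add[of m' ?s] unfolding M_insert by auto
      ultimately show ?thesis using m'(2) unfolding M_insert by auto
    qed
  qed
  have fM: "finite (M A r)" "finite (M (insert a A) (r - 1))"
    unfolding M_def using finite_monomials[of A] finite_monomials[of "insert a A"] fin by blast+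
  have disj: "M A r \<inter> (\<lambda>m. m + ?s) ` M (insert a A) (r - 1) = {}"
  proof -
    have "Poly_Mapping.lookup m a = 0" if "m \<in> M A r" for m
      using that a unfolding M_def by (metis (mono_tags, lifting) in_keys_iff mem_Collect_eq subsetD)
    moreover have "Poly_Mapping.lookup (m + ?s) a \<noteq> 0" for m
      by (simp add: lookup_add)
    ultimately show ?thesis by (metis (no_types, lifting) disjoint_iff imageE)
  qed
  have "complete_sym (insert a A) r = (\<Sum>m\<in>M (insert a A) r. Poly_Mapping.single m 1)"
    by (simp only: complete_sym_def M_def)
  also have "\<dots> = (\<Sum>m\<in>M A r. Poly_Mapping.single m 1) +
      (\<Sum>m\<in>(\<lambda>m. m + ?s) ` M (insert a A) (r - 1). Poly_Mapping.single m 1)"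
    unfolding split by (rule sum.union_disjoint) (use fM disj in auto)
  also have "(\<Sum>m\<in>(\<lambda>m. m + ?s) ` M (insert a A) (r - 1). Poly_Mapping.single m (1::complex))
      = (\<Sum>m\<in>M (insert a A) (r - 1). Poly_Mapping.single (m + ?s) 1)"
    by (rule sum.reindex_cong[where l = "\<lambda>m. m + ?s"]) (auto simp: inj_on_def)
  also have "\<dots> = var a * complete_sym (insert a A) (r - 1)"
    by (simp add: complete_sym_def M_def sum_distrib_left var_def mult_single add.commute
        del: of_nat_sum)
  finally show ?thesis
    by (simp only: complete_sym_def M_def)
qed

lemma Hgf_insert:
  assumes "finite A" "a \<notin> A"
  shows "Hgf (insert a A) * (1 - fps_const (var a) * fps_X) = Hgf A"
proof (rule fps_ext)
  fix r
  show "fps_nth (Hgf (insert a A) * (1 - fps_const (var a) * fps_X)) r = fps_nth (Hgf A) r"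
  proof (cases r)
    case 0
    then show ?thesis
      using assms by (simp add: Hgf_nth complete_sym_zero)
  next
    case (Suc s)
    have "Hgf (insert a A) * (1 - fps_const (var a) * fps_X)
        = Hgf (insert a A) - fps_const (var a) * (Hgf (insert a A) * fps_X)"
      by (simp add: algebra_simps)
    then have "fps_nth (Hgf (insert a A) * (1 - fps_const (var a) * fps_X)) r
        = complete_sym (insert a A) (int r) - var a * complete_sym (insert a A) (int s)"
      by (simp add: Suc Hgf_nth)
    then show ?thesis
      using complete_sym_insert[OF assms, of "int r"] by (simp add: Suc Hgf_nth)
  qed
qed

lemma complete_sym_empty: "complete_sym {} r = (if r = 0 then 1 else 0)"
proof (cases "r = 0")
  case True
  then show ?thesis using complete_sym_zero[of "{}"] by simp
qed (simp add: complete_sym_def)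

lemma Hgf_empty: "Hgf {} = 1"
  by (rule fps_ext) (simp add: Hgf_nth complete_sym_empty)

lemma Hgf_prod: "finite A \<Longrightarrow> Hgf A * (\<Prod>a\<in>A. 1 - fps_const (var a) * fps_X) = 1"
proof (induction A rule: finite_induct)
  case (insert a A)
  then show ?case
    using Hgf_insert[of A a] by (simp add: mult.assoc[symmetric])
qed (simp add: Hgf_empty)

lemma Hgf_union:
  assumes "finite A" "finite B" "A \<inter> B = {}"
  shows "Hgf (A \<union> B) = Hgf A * Hgf B"
  using assms
proof (induction A rule: finite_induct)
  case (insert a A)
  let ?f = "1 - fps_const (var a) * fps_X :: cpoly fps"
  have "Hgf (insert a A \<union> B) * ?f = Hgf (insert a A) * Hgf B * ?f"
  proof -
    have "Hgf (insert a A \<union> B) * ?f = Hgf (A \<union> B)"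
      using insert Hgf_insert[of "A \<union> B" a] by simp
    also have "\<dots> = (Hgf (insert a A) * ?f) * Hgf B"
      using insert Hgf_insert[of A a] by simp
    finally show ?thesis by (simp only: mult_ac)
  qed
  \<comment> \<open>Power series over \<open>cpoly\<close> have no zero divisors, so the common
    factor can be cancelled once it is known to be nonzero; its constant term is 1.\<close>
  moreover have "?f \<noteq> 0"
  proof
    assume "?f = 0"
    then have "fps_nth ?f 0 = 0" by (simp only: fps_zero_nth)
    then show False by simp
  qed
  ultimately show ?case by simp
qed (simp add: Hgf_empty)

lemma complete_sym_union:
  assumes "finite A" "finite B" "A \<inter> B = {}"
  shows "complete_sym (A \<union> B) r = (\<Sum>s = 0..nat r. complete_sym A (int s) * complete_sym B (r - int s))"
proof (cases "r < 0")
  case True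
  then show ?thesis by (simp add: complete_sym_neg)
next
  case False
  then have "complete_sym (A \<union> B) r = fps_nth (Hgf A * Hgf B) (nat r)"
    using Hgf_union[OF assms] Hgf_nth[of "A \<union> B" "nat r"] by simp
  also have "\<dots> = (\<Sum>s = 0..nat r. complete_sym A (int s) * complete_sym B (int (nat r - s)))"
    by (simp add: fps_mult_nth Hgf_nth)
  also have "\<dots> = (\<Sum>s = 0..nat r. complete_sym A (int s) * complete_sym B (r - int s))"
    using False by (intro sum.cong) (auto simp: of_nat_diff)
  finally show ?thesis .
qed

section \<open>Monomials and permutations of the variables\<close>

lemma sum_singles: "(\<Sum>m\<in>Poly_Mapping.keys p. Poly_Mapping.single m (Poly_Mapping.lookup p m)) = p"
proof (rule poly_mapping_eqI)
  fix m
  have "(\<Sum>i\<in>Poly_Mapping.keys p. Poly_Mapping.lookup (Poly_Mapping.single i (Poly_Mapping.lookup p i)) m)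
      = (\<Sum>i\<in>Poly_Mapping.keys p. if i = m then Poly_Mapping.lookup p i else 0)"
    by (intro sum.cong) (auto simp: lookup_single when_def)
  then show "Poly_Mapping.lookup (\<Sum>m\<in>Poly_Mapping.keys p. Poly_Mapping.single m (Poly_Mapping.lookup p m)) m
      = Poly_Mapping.lookup p m"
    by (simp add: lookup_sum in_keys_iff)
qed

lemma single_eq_prod:
  assumes "finite A" "Poly_Mapping.keys m \<subseteq> A"
  shows "Poly_Mapping.single m c = const c * (\<Prod>i\<in>A. var i ^ Poly_Mapping.lookup m i)"
proof -
  have pow: "var i ^ e = Poly_Mapping.single (Poly_Mapping.single i e) 1" for i e
    by (induction e) (simp_all add: var_def mult_single single_add[symmetric])
  have prod: "(\<Prod>i\<in>B. var i ^ Poly_Mapping.lookup m i)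
      = Poly_Mapping.single (\<Sum>i\<in>B. Poly_Mapping.single i (Poly_Mapping.lookup m i)) 1"
    if "finite B" for B
    using that by (induction B rule: finite_induct) (simp_all add: pow mult_single)
  have "(\<Sum>i\<in>A. Poly_Mapping.single i (Poly_Mapping.lookup m i))
      = (\<Sum>i\<in>Poly_Mapping.keys m. Poly_Mapping.single i (Poly_Mapping.lookup m i))"
    by (rule sum.mono_neutral_right) (use assms in \<open>auto simp: in_keys_iff\<close>)
  also have "\<dots> = m" by (rule sum_singles)
  finally show ?thesis
    by (simp add: prod[OF assms(1)] const_def mult_single)
qed

lemma permute_vars_zero: "bij \<sigma> \<Longrightarrow> permute_vars \<sigma> 0 = 0"
  using permute_vars_const[of \<sigma> 0] by (simp add: const_zero)

lemma permute_vars_one: "bij \<sigma> \<Longrightarrow> permute_vars \<sigma> 1 = 1"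
  using permute_vars_const[of \<sigma> 1] by (simp add: const_one)

lemma permute_vars_sum: "bij \<sigma> \<Longrightarrow> permute_vars \<sigma> (sum f A) = (\<Sum>i\<in>A. permute_vars \<sigma> (f i))"
  by (induction A rule: infinite_finite_induct) (simp_all add: permute_vars_zero permute_vars_add)

lemma permute_vars_prod: "bij \<sigma> \<Longrightarrow> permute_vars \<sigma> (prod f A) = (\<Prod>i\<in>A. permute_vars \<sigma> (f i))"
  by (induction A rule: infinite_finite_induct) (simp_all add: permute_vars_one permute_vars_mult)

lemma permute_vars_power: "bij \<sigma> \<Longrightarrow> permute_vars \<sigma> (p ^ e) = permute_vars \<sigma> p ^ e"
  by (induction e) (simp_all add: permute_vars_one permute_vars_mult)

lemma permute_vars_comp:
  assumes "bij \<sigma>" "bij \<tau>"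
  shows "permute_vars \<sigma> (permute_vars \<tau> p) = permute_vars (\<sigma> \<circ> \<tau>) p"
proof (rule poly_mapping_eqI)
  fix m :: "nat \<Rightarrow>\<^sub>0 nat"
  have "Poly_Mapping.map_key \<tau> (Poly_Mapping.map_key \<sigma> m) = Poly_Mapping.map_key (\<sigma> \<circ> \<tau>) m"
    by (rule poly_mapping_eqI) (simp add: map_key_perm assms bij_comp)
  then show "Poly_Mapping.lookup (permute_vars \<sigma> (permute_vars \<tau> p)) m
      = Poly_Mapping.lookup (permute_vars (\<sigma> \<circ> \<tau>) p) m"
    by (simp add: lookup_permute_vars assms bij_comp)
qed

lemma permute_vars_Pol_id:
  assumes p: "p \<in> Pol d" and \<sigma>: "bij \<sigma>" "\<And>i. i \<in> {1..d} \<Longrightarrow> \<sigma> i = i"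
  shows "permute_vars \<sigma> p = p"
proof -
  have "permute_vars \<sigma> (Poly_Mapping.single m c) = Poly_Mapping.single m c"
    if "m \<in> Poly_Mapping.keys p" for m c
  proof -
    have "Poly_Mapping.keys m \<subseteq> {1..d}" using p that by (auto simp: Pol_def)
    then show ?thesis
      using \<sigma> by (simp add: single_eq_prod[of "{1..d}"] permute_vars_mult permute_vars_prod
          permute_vars_power permute_vars_var permute_vars_const)
  qed
  then have "permute_vars \<sigma> (\<Sum>m\<in>Poly_Mapping.keys p. Poly_Mapping.single m (Poly_Mapping.lookup p m))
      = (\<Sum>m\<in>Poly_Mapping.keys p. Poly_Mapping.single m (Poly_Mapping.lookup p m))"
    by (simp add: permute_vars_sum \<sigma>)
  then show ?thesis by (simp only: sum_singles)
qed

section \<open>Splitting off the last block\<close>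

lemma block_butlast: "j < length \<mu> \<Longrightarrow> block (butlast \<mu>) j = block \<mu> j"
  by (simp add: block_def take_butlast)

lemma sum_list_butlast: "\<mu> \<noteq> [] \<Longrightarrow> sum_list \<mu> = sum_list (butlast \<mu>) + last \<mu>"
  by (metis append_butlast_last_id sum_list_append sum_list.Cons sum_list.Nil add.right_neutral)

lemma block_last:
  assumes "\<mu> \<noteq> []"
  shows "block \<mu> (length \<mu>) = {sum_list (butlast \<mu>) + 1..sum_list \<mu>}"
  using assms by (auto simp: block_def butlast_conv_take)

lemma block_disjoint: 
  assumes "i \<noteq> j" "1 \<le> i" "1 \<le> j"
  shows "block \<mu> i \<inter> block \<mu> j = {}"
proof -
  have "block \<mu> i \<inter> block \<mu> j = {}" if "i < j" for i j
  proof -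
    have "j - 1 = i + (j - 1 - i)" using that by simp
    then obtain e where "j - 1 = i + e" by blast
    then have "take (j - 1) \<mu> = take i \<mu> @ take e (drop i \<mu>)"
      by (simp add: take_add)
    then have "sum_list (take i \<mu>) \<le> sum_list (take (j - 1) \<mu>)" by simp
    then show ?thesis by (auto simp: block_def)
  qed
  from this[of i j] this[of j i] show ?thesis
    using assms(1) by (metis inf_commute linorder_neqE_nat)
qed

lemma finite_block: "finite (block \<mu> j)"
proof -
  have "block \<mu> j = {sum_list (take (j - 1) \<mu>) + 1..sum_list (take j \<mu>)}"
    by (auto simp: block_def)
  then show ?thesis by simp
qed

lemma block_Un: "(\<Union>j\<in>{1..length \<mu>}. block \<mu> j) = {1..sum_list \<mu>}"
proof (induction \<mu> rule: rev_induct)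
  case (snoc k \<mu>)
  have "(\<Union>j\<in>{1..length (\<mu> @ [k])}. block (\<mu> @ [k]) j)
      = (\<Union>j\<in>{1..length \<mu>}. block (\<mu> @ [k]) j) \<union> block (\<mu> @ [k]) (length (\<mu> @ [k]))"
    by (auto simp: atLeastAtMostSuc_conv)
  also have "(\<Union>j\<in>{1..length \<mu>}. block (\<mu> @ [k]) j) = {1..sum_list \<mu>}"
    unfolding snoc.IH[symmetric] using block_butlast[of _ "\<mu> @ [k]"] by auto
  also have "block (\<mu> @ [k]) (length (\<mu> @ [k])) = {sum_list \<mu> + 1..sum_list (\<mu> @ [k])}"
    by (subst block_last) auto
  finally show ?case by auto
qed simp

lemma Pol_mono: "d \<le> e \<Longrightarrow> Pol d \<subseteq> Pol e"
  by (fastforce simp: Pol_def)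

lemma hsym_butlast:
  assumes "I \<subseteq> {1..length (butlast \<mu>)}"
  shows "hsym (butlast \<mu>) I r = hsym \<mu> I r"
proof -
  have "(\<Union>i\<in>I. block (butlast \<mu>) i) = (\<Union>i\<in>I. block \<mu> i)"
    using assms by (intro SUP_cong refl block_butlast) force
  then show ?thesis by (simp add: hsym_def)
qed

text \<open>A permutation that preserves each block preserves the union of the first blocks. Its
  restriction there, continued by the identity, is the required element.\<close>

lemma young_subgroup_butlast:
  assumes \<sigma>: "\<sigma> \<in> young_subgroup \<mu>" and ne: "\<mu> \<noteq> []"
  obtains \<tau> where "\<tau> \<in> young_subgroup (butlast \<mu>)" "\<And>i. i \<in> {1..sum_list (butlast \<mu>)} \<Longrightarrow> \<tau> i = \<sigma> i"
proof
  let ?D = "{1..sum_list (butlast \<mu>)}"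
  define \<tau> where "\<tau> i = (if i \<in> ?D then \<sigma> i else i)" for i
  have bl: "\<sigma> ` block (butlast \<mu>) j = block (butlast \<mu>) j" if "j \<in> {1..length (butlast \<mu>)}" for j
  proof -
    have "block (butlast \<mu>) j = block \<mu> j" using that by (intro block_butlast) auto
    moreover have "j \<in> {1..length \<mu>}" using that by auto
    ultimately show ?thesis using \<sigma> by (simp add: young_subgroup_def)
  qed
  have "\<sigma> ` (\<Union>j\<in>{1..length (butlast \<mu>)}. block (butlast \<mu>) j)
      = (\<Union>j\<in>{1..length (butlast \<mu>)}. block (butlast \<mu>) j)"
    unfolding image_UN by (intro SUP_cong refl bl)
  then have img: "\<sigma> ` ?D = ?D" by (simp only: block_Un)
  have "\<tau> permutes ?D"
  proof (rule bij_imp_permutes)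
    have "inj_on \<sigma> ?D" using young_subgroup_bij[OF \<sigma>] by (meson bij_is_inj inj_on_subset subset_UNIV)
    then have "bij_betw \<sigma> ?D ?D" using img by (simp add: bij_betw_def)
    then show "bij_betw \<tau> ?D ?D"
      by (rule bij_betw_cong[THEN iffD1, rotated]) (simp add: \<tau>_def)
  qed (simp add: \<tau>_def del: atLeastAtMost_iff)
  moreover have "\<tau> ` block (butlast \<mu>) j = block (butlast \<mu>) j" if "j \<in> {1..length (butlast \<mu>)}" for j
  proof -
    have "\<tau> ` block (butlast \<mu>) j = \<sigma> ` block (butlast \<mu>) j"
      using block_subset[OF that] by (intro image_cong) (auto simp: \<tau>_def)
    then show ?thesis using bl[OF that] by simp
  qed
  ultimately show "\<tau> \<in> young_subgroup (butlast \<mu>)"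
    by (simp add: young_subgroup_def)
  show "\<tau> i = \<sigma> i" if "i \<in> ?D" for i using that by (simp add: \<tau>_def)
qed

lemma permute_vars_cong:
  assumes p: "p \<in> Pol d" and "bij \<sigma>" "bij \<tau>" "\<And>i. i \<in> {1..d} \<Longrightarrow> \<sigma> i = \<tau> i"
  shows "permute_vars \<sigma> p = permute_vars \<tau> p"
proof -
  have "permute_vars (inv_into UNIV \<tau> \<circ> \<sigma>) p = p"
    by (rule permute_vars_Pol_id[OF p])
      (use assms in \<open>auto simp: bij_comp bij_imp_bij_inv bij_is_inj inv_f_eq\<close>)
  then have "permute_vars \<tau> (permute_vars (inv_into UNIV \<tau> \<circ> \<sigma>) p) = permute_vars \<tau> p" by simp
  moreover have "\<tau> \<circ> (inv_into UNIV \<tau> \<circ> \<sigma>) = \<sigma>"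
    using assms(3) by (simp add: fun_eq_iff bij_is_surj surj_f_inv_f)
  ultimately show ?thesis
    using assms by (simp add: permute_vars_comp bij_comp bij_imp_bij_inv)
qed

lemma Inv_butlast:
  assumes p: "p \<in> Inv (butlast \<mu>)" and ne: "\<mu> \<noteq> []"
  shows "p \<in> Inv \<mu>"
  unfolding Inv_iff
proof (intro conjI ballI)
  show "p \<in> Pol (sum_list \<mu>)"
    using p Pol_mono[of "sum_list (butlast \<mu>)" "sum_list \<mu>"] sum_list_butlast[OF ne]
    by (auto simp: Inv_iff)
  fix \<sigma> assume \<sigma>: "\<sigma> \<in> young_subgroup \<mu>"
  obtain \<tau> where \<tau>: "\<tau> \<in> young_subgroup (butlast \<mu>)"
    "\<And>i. i \<in> {1..sum_list (butlast \<mu>)} \<Longrightarrow> \<tau> i = \<sigma> i"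
    by (rule young_subgroup_butlast[OF \<sigma> ne]) blast
  have "permute_vars \<sigma> p = permute_vars \<tau> p"
    using p \<tau> by (intro permute_vars_cong[of p "sum_list (butlast \<mu>)"])
      (auto simp: Inv_iff young_subgroup_bij[OF \<sigma>] young_subgroup_bij[OF \<tau>(1)])
  then show "permute_vars \<sigma> p = p" using p \<tau>(1) by (simp add: Inv_iff)
qed

lemma tab_h_Nil: "tab_h [] T = 1"
  by (simp add: tab_h.simps)

lemma tab_h_rec:
  "\<mu> \<noteq> [] \<Longrightarrow> tab_h \<mu> T = tab_h (butlast \<mu>) (remove_entry (length \<mu>) T)
      * (\<Prod>i = 1..last \<mu>. hsym \<mu> {length \<mu>} (gamma_part (length \<mu>) (last \<mu>) T i))"
  by (subst tab_h.simps) (simp add: Let_def)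

lemma tab_h_Inv: "tab_h \<mu> T \<in> Inv \<mu>"
proof (induction \<mu> arbitrary: T rule: rev_induct)
  case Nil
  then show ?case by (simp add: tab_h_Nil Inv_one)
next
  case (snoc k \<mu>)
  have "tab_h \<mu> (remove_entry (length (\<mu> @ [k])) T) \<in> Inv (\<mu> @ [k])"
    using Inv_butlast[of _ "\<mu> @ [k]"] snoc.IH by simp
  then show ?case
    by (auto simp: tab_h_rec intro!: Inv_mult Inv_prod hsym_closed)
qed

section \<open>Reinserting the largest entry\<close>

lemma sorted_ge_nth_greater:
  fixes xs :: "nat list"
  assumes "sorted_wrt (\<ge>) xs" "i < length xs"
  shows "r < xs ! i \<longleftrightarrow> i < length (filter (\<lambda>x. r < x) xs)"
  using assms
proof (induction xs arbitrary: i)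
  case (Cons x xs)
  show ?case
  proof (cases "r < x")
    case True
    then show ?thesis using Cons by (cases i) auto
  next
    case False
    then have "filter (\<lambda>x. r < x) xs = []"
      using Cons.prems(1) by (fastforce simp: filter_empty_conv)
    moreover have "(x # xs) ! i \<le> x"
      using Cons.prems by (cases i) auto
    ultimately show ?thesis using False by auto
  qed
qed simp

text \<open>A partition is determined by its conjugate. Column lengths of two tableaux are compared
  in this way, row by row.\<close>

lemma sorted_ge_eqI:
  fixes xs ys :: "nat list"
  assumes "sorted_wrt (\<ge>) xs" "sorted_wrt (\<ge>) ys" "length xs = length ys"
    "\<And>r. length (filter (\<lambda>x. r < x) xs) = length (filter (\<lambda>x. r < x) ys)"
  shows "xs = ys"
proof (rule nth_equalityI[OF assms(3)])
  fix i assume i: "i < length xs"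
  have "r < xs ! i \<longleftrightarrow> r < ys ! i" for r
    using sorted_ge_nth_greater[OF assms(1) i, of r] sorted_ge_nth_greater[OF assms(2), of i r] i assms(3,4)
    by simp
  then show "xs ! i = ys ! i" by (metis less_irrefl linorder_neqE_nat)
qed

lemma sort_key_map: "sort_key f (map g xs) = map g (sort_key (\<lambda>x. f (g x)) xs)"
proof (induction xs)
  case (Cons x xs)
  have "insort_key f (g x) (map g ys) = map g (insort_key (\<lambda>x. f (g x)) x ys)" for ys
    by (induction ys) auto
  then show ?case using Cons by simp
qed simp

lemma count_list_concat: "count_list (concat xs) x = (\<Sum>c\<leftarrow>xs. count_list c x)"
  by (induction xs) auto

lemma sum_list_map_mset_eq:
  fixes f :: "'a \<Rightarrow> nat"
  assumes "mset xs = mset ys"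
  shows "(\<Sum>x\<leftarrow>xs. f x) = (\<Sum>x\<leftarrow>ys. f x)"
  using assms by (metis mset_map sum_mset_sum_list)

lemma partition_prefix:
  fixes lam :: "nat list"
  assumes "sorted_wrt (\<ge>) lam"
  shows "{r. r < length lam \<and> i < lam ! r} = {..<length (filter (\<lambda>x. i < x) lam)}"
proof -
  have "r < length lam" if "r < length (filter (\<lambda>x. i < x) lam)" for r
    using that length_filter_le[of "\<lambda>x. i < x" lam] by (rule less_le_trans)
  then show ?thesis using sorted_ge_nth_greater[OF assms, of _ i] by blast
qed

text \<open>The box condition in the zero-based form of list indices, whereas \<open>boxes\<close>
  and \<open>young_diagram\<close> count from 1.\<close>

lemma Col_memI_columns:
  assumes "[] \<notin> set T" "\<And>r c. r < length lam \<and> c < lam ! r \<longleftrightarrow> c < length T \<and> r < length (T ! c)"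
    "\<And>cc. cc \<in> set T \<Longrightarrow> sorted_wrt (<) cc"
    "\<And>i. count_list (concat T) i = (if i \<in> {1..length \<mu>} then \<mu> ! (i - 1) else 0)"
  shows "T \<in> Col lam \<mu>"
proof -
  have "boxes T = young_diagram lam"
  proof (rule Set.set_eqI)
    fix p :: "nat \<times> nat"
    obtain r c where p: "p = (r, c)" by (cases p)
    show "p \<in> boxes T \<longleftrightarrow> p \<in> young_diagram lam"
      using assms(2)[of "r - 1" "c - 1"] unfolding p
      by (cases r; cases c) (auto simp: boxes_def young_diagram_def Suc_le_eq)
  qed
  then show ?thesis using assms by (simp add: Col_def)
qed

lemma Col_columns:
  assumes "T \<in> Col lam \<mu>"
  shows "r < length lam \<and> c < lam ! r \<longleftrightarrow> c < length T \<and> r < length (T ! c)"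
proof -
  have "(r + 1, c + 1) \<in> boxes T \<longleftrightarrow> (r + 1, c + 1) \<in> young_diagram lam"
    using assms by (simp add: Col_def)
  then show ?thesis by (auto simp: boxes_def young_diagram_def Suc_le_eq)
qed

lemma Col_entries:
  assumes "T \<in> Col lam \<mu>" "cc \<in> set T" "x \<in> set cc"
  shows "x \<in> {1..length \<mu>}"
proof (rule ccontr)
  assume "x \<notin> {1..length \<mu>}"
  then have "count_list (concat T) x = 0" using assms(1) by (auto simp: Col_def)
  then have "x \<notin> set (concat T)" by (metis count_list_0_iff)
  then show False using assms by auto
qed

lemma card_shift: "card {i::nat. i < N \<and> i + 1 \<in> C} = card (C \<inter> {1..N})"
  by (rule bij_betw_same_card[of "\<lambda>i. i + 1"])
    (rule bij_betw_byWitness[where f' = "\<lambda>c. c - 1"], auto)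

text \<open>The columns receiving the entry \<open>n\<close> are the \<open>g\<^sub>i + k - i + 1\<close>, \<open>1 \<le> i \<le> k\<close>.\<close>

definition col_set :: "nat list \<Rightarrow> nat set" where
  "col_set g = (\<lambda>a. g ! a + (length g - a)) ` {..<length g}"

text \<open>A column with index in the interval between two consecutive rows of \<lambda> has its
  bottom box in the longer of the two, so exactly the chosen columns in that interval shorten this
  row.\<close>

definition removed_shape :: "nat list \<Rightarrow> nat list \<Rightarrow> nat list" where
  "removed_shape lam g = map (\<lambda>r. lam ! r - card (col_set g \<inter> {lam ! (r + 1)<..lam ! r})) [0..<length lam - 1]"

text \<open>The elements of \<open>col_set g\<close> in the increasing order used by
  \<open>entry_cols\<close>. Reading g backwards gives a weakly increasing list, which the shift by
  \<open>j + 1\<close> makes strictly increasing.\<close>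

definition col_list :: "nat list \<Rightarrow> nat list" where
  "col_list g = map (\<lambda>j. g ! (length g - 1 - j) + (j + 1)) [0..<length g]"

lemma col_list:
  assumes "sorted_wrt (\<ge>) g"
  shows "set (col_list g) = col_set g" "sorted_wrt (<) (col_list g)"
proof -
  let ?k = "length g"
  have "col_set g = (\<lambda>j. g ! (?k - 1 - j) + (j + 1)) ` {..<?k}"
    unfolding col_set_def
  proof (intro equalityI image_subsetI)
    fix a assume "a \<in> {..<?k}"
    then show "g ! a + (?k - a) \<in> (\<lambda>j. g ! (?k - 1 - j) + (j + 1)) ` {..<?k}"
      by (intro image_eqI[of _ _ "?k - 1 - a"]) auto
  next
    fix j assume "j \<in> {..<?k}"
    then show "g ! (?k - 1 - j) + (j + 1) \<in> (\<lambda>a. g ! a + (?k - a)) ` {..<?k}"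
      by (intro image_eqI[of _ _ "?k - 1 - j"]) auto
  qed
  then show "set (col_list g) = col_set g" by (simp add: col_list_def atLeast0LessThan)
  have "g ! (?k - 1 - i) \<le> g ! (?k - 1 - j)" if "i < j" "j < ?k" for i j
    using assms that by (simp add: sorted_wrt_iff_nth_less)
  then show "sorted_wrt (<) (col_list g)"
    by (auto simp: col_list_def sorted_wrt_iff_nth_less intro: add_le_less_mono)
qed

lemma card_col_set: "sorted_wrt (\<ge>) g \<Longrightarrow> card (col_set g) = length g"
  using col_list[of g] distinct_card[of "col_list g"]
  by (simp add: strict_sorted_iff col_list_def)

text \<open>The intervals between consecutive rows partition the one from \<open>lam ! m\<close> to
  \<open>lam ! 0\<close>, so the losses add up. The cardinality is the drop of the ideal's bound for
  m blocks on passing to the smaller shape.\<close>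

lemma sum_removed_shape:
  assumes lam: "sorted_wrt (\<ge>) lam" and m: "m < length lam"
  shows "sum_list (take m (removed_shape lam g)) + card (col_set g \<inter> {lam ! m<..lam ! 0})
    = sum_list (take m lam)"
  using m
proof (induction m)
  case (Suc m)
  let ?C = "col_set g"
  have fin: "finite ?C" by (simp add: col_set_def)
  have ord: "lam ! Suc m \<le> lam ! m" "lam ! m \<le> lam ! 0"
    using lam Suc.prems by (cases m; auto simp: sorted_wrt_iff_nth_less)+
  have "card (?C \<inter> {lam ! Suc m<..lam ! m}) \<le> card {lam ! Suc m<..lam ! m}"
    by (rule card_mono) auto
  then have le: "card (?C \<inter> {lam ! Suc m<..lam ! m}) \<le> lam ! m" by simp
  have "?C \<inter> {lam ! Suc m<..lam ! 0} = (?C \<inter> {lam ! Suc m<..lam ! m}) \<union> (?C \<inter> {lam ! m<..lam ! 0})"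
    using ord by auto
  then have "card (?C \<inter> {lam ! Suc m<..lam ! 0})
      = card (?C \<inter> {lam ! Suc m<..lam ! m}) + card (?C \<inter> {lam ! m<..lam ! 0})"
    by (simp only:) (rule card_Un_disjoint, auto simp: fin)
  moreover have "take (Suc m) (removed_shape lam g) = take m (removed_shape lam g)
      @ [lam ! m - card (?C \<inter> {lam ! Suc m<..lam ! m})]"
    using Suc.prems by (subst take_Suc_conv_app_nth) (auto simp: removed_shape_def)
  moreover have "take (Suc m) lam = take m lam @ [lam ! m]"
    using Suc.prems by (simp add: take_Suc_conv_app_nth)
  ultimately show ?case using Suc.IH Suc.prems le by simp
qed simp

text \<open>The deleted boxes form a horizontal strip, hence the two shapes interlace.\<close>

lemma removed_shape_le:
  assumes "sorted_wrt (\<ge>) lam" "r + 1 < length lam"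
  shows "lam ! (r + 1) \<le> removed_shape lam g ! r" "removed_shape lam g ! r \<le> lam ! r"
proof -
  have "card (col_set g \<inter> {lam ! (r + 1)<..lam ! r}) \<le> card {lam ! (r + 1)<..lam ! r}"
    by (rule card_mono) auto
  moreover have "lam ! (r + 1) \<le> lam ! r" using assms by (simp add: sorted_wrt_iff_nth_less)
  moreover have r: "r < length lam - 1" using assms(2) by simp
  ultimately show "lam ! (r + 1) \<le> removed_shape lam g ! r"
    by (simp add: removed_shape_def)
  show "removed_shape lam g ! r \<le> lam ! r" using r by (simp add: removed_shape_def)
qed

lemma length_removed_shape: "length (removed_shape lam g) = length lam - 1"
  by (simp add: removed_shape_def)

text \<open>The columns of full length n are those up to \<open>lam ! (n - 1)\<close>. All of them
  are chosen, so the last row disappears completely and the other rows account for the remaining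
  chosen columns.\<close>

lemma removed_shape_Part:
  assumes lam: "lam \<in> Part n d" and n: "n \<noteq> 0" and g: "sorted_wrt (\<ge>) g"
    and C: "col_set g \<subseteq> {1..lam ! 0}" "{1..lam ! (n - 1)} \<subseteq> col_set g"
  shows "removed_shape lam g \<in> Part (n - 1) (d - length g)"
proof -
  have srt: "sorted_wrt (\<ge>) lam" and len: "length lam = n" and sum: "sum_list lam = d"
    using lam by (auto simp: Part_def Comp_def)
  have fin: "finite (col_set g)" by (simp add: col_set_def)
  have take: "lam = take (n - 1) lam @ [lam ! (n - 1)]"
    using take_Suc_conv_app_nth[of "n - 1" lam] len n by simp
  have "sum_list lam = sum_list (take (n - 1) lam) + lam ! (n - 1)"
    by (subst take) simp
  moreover have "sum_list (removed_shape lam g) + card (col_set g \<inter> {lam ! (n - 1)<..lam ! 0})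
      = sum_list (take (n - 1) lam)"
    using sum_removed_shape[OF srt, of "n - 1" g] len n by (simp add: length_removed_shape)
  moreover have "length g = lam ! (n - 1) + card (col_set g \<inter> {lam ! (n - 1)<..lam ! 0})"
  proof -
    have "col_set g = {1..lam ! (n - 1)} \<union> (col_set g \<inter> {lam ! (n - 1)<..lam ! 0})"
      using C by auto
    then have "card (col_set g) = card ({1..lam ! (n - 1)} \<union> (col_set g \<inter> {lam ! (n - 1)<..lam ! 0}))"
      by (rule arg_cong)
    also have "\<dots> = card {1..lam ! (n - 1)} + card (col_set g \<inter> {lam ! (n - 1)<..lam ! 0})"
      by (rule card_Un_disjoint) auto
    finally show ?thesis by (simp add: card_col_set[OF g])
  qed
  ultimately have "sum_list (removed_shape lam g) = d - length g" using sum by linarith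
  moreover have "sorted_wrt (\<ge>) (removed_shape lam g)"
  proof -
    have "removed_shape lam g ! j \<le> removed_shape lam g ! i" if "i < j" "j < n - 1" for i j
    proof -
      have "removed_shape lam g ! j \<le> lam ! j"
        using removed_shape_le(2)[OF srt, of j g] that len by simp
      also have "\<dots> \<le> lam ! (i + 1)"
        using srt that len by (cases "i + 1 = j") (auto simp: sorted_wrt_iff_nth_less)
      also have "\<dots> \<le> removed_shape lam g ! i"
        using removed_shape_le(1)[OF srt, of i g] that len by simp
      finally show ?thesis .
    qed
    then show ?thesis by (simp add: sorted_wrt_iff_nth_less length_removed_shape len)
  qed
  ultimately show ?thesis by (simp add: Part_def Comp_def length_removed_shape len)
qed

text \<open>Un-sort the columns of \<open>S\<close> (padded by empty columns) into the order in which the columns of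
  the partition \<open>lam\<close> appear after deletion of the bottom boxes of the columns in \<open>col_set g\<close>.\<close>

lemma tab_h_restore_entry:
  assumes lam: "lam \<in> Part (length \<mu>) d" and ne: "\<mu> \<noteq> []"
    and g: "sorted_wrt (\<ge>) g" "length g = last \<mu>"
    and C: "col_set g \<subseteq> {1..lam ! 0}" "{1..lam ! (length \<mu> - 1)} \<subseteq> col_set g"
    and S: "S \<in> Col (removed_shape lam g) (butlast \<mu>)"
  shows "\<exists>T\<in>Col lam \<mu>. tab_h \<mu> T = tab_h (butlast \<mu>) S * (\<Prod>x\<leftarrow>g. hsym \<mu> {length \<mu>} (int x))"
proof -
  define n N k where "n = length \<mu>" and "N = lam ! 0" and "k = length g"
  define C where "C = col_set g"
  have n: "n > 0" using ne by (simp add: n_def)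
  have srt: "sorted_wrt (\<ge>) lam" and len: "length lam = n"
    using lam by (auto simp: Part_def Comp_def n_def)
  have lam_le: "lam ! r \<le> N" if "r < n" for r
    using that srt len by (cases r) (auto simp: sorted_wrt_iff_nth_less N_def)
  define cj where "cj i = length (filter (\<lambda>x. i < x) lam)" for i
  have cj: "r < cj i \<longleftrightarrow> r < n \<and> i < lam ! r" for r i
    using partition_prefix[OF srt, of i] len by (auto simp: cj_def)
  have cj_pos: "0 < cj i" if "i < N" for i using cj[of 0 i] that n by (simp add: N_def)
  define L where "L i = cj i - (if i + 1 \<in> C then 1 else 0)" for i
  define S' where "S' = S @ replicate (N - length S) []"
  \<comment> \<open>The stable order in which \<open>straighten\<close> lists columns of lengths
    \<open>L i\<close>; its inverse tells where each column of \<open>S'\<close> has to be put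
    back.\<close>
  define idx where "idx = sort_key (\<lambda>i. - int (L i)) [0..<N]"
  have Sne: "[] \<notin> set S" and Ssrt: "\<And>cc. cc \<in> set S \<Longrightarrow> sorted_wrt (<) cc"
    and Scnt: "\<And>i. count_list (concat S) i = (if i \<in> {1..n - 1} then butlast \<mu> ! (i - 1) else 0)"
    using S by (auto simp: Col_def n_def)
  have Scol: "r < n - 1 \<and> c < removed_shape lam g ! r \<longleftrightarrow> c < length S \<and> r < length (S ! c)" for r c
    using Col_columns[OF S, of r c] by (simp add: length_removed_shape len)
  have lamb_le: "removed_shape lam g ! r \<le> N" if "r < n - 1" for r
    by (rule le_trans[OF removed_shape_le(2)[OF srt, of r g] lam_le[of r]]) (use that len in auto)
  have lenS: "length S \<le> N"
  proof (cases "length S")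
    case (Suc s)
    then have "S ! s \<in> set S" by simp
    then have "S ! s \<noteq> []" using Sne by metis
    then have "0 < n - 1 \<and> s < removed_shape lam g ! 0" using Scol[of 0 s] Suc by simp
    then show ?thesis using lamb_le[of 0] Suc by simp
  qed simp
  have lenS': "length S' = N" using lenS by (simp add: S'_def)
  have S'_columns: "r < length (S' ! c) \<longleftrightarrow> r < n - 1 \<and> c < removed_shape lam g ! r" if "c < N" for r c
    using Scol[of r c] that by (auto simp: S'_def nth_append)
  have mset_idx: "mset idx = mset [0..<N]" by (simp add: idx_def)
  have len_idx: "length idx = N" by (simp add: idx_def)
  have set_idx: "set idx = {..<N}" by (simp add: idx_def atLeast0LessThan)
  have dist_idx: "distinct idx" by (simp add: idx_def)
  \<comment> \<open>Both lists decrease, and in both the number of entries above r is the length of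
    row r of the smaller shape: a chosen column leaves row r only if its bottom box lies
    there.\<close>
  have lens: "map length S' = map L idx"
  proof (rule sorted_ge_eqI)
    have "length (S' ! j) \<le> length (S' ! i)" if "i < j" "j < N" for i j
    proof (rule ccontr)
      assume "\<not> ?thesis"
      then have "length (S' ! i) < n - 1 \<and> j < removed_shape lam g ! length (S' ! i)"
        using S'_columns[of j "length (S' ! i)"] that by simp
      then have "length (S' ! i) < length (S' ! i)"
        using S'_columns[of i "length (S' ! i)"] that by simp
      then show False by simp
    qed
    then show "sorted_wrt (\<ge>) (map length S')" by (simp add: sorted_wrt_iff_nth_less lenS')
    have "sorted (map (\<lambda>i. - int (L i)) idx)" by (simp add: idx_def)
    then show "sorted_wrt (\<ge>) (map L idx)" by (simp add: sorted_wrt_map)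
    show "length (map length S') = length (map L idx)" by (simp add: lenS' len_idx)
    fix r
    have "length (filter (\<lambda>x. r < x) (map length S')) = card {i. i < N \<and> r < length (S' ! i)}"
      by (simp add: length_filter_conv_card lenS' cong: conj_cong)
    also have "{i. i < N \<and> r < length (S' ! i)} = {i. r < n - 1 \<and> i < removed_shape lam g ! r}"
      using S'_columns lamb_le by fastforce
    also have "card \<dots> = card {i. i < N \<and> r < L i}"
    proof -
      have rL: "r < L i \<longleftrightarrow> r < n \<and> i < lam ! r \<and> \<not> (i + 1 \<in> C \<and> \<not> (r + 1 < n \<and> i < lam ! (r + 1)))" for i
        using cj[of r i] cj[of "r + 1" i] unfolding L_def by auto
      consider "r + 1 < n" | "r + 1 = n" | "n < r + 1" by linarith
      then show ?thesis
      proof cases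
        case 1
        have "{i. i < N \<and> r < L i} = {..<lam ! r} - {i. i < lam ! r \<and> i + 1 \<in> C \<inter> {lam ! (r + 1)<..lam ! r}}"
        proof (rule Set.set_eqI)
          fix i
          show "i \<in> {i. i < N \<and> r < L i}
              \<longleftrightarrow> i \<in> {..<lam ! r} - {i. i < lam ! r \<and> i + 1 \<in> C \<inter> {lam ! (r + 1)<..lam ! r}}"
            using lam_le[of r] 1 by (simp only: mem_Collect_eq rL) auto
        qed
        also have "card \<dots> = lam ! r - card (C \<inter> {lam ! (r + 1)<..lam ! r} \<inter> {1..lam ! r})"
          by (subst card_Diff_subset, simp, force) (simp only: card_shift card_lessThan)
        also have "C \<inter> {lam ! (r + 1)<..lam ! r} \<inter> {1..lam ! r} = C \<inter> {lam ! (r + 1)<..lam ! r}" by auto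
        finally have card: "card {i. i < N \<and> r < L i} = lam ! r - card (C \<inter> {lam ! (r + 1)<..lam ! r})" .
        have "r < n - 1" using 1 by simp
        then show ?thesis using card len by (simp add: removed_shape_def C_def)
      next
        case 2
        have "{i. i < N \<and> r < L i} = {}"
        proof -
          have "\<not> r < L i" for i
          proof
            assume "r < L i"
            then have i: "i < lam ! (n - 1)" "i + 1 \<notin> C" using 2 rL[of i] by auto
            then have "i + 1 \<in> {1..lam ! (length \<mu> - 1)}" by (simp add: n_def)
            then show False using C(2) i(2) unfolding C_def by blast
          qed
          then show ?thesis by blast
        qed
        moreover have "{i. r < n - 1 \<and> i < removed_shape lam g ! r} = {}" using 2 by auto
        ultimately show ?thesis by (simp only:)
      next
        case 3
        then have "{i. i < N \<and> r < L i} = {}" by (auto simp only: rL)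
        moreover have "{i. r < n - 1 \<and> i < removed_shape lam g ! r} = {}" using 3 by auto
        ultimately show ?thesis by (simp only:)
      qed
    qed
    also have "\<dots> = length (filter (\<lambda>i. r < L i) [0..<N])"
      by (simp add: length_filter_conv_card cong: conj_cong)
    also have "\<dots> = length (filter (\<lambda>x. r < x) (map L idx))"
    proof -
      have "mset (filter (\<lambda>i. r < L i) idx) = mset (filter (\<lambda>i. r < L i) [0..<N])"
        by (simp only: mset_filter mset_idx)
      then have "length (filter (\<lambda>i. r < L i) idx) = length (filter (\<lambda>i. r < L i) [0..<N])"
        by (rule mset_eq_length)
      then show ?thesis by (simp add: filter_map comp_def)
    qed
    finally show "length (filter (\<lambda>x. r < x) (map length S')) = length (filter (\<lambda>x. r < x) (map L idx))" .
  qed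
  define pos where "pos = inv_into {..<N} (nth idx)"
  have bij: "bij_betw (nth idx) {..<N} {..<N}"
    by (rule bij_betw_nth[OF dist_idx]) (simp_all add: len_idx set_idx)
  have pos: "idx ! pos i = i" "pos i < N" if "i < N" for i
  proof -
    have "i \<in> nth idx ` {..<N}" using that bij by (simp add: bij_betw_imp_surj_on)
    from f_inv_into_f[OF this] inv_into_into[OF this]
    show "idx ! pos i = i" "pos i < N" by (simp_all add: pos_def)
  qed
  have pos_idx: "pos (idx ! j) = j" if "j < N" for j
    unfolding pos_def using that by (intro inv_into_f_f bij_betw_imp_inj_on[OF bij]) simp
  \<comment> \<open>Beyond column N the value is a dummy of the right length, so that
    \<open>len_t0\<close> holds without side condition and rewrites inside the sort key.\<close>
  define t0 where "t0 i = (if i < N then S' ! pos i else replicate (L i) 0)" for i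
  have len_t0: "length (t0 i) = L i" for i
  proof (cases "i < N")
    case True
    then have "length (S' ! pos i) = map length S' ! pos i" using pos lenS' by simp
    also have "\<dots> = L i" using True pos len_idx by (simp only: lens) simp
    finally show ?thesis using True by (simp add: t0_def)
  qed (simp add: t0_def)
  have t0_idx: "map t0 idx = S'"
  proof (rule nth_equalityI)
    fix j assume "j < length (map t0 idx)"
    then have j: "j < N" by (simp add: len_idx)
    then have "idx ! j < N" using set_idx len_idx by (metis lessThan_iff nth_mem)
    then show "map t0 idx ! j = S' ! j" using j by (simp add: len_idx t0_def pos_idx)
  qed (simp add: len_idx lenS')
  have t0_mem: "t0 i = [] \<or> t0 i \<in> set S" if "i < N" for i
  proof -
    have "t0 i \<in> set S'" using that pos lenS' by (simp add: t0_def)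
    then show ?thesis by (auto simp: S'_def)
  qed
  have t0_ent: "x < n" if "i < N" "x \<in> set (t0 i)" for i x
    using t0_mem[OF that(1)] Col_entries[OF S, of "t0 i" x] that(2) n by (auto simp: n_def)
  have t0_srt: "sorted_wrt (<) (t0 i)" if "i < N" for i
    using t0_mem[OF that] Ssrt by auto
  define T where "T = map (\<lambda>i. t0 i @ (if i + 1 \<in> C then [n] else [])) [0..<N]"
  have lenT: "length T = N" by (simp add: T_def)
  have Tcol: "length (T ! i) = cj i" if "i < N" for i
    using that cj_pos[OF that] by (simp add: T_def len_t0 L_def)
  have T: "T \<in> Col lam \<mu>"
  proof (rule Col_memI_columns)
    show "[] \<notin> set T"
    proof
      assume "[] \<in> set T"
      then obtain i where "i < N" "T ! i = []" by (metis in_set_conv_nth lenT)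
      then show False using Tcol[of i] cj_pos[of i] by simp
    qed
    show "r < length lam \<and> c < lam ! r \<longleftrightarrow> c < length T \<and> r < length (T ! c)" for r c
      using cj[of r c] Tcol[of c] lam_le[of r] by (auto simp: len lenT)
    show "sorted_wrt (<) cc" if cc: "cc \<in> set T" for cc
    proof -
      obtain i where "i < N" "cc = t0 i @ (if i + 1 \<in> C then [n] else [])"
        using cc by (auto simp: T_def)
      then show ?thesis using t0_srt[of i] t0_ent[of i] by (auto simp: sorted_wrt_append)
    qed
    fix x
    have "count_list (concat T) x = (\<Sum>i\<leftarrow>[0..<N]. count_list (t0 i) x)
        + (\<Sum>i\<leftarrow>[0..<N]. count_list (if i + 1 \<in> C then [n] else []) x)"
      by (simp add: count_list_concat T_def sum_list_addf comp_def)
    also have "(\<Sum>i\<leftarrow>[0..<N]. count_list (t0 i) x) = (\<Sum>i\<leftarrow>idx. count_list (t0 i) x)"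
      by (rule sum_list_map_mset_eq) (simp add: mset_idx)
    also have "\<dots> = (\<Sum>c\<leftarrow>S'. count_list c x)"
      unfolding t0_idx[symmetric] by (simp add: comp_def)
    also have "\<dots> = count_list (concat S) x"
      by (simp add: S'_def count_list_concat sum_list_replicate)
    also have "(\<Sum>i\<leftarrow>[0..<N]. count_list (if i + 1 \<in> C then [n] else []) x) = (if x = n then k else 0)"
    proof -
      have "(\<Sum>i\<leftarrow>[0..<N]. count_list (if i + 1 \<in> C then [n] else []) x)
          = (\<Sum>i = 0..<N. if i + 1 \<in> C \<and> x = n then 1 else 0)"
        by (subst sum_list_distinct_conv_sum_set) (auto intro!: sum.cong)
      also have "\<dots> = (if x = n then card {i. i < N \<and> i + 1 \<in> C} else 0)"
        by (auto simp: sum.If_cases Int_def atLeast0LessThan)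
      also have "card {i. i < N \<and> i + 1 \<in> C} = k"
        unfolding card_shift using C(1) card_col_set[OF g(1)]
        by (simp add: C_def k_def N_def Int_absorb2)
      finally show ?thesis .
    qed
    finally have cnt: "count_list (concat T) x = (if x \<in> {1..n - 1} then butlast \<mu> ! (x - 1) else 0)
        + (if x = n then k else 0)" by (simp only: Scnt)
    have "last \<mu> = \<mu> ! (n - 1)" using ne by (simp add: last_conv_nth n_def)
    then show "count_list (concat T) x = (if x \<in> {1..length \<mu>} then \<mu> ! (x - 1) else 0)"
      using g(2) n unfolding cnt by (auto simp: n_def k_def nth_butlast)
  qed
  have rem: "remove_entry n T = S"
  proof -
    have "map (filter (\<lambda>e. e \<noteq> n)) T = map t0 [0..<N]"
      unfolding T_def map_map
    proof (rule map_cong[OF refl])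
      fix i assume "i \<in> set [0..<N]"
      then have "filter (\<lambda>e. e \<noteq> n) (t0 i) = t0 i"
        using t0_ent[of i] by (intro filter_True) auto
      then show "(filter (\<lambda>e. e \<noteq> n) \<circ> (\<lambda>i. t0 i @ (if i + 1 \<in> C then [n] else []))) i = t0 i"
        by simp
    qed
    then have "straighten (map (filter (\<lambda>e. e \<noteq> n)) T) = S'"
      by (simp add: straighten_def sort_key_map len_t0 t0_idx[unfolded idx_def])
    moreover have "filter (\<lambda>cc. cc \<noteq> []) S = S"
      using Sne by (intro filter_True) metis
    ultimately show ?thesis by (simp add: remove_entry_def S'_def)
  qed
  have ent: "entry_cols n T = col_list g"
  proof -
    have "entry_cols n T = filter (\<lambda>c. c \<in> C) [1..<N + 1]"
      unfolding entry_cols_def lenT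
    proof (rule filter_cong[OF refl])
      fix c assume "c \<in> set [1..<N + 1]"
      then have "c - 1 < N" "c - 1 + 1 = c" by auto
      then show "n \<in> set (T ! (c - 1)) \<longleftrightarrow> c \<in> C"
        using t0_ent[of "c - 1" n] by (auto simp: T_def)
    qed
    moreover have "\<dots> = col_list g"
    proof (rule sorted_distinct_set_unique)
      show "set (filter (\<lambda>c. c \<in> C) [1..<N + 1]) = set (col_list g)"
        using C(1) by (auto simp: col_list[OF g(1)] C_def N_def)
    qed (use col_list(2)[OF g(1)] in \<open>auto simp: strict_sorted_iff sorted_wrt_filter simp del: upt_Suc\<close>)
    ultimately show ?thesis by simp
  qed
  have "(\<Prod>i = 1..k. hsym \<mu> {n} (gamma_part n k T i)) = (\<Prod>a = 0..<k. hsym \<mu> {n} (int (g ! a)))"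
  proof (rule prod.reindex_bij_witness[of _ "\<lambda>a. a + 1" "\<lambda>i. i - 1"])
    \<comment> \<open>With j = k + 1 - i, position j - 1 of the column list holds
      \<open>g ! (i - 1) + j\<close>; the subtraction of j in \<open>gamma_part\<close> cancels the
      shift.\<close>
    fix i assume i: "i \<in> {1..k}"
    then have "k + 1 - i - 1 < k" "k - 1 - (k + 1 - i - 1) = i - 1" by auto
    then have "gamma_part n k T i = int (g ! (i - 1))"
      unfolding gamma_part_def ent Let_def using i by (simp add: col_list_def k_def[symmetric])
    then show "hsym \<mu> {n} (int (g ! (i - 1))) = hsym \<mu> {n} (gamma_part n k T i)" by simp
  qed auto
  also have "\<dots> = (\<Prod>x\<leftarrow>g. hsym \<mu> {n} (int x))"
  proof -
    have "map (\<lambda>a. hsym \<mu> {n} (int (g ! a))) [0..<k] = map (\<lambda>x. hsym \<mu> {n} (int x)) g"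
      by (rule nth_equalityI) (simp_all add: k_def)
    then show ?thesis
      using prod.distinct_set_conv_list[of "[0..<k]" "\<lambda>a. hsym \<mu> {n} (int (g ! a))"] by simp
  qed
  finally have "tab_h \<mu> T = tab_h (butlast \<mu>) S * (\<Prod>x\<leftarrow>g. hsym \<mu> {length \<mu>} (int x))"
    using rem g(2) by (subst tab_h_rec[OF ne]) (simp add: n_def k_def)
  then show ?thesis using T by blast
qed

section \<open>Invariants over the invariants of the first blocks\<close>

text \<open>The product is a polynomial of degree at most the number of factors. This serves both
  the expansion of powers of a variable and the vanishing at the points of the tableaux.\<close>

lemma fps_nth_prod_linear:
  fixes f :: "'b \<Rightarrow> 'a :: comm_ring_1"
  assumes "finite C" "s > card C"
  shows "fps_nth (\<Prod>c\<in>C. 1 - fps_const (f c) * fps_X) s = 0"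
  using assms
proof (induction C arbitrary: s rule: finite_induct)
  case (insert c C)
  let ?P = "\<Prod>c\<in>C. 1 - fps_const (f c) * fps_X"
  have "(\<Prod>c\<in>insert c C. 1 - fps_const (f c) * fps_X) = ?P - fps_const (f c) * (?P * fps_X)"
    using insert.hyps by (simp add: algebra_simps)
  moreover obtain s' where "s = Suc s'" using insert.prems by (cases s) auto
  ultimately show ?case using insert by simp
qed auto

lemma var_power: "var i ^ e = Poly_Mapping.single (Poly_Mapping.single i e) 1"
  by (induction e) (simp_all add: var_def mult_single single_add[symmetric])

lemma Hgf_singleton: "fps_nth (Hgf {b}) r = var b ^ r"
proof (induction r)
  case 0
  then show ?case using complete_sym_zero[of "{b}"] by (simp add: Hgf_nth)
next
  case (Suc r)
  then show ?case
    using complete_sym_insert[of "{}" b "int (Suc r)"]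
    by (simp add: Hgf_nth complete_sym_empty)
qed

text \<open>The geometric series of one variable is \<open>Hgf B\<close> times the linear factors of
  the other variables. The coefficients of that polynomial are, up to sign, the elementary symmetric
  functions in \<open>B - {b}\<close>.\<close>

lemma var_power_expand:
  assumes "finite B" "b \<in> B"
  shows "var b ^ r = (\<Sum>s = 0..<card B.
    fps_nth (\<Prod>c\<in>B - {b}. 1 - fps_const (var c) * fps_X) s * complete_sym B (int r - int s))"
proof -
  let ?G = "\<Prod>c\<in>B - {b}. 1 - fps_const (var c) * fps_X :: cpoly fps"
  have "Hgf B = Hgf (B - {b}) * Hgf {b}"
    using Hgf_union[of "B - {b}" "{b}"] assms by (simp add: insert_absorb)
  then have "?G * Hgf B = (Hgf (B - {b}) * ?G) * Hgf {b}" by (simp add: mult_ac)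
  also have "\<dots> = Hgf {b}" using Hgf_prod[of "B - {b}"] assms(1) by simp
  finally have "var b ^ r = fps_nth (?G * Hgf B) r" by (simp add: Hgf_singleton)
  also have "\<dots> = (\<Sum>s = 0..r. fps_nth ?G s * complete_sym B (int (r - s)))"
    by (simp add: fps_mult_nth Hgf_nth)
  also have "\<dots> = (\<Sum>s = 0..r. fps_nth ?G s * complete_sym B (int r - int s))"
    by (intro sum.cong) (auto simp: of_nat_diff)
  \<comment> \<open>The two ranges are exchanged through their union: beyond r the complete
    symmetric function has negative degree, and from \<open>card B\<close> on the coefficient is
    zero.\<close>
  also have "\<dots> = (\<Sum>s \<in> {0..r} \<union> {0..<card B}. fps_nth ?G s * complete_sym B (int r - int s))"
    by (rule sum.mono_neutral_left) (auto simp: complete_sym_neg)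
  also have "\<dots> = (\<Sum>s = 0..<card B. fps_nth ?G s * complete_sym B (int r - int s))"
  proof (rule sum.mono_neutral_right)
    have "card B > 0" using assms card_gt_0_iff by blast
    then have "fps_nth ?G s = 0" if "s \<ge> card B" for s
      using that assms by (intro fps_nth_prod_linear) auto
    then show "\<forall>s\<in>{0..r} \<union> {0..<card B} - {0..<card B}.
        fps_nth ?G s * complete_sym B (int r - int s) = 0"
      by auto
  qed auto
  finally show ?thesis .
qed

section \<open>Alternants in the variables of the last block\<close>

definition alternant :: "nat \<Rightarrow> nat \<Rightarrow> (nat \<Rightarrow> nat) \<Rightarrow> cpoly" where
  "alternant D k e = det (mat k k (\<lambda>(i, j). var (D + 1 + j) ^ e i))"

lemma alternant_sum:
  "alternant D k e = (\<Sum>p | p permutes {0..<k}. of_int (sign p) * (\<Prod>i = 0..<k. var (D + 1 + p i) ^ e i))"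
proof -
  have "alternant D k e = (\<Sum>p | p permutes {0..<k}. of_int (sign p) *
      (\<Prod>i = 0..<k. mat k k (\<lambda>(i, j). var (D + 1 + j) ^ e i) $$ (i, p i)))"
    unfolding alternant_def by (rule det_def') simp
  also have "\<dots> = (\<Sum>p | p permutes {0..<k}. of_int (sign p) * (\<Prod>i = 0..<k. var (D + 1 + p i) ^ e i))"
  proof (intro sum.cong refl arg_cong2[of _ _ _ _ "(*)"] prod.cong)
    fix p i assume "p \<in> {p. p permutes {0..<k}}" "i \<in> {0..<k}"
    then have "p i < k" using permutes_in_image[of p "{0..<k}" i] by simp
    then show "mat k k (\<lambda>(i, j). var (D + 1 + j) ^ e i) $$ (i, p i) = var (D + 1 + p i) ^ e i"
      using \<open>i \<in> {0..<k}\<close> by simp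
  qed
  finally show ?thesis .
qed

text \<open>The exponents 0, ..., k - 1 are distinct, so a permutation can be read off from its
  monomial and the diagonal monomial is not cancelled. This permits division by the Vandermonde
  determinant.\<close>

lemma alternant_id_nonzero: "alternant D k id \<noteq> 0"
proof
  assume zero: "alternant D k id = 0"
  define mp where "mp p = (\<Sum>i = 0..<k. Poly_Mapping.single (D + 1 + p i) i)" for p
  have prod: "(\<Prod>i\<in>I. var (D + 1 + p i) ^ id i)
      = Poly_Mapping.single (\<Sum>i\<in>I. Poly_Mapping.single (D + 1 + p i) i) 1" if "finite I" for I p
    using that by (induction I rule: finite_induct) (simp_all add: var_power mult_single)
  have lookup_mp: "Poly_Mapping.lookup (mp p) (D + 1 + p j) = j" if "p permutes {0..<k}" "j < k" for p j
  proof -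
    have "Poly_Mapping.lookup (mp p) (D + 1 + p j) = (\<Sum>i = 0..<k. if i = j then i else 0)"
      unfolding mp_def lookup_sum
      using permutes_inj[OF that(1)] by (intro sum.cong) (auto simp: lookup_single when_def inj_eq)
    then show ?thesis using that by simp
  qed
  have eq_id: "p = id" if p: "p permutes {0..<k}" and m: "mp p = mp id" for p
  proof
    fix j
    show "p j = id j"
    proof (cases "j < k")
      case True
      then have "p j < k" using permutes_in_image[OF p, of j] by simp
      then show ?thesis
        using lookup_mp[OF p True] lookup_mp[of id "p j"] m by (simp add: permutes_id)
    next
      case False
      then show ?thesis using permutes_not_in[OF p, of j] by simp
    qed
  qed
  have "Poly_Mapping.lookup (alternant D k id) (mp id)
      = (\<Sum>p | p permutes {0..<k}. Poly_Mapping.lookup (of_int (sign p) * Poly_Mapping.single (mp p) 1) (mp id))"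
    unfolding alternant_sum lookup_sum using prod[of "{0..<k}"] by (simp add: mp_def)
  also have "\<dots> = (\<Sum>p | p permutes {0..<k}. if p = id then 1 else 0)"
  proof (rule sum.cong[OF refl])
    fix p assume "p \<in> {p. p permutes {0..<k}}"
    then show "Poly_Mapping.lookup (of_int (sign p) * Poly_Mapping.single (mp p) (1::complex)) (mp id)
        = (if p = id then 1 else 0)"
      using eq_id[of p] by (cases "sign p = 1") (auto simp: sign_def lookup_single when_def)
  qed
  also have "\<dots> = 1" by (simp add: finite_permutations permutes_id)
  finally show False using zero by simp
qed

text \<open>The power \<open>x\<^sup>e\<close> of a variable is a combination of \<open>h(e), h(e - 1), \<dots>, h(e - k + 1)\<close> whose coefficients do
  not depend on \<open>e\<close>, so the matrix of the alternant factors.\<close>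

lemma alternant_eq:
  fixes D k :: nat
  defines "B \<equiv> {D + 1..D + k}"
  shows "alternant D k e = alternant D k id
    * det (mat k k (\<lambda>(i, s). complete_sym B (int (e i) - int s)))"
proof -
  define G where "G = mat k k (\<lambda>(s, j).
    fps_nth (\<Prod>c\<in>B - {D + 1 + j}. 1 - fps_const (var c) * fps_X :: cpoly fps) s)"
  define Hm where "Hm e = mat k k (\<lambda>(i, s). complete_sym B (int (e i) - int s))" for e :: "nat \<Rightarrow> nat"
  have B: "finite B" "card B = k" by (simp_all add: B_def)
  have carr: "G \<in> carrier_mat k k" "Hm e \<in> carrier_mat k k" for e by (simp_all add: G_def Hm_def)
  have "mat k k (\<lambda>(i, j). var (D + 1 + j) ^ e i) = Hm e * G" for e
  proof (rule eq_matI)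
    fix i j assume "i < dim_row (Hm e * G)" "j < dim_col (Hm e * G)"
    then have ij: "i < k" "j < k" by (simp_all add: Hm_def G_def)
    have "D + 1 + j \<in> B" using ij by (simp add: B_def)
    from var_power_expand[OF B(1) this, of "e i"] ij
    show "mat k k (\<lambda>(i, j). var (D + 1 + j) ^ e i) $$ (i, j) = (Hm e * G) $$ (i, j)"
      by (simp add: Hm_def G_def scalar_prod_def B mult.commute)
  qed (simp_all add: Hm_def G_def)
  then have det: "alternant D k e = det (Hm e) * det G" for e
    by (simp add: alternant_def det_mult[OF carr(2) carr(1)])
  have "det (Hm id) = prod_list (diag_mat (Hm id))"
    by (rule det_lower_triangular[of k]) (auto simp: Hm_def complete_sym_neg)
  also have "\<dots> = 1"
    unfolding prod_list_diag_prod by (rule prod.neutral) (simp add: Hm_def complete_sym_zero B)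
  finally show ?thesis
    using det[of e] det[of id] by (simp add: Hm_def mult.commute)
qed

section \<open>Averaging over the Young subgroup of the first blocks\<close>

lemma permute_vars_Pol:
  assumes q: "q \<in> Pol d" and \<tau>: "\<tau> permutes {1..d}"
  shows "permute_vars \<tau> q \<in> Pol d"
  unfolding Pol_def
proof (intro CollectI ballI subsetI)
  have b: "bij \<tau>" by (rule permutes_bij[OF \<tau>])
  fix m i assume m: "m \<in> Poly_Mapping.keys (permute_vars \<tau> q)" and i: "i \<in> Poly_Mapping.keys m"
  have "Poly_Mapping.map_key \<tau> m \<in> Poly_Mapping.keys q"
    using m b by (simp add: in_keys_iff lookup_permute_vars)
  then have *: "Poly_Mapping.keys (Poly_Mapping.map_key \<tau> m) \<subseteq> {1..d}" using q by (auto simp: Pol_def)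
  have "Poly_Mapping.lookup (Poly_Mapping.map_key \<tau> m) (inv_into UNIV \<tau> i) \<noteq> 0"
    using i b by (simp add: map_key_perm bij_is_surj surj_f_inv_f in_keys_iff)
  then have "inv_into UNIV \<tau> i \<in> {1..d}" using * by (auto simp: in_keys_iff simp del: atLeastAtMost_iff)
  then have "\<tau> (inv_into UNIV \<tau> i) \<in> {1..d}" using permutes_in_image[OF \<tau>] by blast
  then show "i \<in> {1..d}" using b by (simp add: bij_is_surj surj_f_inv_f)
qed

lemma young_subgroup_comp:
  "\<sigma> \<in> young_subgroup \<mu> \<Longrightarrow> \<tau> \<in> young_subgroup \<mu> \<Longrightarrow> \<sigma> \<circ> \<tau> \<in> young_subgroup \<mu>"
  unfolding young_subgroup_def by (simp add: permutes_compose image_comp[symmetric] del: atLeastAtMost_iff o_apply image_comp)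

lemma young_subgroup_inv:
  assumes "\<sigma> \<in> young_subgroup \<mu>"
  shows "inv_into UNIV \<sigma> \<in> young_subgroup \<mu>"
proof -
  have p: "\<sigma> permutes {1..sum_list \<mu>}" using assms by (simp add: young_subgroup_def)
  have "inv_into UNIV \<sigma> ` block \<mu> j = block \<mu> j" if "j \<in> {1..length \<mu>}" for j
  proof -
    have "inv_into UNIV \<sigma> ` (\<sigma> ` block \<mu> j) = block \<mu> j"
      by (simp add: image_comp permutes_inv_o[OF p])
    then show ?thesis using assms that by (simp add: young_subgroup_def)
  qed
  then show ?thesis using permutes_inv[OF p] by (simp add: young_subgroup_def)
qed

lemma finite_young_subgroup: "finite (young_subgroup \<mu>)"
  by (rule finite_subset[OF _ finite_permutations[of "{1..sum_list \<mu>}"]]) (auto simp: young_subgroup_def)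

lemma id_young_subgroup: "id \<in> young_subgroup \<mu>"
  by (simp add: young_subgroup_def permutes_id)

text \<open>The Reynolds operator before division by the order of the group.\<close>

definition orbit_sum :: "nat list \<Rightarrow> cpoly \<Rightarrow> cpoly" where
  "orbit_sum \<mu> q = (\<Sum>\<tau> \<in> young_subgroup \<mu>. permute_vars \<tau> q)"

lemma orbit_sum_Inv:
  assumes "q \<in> Pol (sum_list \<mu>)"
  shows "orbit_sum \<mu> q \<in> Inv \<mu>"
  unfolding Inv_iff
proof (intro conjI ballI)
  have sub: "cp.subspace (Pol (sum_list \<mu>))"
    unfolding cp.subspace_def using const_in_Pol[of 0 "sum_list \<mu>"]
    by (auto simp: const_zero intro: Pol_add Pol_mult const_in_Pol)
  show "orbit_sum \<mu> q \<in> Pol (sum_list \<mu>)"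
    unfolding orbit_sum_def
    by (rule cp.subspace_sum[OF sub]) (auto simp: young_subgroup_def intro!: permute_vars_Pol assms)
  fix \<sigma> assume \<sigma>: "\<sigma> \<in> young_subgroup \<mu>"
  have b: "bij \<sigma>" by (rule young_subgroup_bij[OF \<sigma>])
  have "permute_vars \<sigma> (orbit_sum \<mu> q) = (\<Sum>\<tau> \<in> young_subgroup \<mu>. permute_vars (\<sigma> \<circ> \<tau>) q)"
    unfolding orbit_sum_def permute_vars_sum[OF b]
    by (intro sum.cong refl permute_vars_comp[OF b] young_subgroup_bij)
  also have "\<dots> = orbit_sum \<mu> q"
    unfolding orbit_sum_def
  proof (rule sum.reindex_bij_witness[of _ "\<lambda>\<tau>. inv_into UNIV \<sigma> \<circ> \<tau>" "\<lambda>\<tau>. \<sigma> \<circ> \<tau>"])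
    fix \<tau> assume "\<tau> \<in> young_subgroup \<mu>"
    then show "\<sigma> \<circ> \<tau> \<in> young_subgroup \<mu>" "inv_into UNIV \<sigma> \<circ> \<tau> \<in> young_subgroup \<mu>"
      using \<sigma> by (auto intro: young_subgroup_comp young_subgroup_inv)
    show "inv_into UNIV \<sigma> \<circ> (\<sigma> \<circ> \<tau>) = \<tau>" "\<sigma> \<circ> (inv_into UNIV \<sigma> \<circ> \<tau>) = \<tau>"
      using b by (auto simp: fun_eq_iff bij_is_inj bij_is_surj surj_f_inv_f)
  qed simp
  finally show "permute_vars \<sigma> (orbit_sum \<mu> q) = orbit_sum \<mu> q" .
qed

lemma young_subgroup_butlast_subset:
  assumes "\<mu> \<noteq> []"
  shows "young_subgroup (butlast \<mu>) \<subseteq> young_subgroup \<mu>"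
proof
  fix \<tau> assume \<tau>: "\<tau> \<in> young_subgroup (butlast \<mu>)"
  then have p: "\<tau> permutes {1..sum_list (butlast \<mu>)}" by (simp add: young_subgroup_def)
  have "\<tau> permutes {1..sum_list \<mu>}"
    by (rule permutes_subset[OF p]) (auto simp: sum_list_butlast[OF assms])
  moreover have "\<tau> ` block \<mu> j = block \<mu> j" if "j \<in> {1..length \<mu>}" for j
  proof (cases "j = length \<mu>")
    case True
    have "\<tau> i = i" if "i \<in> block \<mu> j" for i
      using permutes_not_in[OF p, of i] that by (simp add: True block_last[OF assms])
    then show ?thesis by auto
  next
    case False
    then have "j < length \<mu>" "j \<in> {1..length (butlast \<mu>)}" using that by auto
    then show ?thesis using \<tau> block_butlast[of j \<mu>] unfolding young_subgroup_def by fastforce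
  qed
  ultimately show "\<tau> \<in> young_subgroup \<mu>" by (simp add: young_subgroup_def)
qed

text \<open>At this stage the coefficients are arbitrary polynomials in the variables of the first
  blocks; averaging in \<open>Inv_span_hlast\<close> makes them invariant.\<close>

lemma Inv_span_Pol:
  assumes ne: "\<mu> \<noteq> []" and f: "f \<in> Inv \<mu>"
  shows "f \<in> cp.span {q * (\<Prod>x\<leftarrow>g. hsym \<mu> {length \<mu>} (int x)) | q g.
    q \<in> Pol (sum_list (butlast \<mu>)) \<and> length g = last \<mu>}" (is "_ \<in> cp.span ?S")
proof -
  define D k where "D = sum_list (butlast \<mu>)" and "k = last \<mu>"
  define B where "B = {D + 1..D + k}"
  have d: "sum_list \<mu> = D + k" using sum_list_butlast[OF ne] by (simp add: D_def k_def)
  have bl: "block \<mu> (length \<mu>) = B" using block_last[OF ne] d by (simp add: B_def D_def)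
  have hs: "hsym \<mu> {length \<mu>} r = complete_sym B r" for r by (simp add: hsym_def bl)
  define act where "act p x = (if x \<in> B then D + 1 + p (x - (D + 1)) else x)" for p x
  have act_B: "act p (D + 1 + i) = D + 1 + p i" if "i < k" for p i
    using that by (simp add: act_def B_def)
  have act: "act p \<in> young_subgroup \<mu>" if p: "p permutes {0..<k}" for p
  proof -
    have pk: "p i < k" if "i < k" for i using permutes_in_image[OF p, of i] that by simp
    have "bij_betw (act p) B B"
    proof (rule bij_betw_byWitness[where f' = "act (inv_into UNIV p)"])
      have ip: "inv_into UNIV p i < k" if "i < k" for i
        using permutes_in_image[OF permutes_inv[OF p], of i] that by simp
      show "\<forall>a\<in>B. act (inv_into UNIV p) (act p a) = a" "\<forall>a\<in>B. act p (act (inv_into UNIV p) a) = a"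
        using pk ip permutes_inverses[OF p] by (auto simp: act_def B_def Suc_le_eq)
      show "act p ` B \<subseteq> B" "act (inv_into UNIV p) ` B \<subseteq> B"
      proof -
        have "act r y \<in> B" if r: "\<And>i. i < k \<Longrightarrow> r i < k" and y: "y \<in> B" for r y
        proof -
          have "y - (D + 1) < k" using y by (auto simp: B_def)
          then show ?thesis using r[of "y - (D + 1)"] y by (simp add: act_def B_def Suc_le_eq)
        qed
        then show "act p ` B \<subseteq> B" "act (inv_into UNIV p) ` B \<subseteq> B"
          using pk ip by blast+
      qed
    qed
    then have 1: "act p permutes B" by (rule bij_imp_permutes) (simp add: act_def)
    then have "act p permutes {1..sum_list \<mu>}" by (rule permutes_subset) (auto simp: B_def d)
    moreover have "act p ` block \<mu> j = block \<mu> j" if j: "j \<in> {1..length \<mu>}" for j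
    proof (cases "j = length \<mu>")
      case True
      then show ?thesis using permutes_image[OF 1] bl by simp
    next
      case False
      then have "block \<mu> j \<inter> B = {}"
        using block_disjoint[of j "length \<mu>" \<mu>] j bl by auto
      then have "act p i = i" if "i \<in> block \<mu> j" for i using that by (auto simp: act_def)
      then show ?thesis by auto
    qed
    ultimately show ?thesis by (simp add: young_subgroup_def)
  qed
  \<comment> \<open>Antisymmetrizing \<open>F\<close> over the last block gives f times the
    Vandermonde determinant, because f is invariant; antisymmetrizing its monomials one by one gives
    alternants.\<close>
  define F where "F = f * (\<Prod>i = 0..<k. var (D + 1 + i) ^ i)"
  define q where "q m = const (Poly_Mapping.lookup F m) * (\<Prod>i\<in>{1..D}. var i ^ Poly_Mapping.lookup m i)" for m
  have q: "q m \<in> Pol D" for m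
  proof -
    have "var i ^ e \<in> Pol D" if "i \<in> {1..D}" for i e
      using that by (auto simp: var_power Pol_def)
    then have "(\<Prod>i\<in>I. var i ^ Poly_Mapping.lookup m i) \<in> Pol D" if "I \<subseteq> {1..D}" for I
      using that infinite_super[of I "{1..D}"] const_in_Pol[of 1 D] 
      by (induction I rule: infinite_finite_induct) (auto intro!: Pol_mult simp: const_one simp del: atLeastAtMost_iff)
    then show ?thesis unfolding q_def by (intro Pol_mult const_in_Pol) simp
  qed
  have FPol: "F \<in> Pol (D + k)"
  proof -
    have "var (D + 1 + i) ^ e \<in> Pol (D + k)" if "i < k" for i e
      using that by (auto simp: var_power Pol_def)
    then have "(\<Prod>i\<in>I. var (D + 1 + i) ^ i) \<in> Pol (D + k)" if "I \<subseteq> {0..<k}" for I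
      using that infinite_super[of I "{0..<k}"] const_in_Pol[of 1 "D + k"]
      by (induction I rule: infinite_finite_induct) (auto intro!: Pol_mult simp: const_one)
    then show ?thesis unfolding F_def using f d by (intro Pol_mult) (auto simp: Inv_iff)
  qed
  have F_sum: "F = (\<Sum>m\<in>Poly_Mapping.keys F. q m * (\<Prod>i = 0..<k. var (D + 1 + i) ^ Poly_Mapping.lookup m (D + 1 + i)))"
  proof -
    have "Poly_Mapping.single m (Poly_Mapping.lookup F m)
        = q m * (\<Prod>i = 0..<k. var (D + 1 + i) ^ Poly_Mapping.lookup m (D + 1 + i))"
      if m: "m \<in> Poly_Mapping.keys F" for m
    proof -
      have "Poly_Mapping.keys m \<subseteq> {1..D} \<union> B" using m FPol by (fastforce simp: Pol_def B_def)
      then have "Poly_Mapping.single m (Poly_Mapping.lookup F m) = const (Poly_Mapping.lookup F m)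
          * (\<Prod>i\<in>{1..D} \<union> B. var i ^ Poly_Mapping.lookup m i)"
        by (intro single_eq_prod) (auto simp: B_def)
      also have "(\<Prod>i\<in>{1..D} \<union> B. var i ^ Poly_Mapping.lookup m i)
          = (\<Prod>i\<in>{1..D}. var i ^ Poly_Mapping.lookup m i) * (\<Prod>i\<in>B. var i ^ Poly_Mapping.lookup m i)"
        by (rule prod.union_disjoint) (auto simp: B_def)
      also have "(\<Prod>i\<in>B. var i ^ Poly_Mapping.lookup m i)
          = (\<Prod>i = 0..<k. var (D + 1 + i) ^ Poly_Mapping.lookup m (D + 1 + i))"
        by (rule prod.reindex_bij_witness[of _ "\<lambda>i. D + 1 + i" "\<lambda>i. i - (D + 1)"]) (auto simp: B_def)
      finally show ?thesis by (simp add: q_def mult.assoc)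
    qed
    then show ?thesis using sum_singles[of F] by simp
  qed
  have perm: "permute_vars (act p) (q * (\<Prod>i = 0..<k. var (D + 1 + i) ^ e i))
      = q * (\<Prod>i = 0..<k. var (D + 1 + p i) ^ e i)" if "p permutes {0..<k}" "q \<in> Pol D" for p q e
  proof -
    have b: "bij (act p)" by (rule young_subgroup_bij[OF act[OF that(1)]])
    have "permute_vars (act p) q = q"
      by (rule permute_vars_Pol_id[OF that(2) b]) (simp add: act_def B_def)
    moreover have "(\<Prod>i = 0..<k. var (act p (D + 1 + i)) ^ e i) = (\<Prod>i = 0..<k. var (D + 1 + p i) ^ e i)"
      using act_B by (intro prod.cong) auto
    ultimately show ?thesis
      by (simp only: permute_vars_mult[OF b] permute_vars_prod[OF b] permute_vars_power[OF b] permute_vars_var[OF b])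
  qed
  have "f * alternant D k id = (\<Sum>p | p permutes {0..<k}. of_int (sign p) * permute_vars (act p) F)"
    unfolding alternant_sum sum_distrib_left
  proof (rule sum.cong[OF refl])
    fix p assume "p \<in> {p. p permutes {0..<k}}"
    then have p: "p permutes {0..<k}" by simp
    have "permute_vars (act p) F = f * (\<Prod>i = 0..<k. var (D + 1 + p i) ^ i)"
    proof -
      have "permute_vars (act p) f = f" using f act[OF p] by (simp add: Inv_iff)
      moreover have "permute_vars (act p) (\<Prod>i = 0..<k. var (D + 1 + i) ^ i) = (\<Prod>i = 0..<k. var (D + 1 + p i) ^ i)"
        using perm[OF p, of 1 "\<lambda>i. i"] const_in_Pol[of 1 D] by (simp add: const_one)
      ultimately show ?thesis
        unfolding F_def permute_vars_mult[OF young_subgroup_bij[OF act[OF p]]] by simp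
    qed
    then show "f * (of_int (sign p) * (\<Prod>i = 0..<k. var (D + 1 + p i) ^ id i))
        = of_int (sign p) * permute_vars (act p) F" by (simp add: mult_ac)
  qed
  also have "\<dots> = (\<Sum>p | p permutes {0..<k}. \<Sum>m\<in>Poly_Mapping.keys F.
      q m * (of_int (sign p) * (\<Prod>i = 0..<k. var (D + 1 + p i) ^ Poly_Mapping.lookup m (D + 1 + i))))"
  proof (rule sum.cong[OF refl])
    fix p assume "p \<in> {p. p permutes {0..<k}}"
    then have p: "p permutes {0..<k}" by simp
    have "permute_vars (act p) F = (\<Sum>m\<in>Poly_Mapping.keys F.
        q m * (\<Prod>i = 0..<k. var (D + 1 + p i) ^ Poly_Mapping.lookup m (D + 1 + i)))"
      by (subst F_sum, subst permute_vars_sum[OF young_subgroup_bij[OF act[OF p]]])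
        (intro sum.cong refl perm[OF p q])
    then show "of_int (sign p) * permute_vars (act p) F = (\<Sum>m\<in>Poly_Mapping.keys F.
      q m * (of_int (sign p) * (\<Prod>i = 0..<k. var (D + 1 + p i) ^ Poly_Mapping.lookup m (D + 1 + i))))"
      by (simp add: sum_distrib_left mult_ac)
  qed
  also have "\<dots> = (\<Sum>m\<in>Poly_Mapping.keys F. q m * alternant D k (\<lambda>i. Poly_Mapping.lookup m (D + 1 + i)))"
    unfolding alternant_sum sum_distrib_left by (rule sum.swap)
  also have "\<dots> = (\<Sum>m\<in>Poly_Mapping.keys F. q m *
      det (mat k k (\<lambda>(i, s). complete_sym B (int (Poly_Mapping.lookup m (D + 1 + i)) - int s)))) * alternant D k id"
    unfolding sum_distrib_right
    by (intro sum.cong refl) (subst alternant_eq, simp add: B_def mult_ac)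
  finally have feq: "f = (\<Sum>m\<in>Poly_Mapping.keys F. q m *
      det (mat k k (\<lambda>(i, s). complete_sym B (int (Poly_Mapping.lookup m (D + 1 + i)) - int s))))"
    using alternant_id_nonzero[of D k] by simp
  have key: "q' * det (mat k k (\<lambda>(i, s). complete_sym B (int (e i) - int s))) \<in> cp.span ?S"
    if q': "q' \<in> Pol D" for q' e
  proof -
    have "q' * det (mat k k (\<lambda>(i, s). complete_sym B (int (e i) - int s)))
        = (\<Sum>p | p permutes {0..<k}. of_int (sign p) * (q' * (\<Prod>i = 0..<k. complete_sym B (int (e i) - int (p i)))))"
    proof -
      have "mat k k (\<lambda>(i, s). complete_sym B (int (e i) - int s)) $$ (i, p i)
          = complete_sym B (int (e i) - int (p i))" if "p permutes {0..<k}" "i < k" for p i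
        using permutes_in_image[OF that(1), of i] that(2) by simp
      then show ?thesis
        by (subst det_def'[of _ k]) (auto simp: sum_distrib_left mult_ac intro!: sum.cong prod.cong)
    qed
    also have "\<dots> \<in> cp.span ?S"
    proof (rule cp.span_sum)
      fix p
      have "q' * (\<Prod>i = 0..<k. complete_sym B (int (e i) - int (p i))) \<in> cp.span ?S"
      proof (cases "\<exists>i<k. int (e i) < int (p i)")
        case True
        then have "(\<Prod>i = 0..<k. complete_sym B (int (e i) - int (p i))) = 0"
          by (intro prod_zero) (force simp: complete_sym_neg)+
        then show ?thesis by (simp only: mult_zero_right cp.span_zero)
      next
        case False
        define g where "g = map (\<lambda>i. e i - p i) [0..<k]"
        have "(\<Prod>i = 0..<k. complete_sym B (int (e i) - int (p i)))
            = (\<Prod>i = 0..<k. complete_sym B (int (e i - p i)))"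
          using False by (intro prod.cong refl) (auto simp: of_nat_diff)
        also have "\<dots> = (\<Prod>x\<leftarrow>g. hsym \<mu> {length \<mu>} (int x))"
          by (simp add: g_def hs prod.distinct_set_conv_list[symmetric] comp_def)
        finally have "q' * (\<Prod>i = 0..<k. complete_sym B (int (e i) - int (p i))) \<in> ?S"
          using q' by (intro CollectI exI[of _ q'] exI[of _ g]) (simp add: D_def g_def k_def)
        then show ?thesis by (rule cp.span_base)
      qed
      then show "of_int (sign p) * (q' * (\<Prod>i = 0..<k. complete_sym B (int (e i) - int (p i)))) \<in> cp.span ?S"
        by (cases "sign p = 1") (auto simp: sign_def dest: cp.span_neg)
    qed
    finally show ?thesis .
  qed
  show ?thesis
    by (subst feq) (rule cp.span_sum, rule key[OF q])
qed

text \<open>Averaging over the Young subgroup of the first blocks fixes f and the factors from the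
  last block, and replaces each coefficient by an invariant one. Division by the group order is
  possible over the complex numbers.\<close>

lemma Inv_span_hlast:
  assumes ne: "\<mu> \<noteq> []" and f: "f \<in> Inv \<mu>"
  shows "f \<in> cp.span {q * (\<Prod>x\<leftarrow>g. hsym \<mu> {length \<mu>} (int x)) | q g.
    q \<in> Inv (butlast \<mu>) \<and> length g = last \<mu>}" (is "_ \<in> cp.span ?S")
proof -
  let ?h = "\<lambda>g. \<Prod>x\<leftarrow>g. hsym \<mu> {length \<mu>} (int x)"
  define N where "N = card (young_subgroup (butlast \<mu>))"
  have N: "N \<noteq> 0"
    unfolding N_def using finite_young_subgroup id_young_subgroup by (metis card_0_eq empty_iff)
  have hg: "?h g \<in> Inv \<mu>" for g
  proof (induction g)
    case (Cons x g)
    have "hsym \<mu> {length \<mu>} (int x) \<in> Inv \<mu>"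
      by (rule hsym_closed) (use ne in \<open>simp add: Suc_le_eq\<close>)
    then show ?case using Cons by (simp add: Inv_mult)
  qed (simp add: Inv_one)
  have "orbit_sum (butlast \<mu>) f' \<in> cp.span ?S"
    if "f' \<in> cp.span {q * ?h g | q g. q \<in> Pol (sum_list (butlast \<mu>)) \<and> length g = last \<mu>}" for f'
    using that
  proof (induction f' rule: cp.span_induct_alt)
    case base
    then show ?case by (simp add: orbit_sum_def permute_vars_zero young_subgroup_bij cp.span_zero)
  next
    case (step c x y)
    then obtain q g where x: "x = q * ?h g" and q: "q \<in> Pol (sum_list (butlast \<mu>))" and g: "length g = last \<mu>"
      by blast
    have "orbit_sum (butlast \<mu>) (const c * x + y)
        = const c * (orbit_sum (butlast \<mu>) q * ?h g) + orbit_sum (butlast \<mu>) y"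
      unfolding orbit_sum_def sum_distrib_left sum_distrib_right sum.distrib[symmetric]
    proof (rule sum.cong[OF refl])
      fix \<tau> assume \<tau>: "\<tau> \<in> young_subgroup (butlast \<mu>)"
      then have b: "bij \<tau>" by (rule young_subgroup_bij)
      have "permute_vars \<tau> (?h g) = ?h g"
        using hg[of g] \<tau> young_subgroup_butlast_subset[OF ne] by (auto simp: Inv_iff)
      then show "permute_vars \<tau> (const c * x + y) = const c * (permute_vars \<tau> q * ?h g) + permute_vars \<tau> y"
        by (simp add: x permute_vars_add[OF b] permute_vars_mult[OF b] permute_vars_const[OF b])
    qed
    moreover have "orbit_sum (butlast \<mu>) q * ?h g \<in> cp.span ?S"
      using orbit_sum_Inv[OF q] g by (intro cp.span_base) blast
    ultimately show ?case
      by (simp only:) (intro cp.span_add cp.span_scale step.IH)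
  qed
  then have "orbit_sum (butlast \<mu>) f \<in> cp.span ?S" using Inv_span_Pol[OF assms] by blast
  moreover have "orbit_sum (butlast \<mu>) f = const (of_nat N) * f"
  proof -
    have "orbit_sum (butlast \<mu>) f = (\<Sum>\<tau> \<in> young_subgroup (butlast \<mu>). f)"
      unfolding orbit_sum_def
      using f young_subgroup_butlast_subset[OF ne] by (intro sum.cong) (auto simp: Inv_iff)
    also have "\<dots> = of_nat N * f" by (simp add: N_def)
    also have "of_nat N = const (of_nat N)"
      by (induction N) (simp_all add: const_zero const_one const_add)
    finally show ?thesis .
  qed
  ultimately have "const (of_nat N) * f \<in> cp.span ?S" by (simp only:)
  then have "const (1 / of_nat N) * (const (of_nat N) * f) \<in> cp.span ?S"
    by (rule cp.span_scale)
  then show ?thesis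
    using N by (simp add: mult.assoc[symmetric] const_mult[symmetric] const_one)
qed

section \<open>The straightening relation\<close>

lemma prod_list_prod_nth: "prod_list (xs :: 'a :: comm_monoid_mult list) = (\<Prod>i = 0..<length xs. xs ! i)"
proof (induction xs rule: rev_induct)
  case (snoc x xs)
  have "(\<Prod>i = 0..<length xs. (xs @ [x]) ! i) = (\<Prod>i = 0..<length xs. xs ! i)"
    by (intro prod.cong) (auto simp: nth_append)
  then show ?case using snoc by (simp add: nth_append)
qed simp

text \<open>With base \<open>k + 1\<close>, a larger exponent at the first difference outweighs the
  at most k powers that remain on the other side. As the weight does not depend on the order of the
  entries, the larger list need not be sorted.\<close>

lemma sum_power_less:
  fixes G G' :: "nat \<Rightarrow> nat"
  assumes "a0 < k" "\<And>a. a < a0 \<Longrightarrow> G' a = G a" "G a0 < G' a0"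
    "\<And>a. a0 \<le> a \<Longrightarrow> a < k \<Longrightarrow> G a \<le> G a0"
  shows "(\<Sum>a<k. (k + 1) ^ G a) < (\<Sum>a<k. (k + 1) ^ G' a)"
proof -
  let ?X = "k + 1"
  have split: "(\<Sum>a<k. f a) = (\<Sum>a<a0. f a) + (\<Sum>a=a0..<k. f a)" for f :: "nat \<Rightarrow> nat"
    using assms(1) by (metis atLeast0LessThan less_imp_le sum.atLeastLessThan_concat zero_le)
  have "(\<Sum>a=a0..<k. ?X ^ G a) \<le> (\<Sum>a=a0..<k. ?X ^ G a0)"
    using assms(4) by (intro sum_mono power_increasing) auto
  also have "\<dots> \<le> k * ?X ^ G a0" by simp
  also have "\<dots> < ?X ^ Suc (G a0)" by simp
  also have "\<dots> \<le> ?X ^ G' a0" using assms(3) by (intro power_increasing) auto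
  also have "\<dots> \<le> (\<Sum>a=a0..<k. ?X ^ G' a)"
    using assms(1) by (intro member_le_sum) auto
  finally have "(\<Sum>a=a0..<k. ?X ^ G a) < (\<Sum>a=a0..<k. ?X ^ G' a)" .
  moreover have "(\<Sum>a<a0. ?X ^ G a) = (\<Sum>a<a0. ?X ^ G' a)"
    using assms(2) by (intro sum.cong) auto
  ultimately show ?thesis by (simp only: split)
qed

text \<open>All values below the first moved point are already taken, so injectivity forces that
  point upwards.\<close>

lemma permutes_first_moved:
  fixes \<sigma> :: "nat \<Rightarrow> nat"
  assumes "\<sigma> permutes {0..<l}" "\<sigma> \<noteq> id"
  obtains a0 where "a0 < l" "\<And>a. a < a0 \<Longrightarrow> \<sigma> a = a" "a0 < \<sigma> a0"
proof
  define a0 where "a0 = (LEAST a. \<sigma> a \<noteq> a)"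
  have ex: "\<exists>a. \<sigma> a \<noteq> a" using assms(2) by auto
  then have ne: "\<sigma> a0 \<noteq> a0" unfolding a0_def by (rule LeastI_ex)
  show below: "\<sigma> a = a" if "a < a0" for a
    using that not_less_Least unfolding a0_def by blast
  show "a0 < l"
    using ne assms(1) by (metis atLeast0LessThan lessThan_iff permutes_not_in)
  show "a0 < \<sigma> a0"
  proof (rule ccontr)
    assume "\<not> a0 < \<sigma> a0"
    then have "\<sigma> a0 < a0" using ne by simp
    then have "\<sigma> (\<sigma> a0) = \<sigma> a0" by (rule below)
    then have "\<sigma> a0 = a0" using permutes_inj[OF assms(1)] by (simp add: inj_eq)
    then show False using ne by simp
  qed
qed

text \<open>\<open>W_higher\<close> compares products first by degree and then by a weight that increases under passing to
  a larger partition in dominance order.\<close>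

locale straightening =
  fixes h u :: "int \<Rightarrow> 'a :: comm_ring_1" and A :: int and g :: "nat list"
    and k l :: nat and R W :: "'a set"
  assumes h_neg: "s < 0 \<Longrightarrow> h s = 0"
    and u_neg: "s < 0 \<Longrightarrow> u s = 0"
    and len: "length g = k" and desc: "sorted_wrt (\<ge>) g" and lk: "l \<le> k"
    and R_one: "1 \<in> R" and R_mult: "p \<in> R \<Longrightarrow> q \<in> R \<Longrightarrow> p * q \<in> R" and R_h: "h s \<in> R"
    and W_zero: "0 \<in> W" and W_add: "p \<in> W \<Longrightarrow> q \<in> W \<Longrightarrow> p + q \<in> W"
    and W_neg: "p \<in> W \<Longrightarrow> - p \<in> W"
    and W_u: "s > A \<Longrightarrow> p \<in> R \<Longrightarrow> u s * p \<in> W"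
    and W_v: "a < l \<Longrightarrow> p \<in> R \<Longrightarrow>
      (\<Sum>j = 0..nat (A + int (g ! a) - int a). h (int j) * u (A + int (g ! a) - int a - int j)) * p \<in> W"
    and W_higher: "length g' = k \<Longrightarrow>
      sum_list g < sum_list g' \<or> sum_list g = sum_list g' \<and>
        (\<Sum>x\<leftarrow>g. (k + 1) ^ x) < (\<Sum>x\<leftarrow>g'. (k + 1) ^ x) \<Longrightarrow>
      u s * (\<Prod>x\<leftarrow>g'. h (int x)) \<in> W"
begin

lemma W_sum: "(\<And>i. i \<in> B \<Longrightarrow> f i \<in> W) \<Longrightarrow> sum f B \<in> W"
  by (induction B rule: infinite_finite_induct) (auto simp: W_zero W_add)

lemma W_diff: "p \<in> W \<Longrightarrow> q \<in> W \<Longrightarrow> p - q \<in> W"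
  using W_add[of p "- q"] W_neg[of q] by simp

lemma W_sign: "p \<in> W \<Longrightarrow> of_int (sign \<sigma>) * p \<in> W"
  using W_neg by (cases "sign \<sigma> = 1") (auto simp: sign_def)

lemma R_prod: "(\<And>i. i \<in> B \<Longrightarrow> f i \<in> R) \<Longrightarrow> prod f B \<in> R"
  by (induction B rule: infinite_finite_induct) (auto simp: R_one R_mult)

definition tail :: 'a where
  "tail = (\<Prod>a = l..<k. h (int (g ! a)))"

definition hterm :: "(nat \<Rightarrow> nat) \<Rightarrow> 'a" where
  "hterm t = (\<Prod>a = 0..<l. h (int (g ! a) - int a + int (t a))) * tail"

lemma prod_list_eq_hterm_id: "(\<Prod>x\<leftarrow>g. h (int x)) = hterm id"
proof -
  have "(\<Prod>x\<leftarrow>g. h (int x)) = (\<Prod>a = 0..<k. h (int (g ! a)))"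
    by (subst prod_list_prod_nth) (simp add: len)
  also have "\<dots> = (\<Prod>a = 0..<l. h (int (g ! a))) * (\<Prod>a = l..<k. h (int (g ! a)))"
    using lk by (simp add: prod.atLeastLessThan_concat)
  finally show ?thesis by (simp add: hterm_def tail_def)
qed

text \<open>A larger sum of column numbers raises the degree. A nontrivial permutation keeps the
  degree, leaves the parts before its first moved row unchanged and enlarges the part in that row,
  so the weight grows. Terms with a negative index vanish.\<close>

lemma hterm_higher:
  assumes t: "(\<Sum>a = 0..<l. t a) > (\<Sum>a = 0..<l. a) \<or> t permutes {0..<l} \<and> t \<noteq> id"
  shows "u s * hterm t \<in> W"
proof (cases "\<exists>a<l. int (g ! a) - int a + int (t a) < 0")
  case True
  then have "(\<Prod>a = 0..<l. h (int (g ! a) - int a + int (t a))) = 0"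
    using h_neg by (intro prod_zero) force+
  then show ?thesis by (simp add: hterm_def W_zero)
next
  case False
  then have nn: "0 \<le> int (g ! a) - int a + int (t a)" if "a < l" for a
    using that by force
  define G where "G a = (if a < l then nat (int (g ! a) - int a + int (t a)) else g ! a)" for a
  define g' where "g' = map G [0..<k]"
  have len': "length g' = k" by (simp add: g'_def)
  have g'_nth: "g' ! a = G a" if "a < k" for a using that by (simp add: g'_def)
  have split: "(\<Sum>a = 0..<k. f a) = (\<Sum>a = 0..<l. f a) + (\<Sum>a = l..<k. f a)" for f :: "nat \<Rightarrow> int"
    using lk by (simp add: sum.atLeastLessThan_concat)
  have sums: "int (sum_list g') = int (sum_list g) - (\<Sum>a = 0..<l. int a) + (\<Sum>a = 0..<l. int (t a))"
  proof -
    have "int (sum_list g') = (\<Sum>a = 0..<k. int (G a))"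
      by (simp add: sum_list_sum_nth len' g'_nth)
    also have "\<dots> = (\<Sum>a = 0..<l. int (g ! a) - int a + int (t a)) + (\<Sum>a = l..<k. int (g ! a))"
      unfolding split using nn by (intro arg_cong2[of _ _ _ _ "(+)"] sum.cong) (auto simp: G_def)
    also have "\<dots> = (\<Sum>a = 0..<k. int (g ! a)) - (\<Sum>a = 0..<l. int a) + (\<Sum>a = 0..<l. int (t a))"
      unfolding split by (simp add: sum.distrib sum_subtractf)
    also have "(\<Sum>a = 0..<k. int (g ! a)) = int (sum_list g)"
      by (simp add: sum_list_sum_nth len)
    finally show ?thesis .
  qed
  have "sum_list g < sum_list g' \<or> sum_list g = sum_list g' \<and>
        (\<Sum>x\<leftarrow>g. (k + 1) ^ x) < (\<Sum>x\<leftarrow>g'. (k + 1) ^ x)"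
    using t
  proof
    assume "(\<Sum>a = 0..<l. t a) > (\<Sum>a = 0..<l. a)"
    then have "int (\<Sum>a = 0..<l. t a) > int (\<Sum>a = 0..<l. a)"
      by (simp only: of_nat_less_iff)
    then have "(\<Sum>a = 0..<l. int (t a)) > (\<Sum>a = 0..<l. int a)"
      by (simp only: of_nat_sum)
    then show ?thesis using sums by linarith
  next
    assume p: "t permutes {0..<l} \<and> t \<noteq> id"
    have "(\<Sum>a = 0..<l. int (t a)) = (\<Sum>a = 0..<l. int a)"
      using sum.permute[of t "{0..<l}" int] p by (simp add: comp_def)
    then have eq: "sum_list g = sum_list g'" using sums by simp
    obtain a0 where a0: "a0 < l" "\<And>a. a < a0 \<Longrightarrow> t a = a" "a0 < t a0"
      using permutes_first_moved[of t l] p by blast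
    have "(\<Sum>a<k. (k + 1) ^ (g ! a)) < (\<Sum>a<k. (k + 1) ^ G a)"
    proof (rule sum_power_less[where ?a0.0 = a0])
      show "a0 < k" using a0(1) lk by simp
      show "G a = g ! a" if "a < a0" for a using that a0 by (simp add: G_def)
      show "g ! a0 < G a0" using a0 by (simp add: G_def)
      show "g ! a \<le> g ! a0" if "a0 \<le> a" "a < k" for a
        using that desc len by (cases "a = a0") (auto simp: sorted_wrt_iff_nth_less)
    qed
    moreover have "(\<Sum>x\<leftarrow>g. (k + 1) ^ x) = (\<Sum>a<k. (k + 1) ^ (g ! a))"
      by (subst sum_list_sum_nth) (simp add: len atLeast0LessThan)
    moreover have "(\<Sum>x\<leftarrow>g'. (k + 1) ^ x) = (\<Sum>a<k. (k + 1) ^ G a)"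
      by (subst sum_list_sum_nth) (simp add: len' g'_nth atLeast0LessThan)
    ultimately show ?thesis using eq by simp
  qed
  then have W: "u s * (\<Prod>x\<leftarrow>g'. h (int x)) \<in> W" by (rule W_higher[OF len'])
  have "(\<Prod>x\<leftarrow>g'. h (int x)) = (\<Prod>a = 0..<k. h (int (G a)))"
    by (subst prod_list_prod_nth) (simp add: len' g'_nth)
  also have "\<dots> = (\<Prod>a = 0..<l. h (int (G a))) * (\<Prod>a = l..<k. h (int (G a)))"
    using lk by (simp add: prod.atLeastLessThan_concat)
  also have "\<dots> = hterm t"
    unfolding hterm_def tail_def using nn
    by (intro arg_cong2[of _ _ _ _ "(*)"] prod.cong) (auto simp: G_def)
  finally show ?thesis using W by simp
qed

text \<open>Row a of the linear system: the part of the coefficient in \<open>W_v\<close> that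
  involves only the l unknowns \<open>u A\<close>, ..., \<open>u (A - l + 1)\<close>.\<close>

definition rhs :: "nat \<Rightarrow> 'a" where
  "rhs a = (\<Sum>j = 0..<l. h (int (g ! a) - int a + int j) * u (A - int j))"

text \<open>The terms are sorted by the degree of u: the window of the l unknowns, the degrees above
  A, which \<open>W_u\<close> disposes of, and the degrees below the window, whose cofactor from h
  is so large that the product is higher.\<close>

lemma v_split:
  assumes r: "r = A + int (g ! a) - int a"
  shows "(\<Sum>j = 0..nat r. h (int j) * u (r - int j)) = rhs a
    + (\<Sum>s \<in> {A<..r}. h (r - s) * u s) + (\<Sum>s \<in> {0..A - int l}. h (r - s) * u s)"
proof -
  let ?f = "\<lambda>s. h (r - s) * u s"
  have z: "?f s = 0" if "s \<notin> {0..r}" for s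
    using that h_neg[of "r - s"] u_neg[of s] by (cases "s < 0") auto
  have "(\<Sum>j = 0..nat r. h (int j) * u (r - int j)) = (\<Sum>s\<in>{0..r}. ?f s)"
  proof (cases "r < 0")
    case True
    then show ?thesis by (simp add: u_neg)
  next
    case False
    show ?thesis
      by (rule sum.reindex_bij_witness[of _ "\<lambda>s. nat (r - s)" "\<lambda>j. r - int j"]) (use False in auto)
  qed
  \<comment> \<open>Outside the interval from 0 to r one of the two factors has negative degree, so
    the full window may be summed.\<close>
  also have "\<dots> = sum ?f ({A - int l<..A} \<union> {A<..r} \<union> {0..A - int l})"
    by (rule sum.mono_neutral_left) (use z in auto)
  also have "\<dots> = sum ?f {A - int l<..A} + sum ?f {A<..r} + sum ?f {0..A - int l}"
    by (subst sum.union_disjoint, simp, simp, force, subst sum.union_disjoint) auto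
  also have "sum ?f {A - int l<..A} = rhs a"
    unfolding rhs_def
    by (rule sum.reindex_bij_witness[of _ "\<lambda>j. A - int j" "\<lambda>s. nat (A - s)"])
      (auto simp: r algebra_simps)
  finally show ?thesis .
qed

lemma rhs_term:
  assumes \<sigma>: "\<sigma> permutes {0..<l}" and a0: "a0 < l" and i: "\<sigma> a0 = i"
  shows "rhs a0 * ((\<Prod>a \<in> {0..<l} - {a0}. h (int (g ! a) - int a + int (\<sigma> a))) * tail) \<in> W"
    (is "_ * ?F \<in> W")
proof -
  define r where "r = A + int (g ! a0) - int a0"
  have F: "?F \<in> R" unfolding tail_def by (intro R_mult R_prod R_h)
  have 1: "(\<Sum>j = 0..nat r. h (int j) * u (r - int j)) * ?F \<in> W"
    unfolding r_def by (rule W_v[OF a0 F])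
  have 2: "(\<Sum>s \<in> {A<..r}. h (r - s) * u s) * ?F \<in> W"
    unfolding sum_distrib_right
  proof (rule W_sum)
    fix s assume "s \<in> {A<..r}"
    then have "u s * (h (r - s) * ?F) \<in> W" by (intro W_u R_mult R_h F) auto
    then show "h (r - s) * u s * ?F \<in> W" by (simp add: mult_ac)
  qed
  have 3: "(\<Sum>s \<in> {0..A - int l}. h (r - s) * u s) * ?F \<in> W"
    unfolding sum_distrib_right
  proof (rule W_sum)
    fix s assume s: "s \<in> {0..A - int l}"
    \<comment> \<open>Below the window, A - s is at least l and thus exceeds the column that
      \<sigma> uses in row \<open>a0\<close>; the sum of the column numbers becomes larger than that
      of the identity.\<close>
    define t where "t = \<sigma>(a0 := nat (A - s))"
    have il: "i < l" using permutes_in_image[OF \<sigma>, of a0] a0 i by simp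
    have "(\<Sum>a = 0..<l. a) = (\<Sum>a = 0..<l. \<sigma> a)"
      using sum.permute[OF \<sigma>, of id] by simp
    also have "\<dots> = i + (\<Sum>a \<in> {0..<l} - {a0}. \<sigma> a)"
      by (subst sum.remove[of _ a0]) (use a0 i in auto)
    also have "\<dots> < nat (A - s) + (\<Sum>a \<in> {0..<l} - {a0}. \<sigma> a)"
      using s il by auto
    also have "\<dots> = (\<Sum>a = 0..<l. t a)"
      by (subst sum.remove[of _ a0]) (use a0 in \<open>auto simp: t_def\<close>)
    finally have "u s * hterm t \<in> W" by (intro hterm_higher) simp
    moreover have "hterm t = h (r - s) * ?F"
    proof -
      have "h (int (g ! a0) - int a0 + int (t a0)) = h (r - s)"
        using s by (simp add: t_def r_def algebra_simps)
      moreover have "(\<Prod>a \<in> {0..<l} - {a0}. h (int (g ! a) - int a + int (t a)))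
          = (\<Prod>a \<in> {0..<l} - {a0}. h (int (g ! a) - int a + int (\<sigma> a)))"
        by (intro prod.cong) (auto simp: t_def)
      ultimately show ?thesis
        unfolding hterm_def using a0 by (subst prod.remove[of _ a0]) (auto simp: mult.assoc)
    qed
    ultimately show "h (r - s) * u s * ?F \<in> W" by (simp add: mult_ac)
  qed
  have "rhs a0 = (\<Sum>j = 0..nat r. h (int j) * u (r - int j))
      - (\<Sum>s \<in> {A<..r}. h (r - s) * u s) - (\<Sum>s \<in> {0..A - int l}. h (r - s) * u s)"
    using v_split[OF r_def] by (simp add: algebra_simps)
  then show ?thesis
    using W_diff[OF W_diff[OF 1 2] 3] by (simp add: left_diff_distrib)
qed

text \<open>Cramer's rule for the linear system in \<open>u (A - j)\<close>, \<open>j < l\<close>, which the coefficients of the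
  product of the generating functions of \<open>h\<close> and \<open>u\<close> provide.\<close>

lemma straighten:
  assumes i: "i < l"
  shows "u (A - int i) * (\<Prod>x\<leftarrow>g. h (int x)) \<in> W"
proof -
  define M where "M = mat l l (\<lambda>(a, j). h (int (g ! a) - int a + int j))"
  define x where "x = vec l (\<lambda>j. u (A - int j))"
  have M: "M \<in> carrier_mat l l" and x: "x \<in> carrier_vec l" by (simp_all add: M_def x_def)
  have "det (replace_col M (M *\<^sub>v x) i) = x $ i * det M"
    by (rule cramer_lemma_mat[OF M x i])
  then have cramer: "u (A - int i) * det M * tail = det (replace_col M (M *\<^sub>v x) i) * tail"
    using i by (simp add: x_def)
  have "det (replace_col M (M *\<^sub>v x) i) * tail = (\<Sum>\<sigma> \<in> {\<sigma>. \<sigma> permutes {0..<l}}.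
      of_int (sign \<sigma>) * ((\<Prod>a = 0..<l. replace_col M (M *\<^sub>v x) i $$ (a, \<sigma> a)) * tail))"
    by (subst det_def'[of _ l]) (auto simp: replace_col_def M_def sum_distrib_right mult.assoc)
  also have "\<dots> \<in> W"
  proof (intro W_sum W_sign)
    fix \<sigma> assume "\<sigma> \<in> {\<sigma>. \<sigma> permutes {0..<l}}"
    then have \<sigma>: "\<sigma> permutes {0..<l}" by simp
    \<comment> \<open>The only row whose factor is taken from the replaced column.\<close>
    define a0 where "a0 = inv_into UNIV \<sigma> i"
    have a0: "\<sigma> a0 = i" unfolding a0_def by (rule permutes_inverses(1)[OF \<sigma>])
    have a0l: "a0 < l" using permutes_in_image[OF \<sigma>, of a0] i a0 by simp
    have "(\<Prod>a = 0..<l. replace_col M (M *\<^sub>v x) i $$ (a, \<sigma> a))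
        = replace_col M (M *\<^sub>v x) i $$ (a0, \<sigma> a0)
          * (\<Prod>a \<in> {0..<l} - {a0}. replace_col M (M *\<^sub>v x) i $$ (a, \<sigma> a))"
      using a0l by (subst prod.remove[of _ a0]) auto
    also have "replace_col M (M *\<^sub>v x) i $$ (a0, \<sigma> a0) = rhs a0"
      using a0 a0l i by (simp add: replace_col_def M_def x_def rhs_def scalar_prod_def)
    also have "(\<Prod>a \<in> {0..<l} - {a0}. replace_col M (M *\<^sub>v x) i $$ (a, \<sigma> a))
        = (\<Prod>a \<in> {0..<l} - {a0}. h (int (g ! a) - int a + int (\<sigma> a)))"
    proof (rule prod.cong[OF refl])
      fix a assume a: "a \<in> {0..<l} - {a0}"
      then have "\<sigma> a \<noteq> i" using a0 permutes_inj[OF \<sigma>] by (metis DiffD2 injD singletonI)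
      moreover have "\<sigma> a < l" using a permutes_in_image[OF \<sigma>, of a] by simp
      ultimately show "replace_col M (M *\<^sub>v x) i $$ (a, \<sigma> a) = h (int (g ! a) - int a + int (\<sigma> a))"
        using a by (simp add: replace_col_def M_def)
    qed
    finally show "(\<Prod>a = 0..<l. replace_col M (M *\<^sub>v x) i $$ (a, \<sigma> a)) * tail \<in> W"
      using rhs_term[OF \<sigma> a0l a0] by (simp add: mult.assoc)
  qed
  finally have W1: "u (A - int i) * det M * tail \<in> W" by (simp only: cramer)
  define S where "S = {\<sigma>. \<sigma> permutes {0..<l}}"
  have S: "finite S" "id \<in> S" by (simp_all add: S_def finite_permutations)
  \<comment> \<open>Expanding the left-hand side of Cramer's rule isolates the wanted product as the
    term of the identity; the terms of all other permutations are higher.\<close>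
  have "u (A - int i) * det M * tail = (\<Sum>\<sigma>\<in>S. of_int (sign \<sigma>) * (u (A - int i) * hterm \<sigma>))"
  proof -
    have "(\<Prod>a = 0..<l. M $$ (a, \<sigma> a)) = (\<Prod>a = 0..<l. h (int (g ! a) - int a + int (\<sigma> a)))"
      if "\<sigma> \<in> S" for \<sigma>
      using that permutes_in_image[of \<sigma> "{0..<l}"] by (intro prod.cong) (auto simp: M_def S_def)
    then show ?thesis
      unfolding det_def'[OF M] S_def[symmetric] sum_distrib_left sum_distrib_right hterm_def
      by (intro sum.cong) (simp_all add: mult_ac)
  qed
  also have "\<dots> = u (A - int i) * hterm id
      + (\<Sum>\<sigma>\<in>S - {id}. of_int (sign \<sigma>) * (u (A - int i) * hterm \<sigma>))"
    by (subst sum.remove[OF S]) (simp add: sign_id)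
  finally have "u (A - int i) * hterm id = u (A - int i) * det M * tail
      - (\<Sum>\<sigma>\<in>S - {id}. of_int (sign \<sigma>) * (u (A - int i) * hterm \<sigma>))"
    by simp
  also have "\<dots> \<in> W"
    by (intro W_diff W1 W_sum W_sign hterm_higher) (auto simp: S_def)
  finally show ?thesis by (simp only: prod_list_eq_hterm_id)
qed

end

section \<open>Spanning\<close>

abbreviation hlast :: "nat list \<Rightarrow> nat list \<Rightarrow> cpoly" where
  "hlast \<mu> g \<equiv> (\<Prod>x\<leftarrow>g. hsym \<mu> {length \<mu>} (int x))"

lemma hsym_neg: "r < 0 \<Longrightarrow> hsym \<mu> I r = 0"
  by (simp add: hsym_def complete_sym_neg)

lemma hlast_Inv: "\<mu> \<noteq> [] \<Longrightarrow> hlast \<mu> g \<in> Inv \<mu>"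
proof (induction g)
  case (Cons x g)
  have "hsym \<mu> {length \<mu>} (int x) \<in> Inv \<mu>"
    by (rule hsym_closed) (use Cons in \<open>simp add: Suc_le_eq\<close>)
  then show ?case using Cons by (simp add: Inv_mult)
qed (simp add: Inv_one)

lemma hlast_mset: "mset g = mset g' \<Longrightarrow> hlast \<mu> g = hlast \<mu> g'"
  by (metis mset_map prod_mset_prod_list)

lemma Pol_0: "p \<in> Pol 0 \<Longrightarrow> p = const (Poly_Mapping.lookup p 0)"
proof (rule poly_mapping_eqI)
  fix m assume p: "p \<in> Pol 0"
  have "m = 0" if "m \<in> Poly_Mapping.keys p"
  proof -
    have "Poly_Mapping.keys m = {}" using p that by (auto simp: Pol_def)
    then show "m = 0" by simp
  qed
  then show "Poly_Mapping.lookup p m = Poly_Mapping.lookup (const (Poly_Mapping.lookup p 0)) m"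
    by (cases "m = 0") (auto simp: const_def lookup_single in_keys_iff)
qed

text \<open>The column indices decrease along g. If the one of part a were at most q, so would be
  those of all later parts, giving at least \<open>length g - a\<close> chosen columns up to
  q.\<close>

lemma card_col_set_le:
  assumes g: "sorted_wrt (\<ge>) g" and a: "a < length g - card (col_set g \<inter> {1..q})"
  shows "q < g ! a + (length g - a)"
proof (rule ccontr)
  assume "\<not> ?thesis"
  then have le: "g ! a + (length g - a) \<le> q" by simp
  let ?f = "\<lambda>b. g ! b + (length g - b)"
  have inj: "inj_on ?f {..<length g}"
    using card_col_set[OF g] by (intro eq_card_imp_inj_on) (auto simp: col_set_def)
  have "?f ` {a..<length g} \<subseteq> col_set g \<inter> {1..q}"
  proof (rule image_subsetI)
    fix b assume b: "b \<in> {a..<length g}"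
    have "g ! b \<le> g ! a"
      using g b by (cases "a = b") (auto simp: sorted_wrt_iff_nth_less)
    then have "?f b \<le> q" using le b by auto
    then show "?f b \<in> col_set g \<inter> {1..q}" using b by (auto simp: col_set_def)
  qed
  then have "card (?f ` {a..<length g}) \<le> card (col_set g \<inter> {1..q})"
    by (intro card_mono) auto
  moreover have "card (?f ` {a..<length g}) = length g - a"
    by (subst card_image[OF inj_on_subset[OF inj]]) auto
  ultimately show False using a by linarith
qed

lemma hsym_union_last:
  assumes ne: "\<mu> \<noteq> []" and I: "I \<subseteq> {1..length \<mu> - 1}"
  shows "hsym \<mu> (insert (length \<mu>) I) r
    = (\<Sum>j = 0..nat r. hsym \<mu> {length \<mu>} (int j) * hsym \<mu> I (r - int j))"
proof -
  have "finite I" by (rule finite_subset[OF I]) simp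
  then have "finite (\<Union>i\<in>I. block \<mu> i)" by (simp add: finite_block)
  moreover have "block \<mu> (length \<mu>) \<inter> (\<Union>i\<in>I. block \<mu> i) = {}"
  proof -
    have "block \<mu> (length \<mu>) \<inter> block \<mu> i = {}" if "i \<in> I" for i
    proof (rule block_disjoint)
      have "i \<in> {1..length \<mu> - 1}" using that I by blast
      then show "length \<mu> \<noteq> i" "1 \<le> length \<mu>" "1 \<le> i" using ne by (cases \<mu>; auto)+
    qed
    then show ?thesis by blast
  qed
  ultimately show ?thesis
    unfolding hsym_def using complete_sym_union[OF finite_block] by simp
qed

lemma ideal_gensI:
  assumes "I \<noteq> {}" "I \<subseteq> {1..length \<mu>}"
    "r > int (sum_list (take (card I) lam)) - (\<Sum>i\<in>I. int (\<mu> ! (i - 1)))"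
  shows "hsym \<mu> I r \<in> ideal_gens lam \<mu>"
  using assms unfolding ideal_gens_def by blast

text \<open>One step of the induction on the number of blocks. \<open>IH\<close> covers all shapes
  of the smaller size at once, because the shape that occurs varies with g.\<close>

locale spanning_step =
  fixes lam \<mu> :: "nat list" and d :: nat
  assumes ne: "\<mu> \<noteq> []" and lam: "lam \<in> Part (length \<mu>) d" and \<mu>: "sum_list \<mu> = d"
    and IH: "\<And>lam'. lam' \<in> Part (length \<mu> - 1) (d - last \<mu>) \<Longrightarrow>
      Inv (butlast \<mu>) \<subseteq> cp.span (tab_h (butlast \<mu>) ` Col lam' (butlast \<mu>) \<union> ideal_I lam' (butlast \<mu>))"
begin

abbreviation "n \<equiv> length \<mu>"
abbreviation "k \<equiv> last \<mu>"
abbreviation "W \<equiv> cp.span (tab_h \<mu> ` Col lam \<mu> \<union> ideal_I lam \<mu>)"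

lemma n_pos: "0 < n" using ne by simp

lemma lam_props: "length lam = n" "sorted_wrt (\<ge>) lam" "sum_list lam = d"
  using lam by (auto simp: Part_def Comp_def)

lemma ideal_W: "f \<in> ideal_I lam \<mu> \<Longrightarrow> f \<in> W"
  by (intro cp.span_base) blast

lemma h_closed: "hsym \<mu> {n} r \<in> Inv \<mu>"
  by (rule hsym_closed) (use ne in \<open>simp add: Suc_le_eq\<close>)

lemma mu_last: "\<mu> ! (n - 1) = k" using ne by (simp add: last_conv_nth)

lemma sum_insert_n:
  assumes "I \<subseteq> {1..n - 1}"
  shows "(\<Sum>i\<in>insert n I. int (\<mu> ! (i - 1))) = int k + (\<Sum>i\<in>I. int (\<mu> ! (i - 1)))"
proof -
  have "finite I" using assms finite_subset by blast
  moreover have "n \<notin> I"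
  proof
    assume "n \<in> I"
    then have "n \<in> {1..n - 1}" using assms by blast
    then have "n \<le> n - 1" by simp
    then show False using n_pos by linarith
  qed
  ultimately show ?thesis using mu_last by simp
qed

text \<open>The offending factor is itself a generator, belonging to the single block n with bound
  \<open>lam ! 0 - k\<close>.\<close>

lemma big_entry:
  assumes p: "p \<in> Inv \<mu>" and x: "x \<in> set g" "int x > int (lam ! 0) - int k"
  shows "p * hlast \<mu> g \<in> W"
proof -
  have "hsym \<mu> {n} (int x) \<in> ideal_gens lam \<mu>"
  proof (rule ideal_gensI)
    have "sum_list (take (card {n}) lam) = lam ! 0"
      using lam_props(1) n_pos by (cases lam) auto
    then show "int (sum_list (take (card {n}) lam)) - (\<Sum>i\<in>{n}. int (\<mu> ! (i - 1))) < int x"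
      using x(2) mu_last by simp
  qed (use n_pos in \<open>auto simp: Suc_le_eq\<close>)
  then have "hsym \<mu> {n} (int x) \<in> ideal_I lam \<mu>" by (rule ideal_gens_ideal_I)
  moreover obtain g1 g2 where g: "g = g1 @ x # g2" using x(1) by (meson split_list)
  ultimately have "(p * hlast \<mu> g1 * hlast \<mu> g2) * hsym \<mu> {n} (int x) \<in> ideal_I lam \<mu>"
    by (intro ideal_I_mult Inv_mult p hlast_Inv ne)
  then have "p * hlast \<mu> g \<in> ideal_I lam \<mu>" by (simp add: g mult_ac)
  then show ?thesis by (rule ideal_W)
qed

text \<open>For a generator of the smaller ideal, s is either beyond A or one of the l degrees
  directly up to A. Degrees beyond A are covered by the ideal of \<lambda>, the other l by
  \<open>straighten\<close>.\<close>

lemma key: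
  assumes g: "sorted_wrt (\<ge>) g" "length g = k"
    and hi: "\<And>g' p. length g' = k \<Longrightarrow>
      sum_list g < sum_list g' \<or> sum_list g = sum_list g' \<and>
        (\<Sum>x\<leftarrow>g. (k + 1) ^ x) < (\<Sum>x\<leftarrow>g'. (k + 1) ^ x) \<Longrightarrow>
      p \<in> Inv (butlast \<mu>) \<Longrightarrow> p * hlast \<mu> g' \<in> W"
    and I: "I \<subseteq> {1..n - 1}" and p: "p \<in> Inv (butlast \<mu>)"
    and s: "s > int (sum_list (take (card I) lam)) - (\<Sum>i\<in>I. int (\<mu> ! (i - 1)))
      - int (k - card (col_set g \<inter> {1..lam ! card I}))"
  shows "p * (hsym \<mu> I s * hlast \<mu> g) \<in> W"
proof -
  define m where "m = card I"
  define q where "q = lam ! m"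
  define A where "A = int (sum_list (take m lam)) - (\<Sum>i\<in>I. int (\<mu> ! (i - 1)))"
  define l where "l = k - card (col_set g \<inter> {1..q})"
  have finI: "finite I" using I finite_subset by blast
  have mn: "m \<le> n - 1" unfolding m_def using card_mono[OF _ I] by simp
  have take_m: "sum_list (take (Suc m) lam) = sum_list (take m lam) + q"
  proof -
    have "m < length lam" using mn n_pos lam_props(1) by linarith
    then show ?thesis by (simp add: q_def take_Suc_conv_app_nth)
  qed
  have I': "I \<subseteq> {1..n}" using I by (rule subset_trans) auto
  have card_n: "card (insert n I) = Suc m"
  proof -
    have "n \<notin> I"
    proof
      assume "n \<in> I"
      then have "n \<le> n - 1" using I by auto
      then show False using n_pos by linarith
    qed
    then show ?thesis using finI by (simp add: m_def)
  qed
  have u_closed: "hsym \<mu> I r \<in> Inv \<mu>" for r by (rule hsym_closed[OF I'])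
  have p\<mu>: "p \<in> Inv \<mu>" by (rule Inv_butlast[OF p ne])
  have ideal_u: "p * (hsym \<mu> I r * f) \<in> W" if "A < r" "f \<in> Inv \<mu>" for r f
  proof (cases "I = {}")
    \<comment> \<open>The empty set yields no generator, but then A is 0 and
      \<open>hsym \<mu> I r\<close> vanishes in positive degree. The case arises for n = 1 from
      \<open>sorted_case\<close>.\<close>
    case True
    then have "A = 0" by (simp add: A_def m_def)
    then show ?thesis using True that by (simp add: hsym_def complete_sym_empty cp.span_zero)
  next
    case False
    then have "hsym \<mu> I r \<in> ideal_I lam \<mu>"
      using that I' by (intro ideal_gens_ideal_I ideal_gensI) (auto simp: A_def m_def)
    then have "(p * f) * hsym \<mu> I r \<in> ideal_I lam \<mu>"
      by (intro ideal_I_mult Inv_mult that p\<mu>)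
    then show ?thesis by (intro ideal_W) (simp add: mult_ac)
  qed
  interpret straightening "hsym \<mu> {n}" "hsym \<mu> I" A g k l "Inv \<mu>" "{f. p * f \<in> W}"
  proof
    fix a :: nat and f assume a: "a < l" and f: "f \<in> Inv \<mu>"
    let ?r = "A + int (g ! a) - int a"
    \<comment> \<open>Adjoining block n to I changes the bound from A to A + q - k; the degree
      \<open>?r\<close> exceeds it exactly when the column index of part a is larger than q.\<close>
    have "q < g ! a + (k - a)" using card_col_set_le[OF g(1), of a q] a g(2) by (simp add: l_def)
    moreover have "a < k" using a by (simp add: l_def)
    ultimately have "int q < int (g ! a) + int k - int a" by linarith
    then have "hsym \<mu> (insert n I) ?r \<in> ideal_I lam \<mu>"
      using sum_insert_n[OF I] take_m card_n finI I' n_pos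
      by (intro ideal_gens_ideal_I ideal_gensI) (auto simp: A_def m_def Suc_le_eq simp del: sum.insert)
    then have "(p * f) * hsym \<mu> (insert n I) ?r \<in> ideal_I lam \<mu>"
      by (intro ideal_I_mult Inv_mult f p\<mu>)
    then have "p * (hsym \<mu> (insert n I) ?r * f) \<in> W"
      by (intro ideal_W) (simp add: mult_ac)
    then show "(\<Sum>j = 0..nat ?r. hsym \<mu> {n} (int j) * hsym \<mu> I (?r - int j)) * f \<in> {f. p * f \<in> W}"
      by (simp only: hsym_union_last[OF ne I, symmetric] mem_Collect_eq)
  next
    fix g' :: "nat list" and r assume g': "length g' = k"
      and hi': "sum_list g < sum_list g' \<or> sum_list g = sum_list g' \<and>
        (\<Sum>x\<leftarrow>g. (k + 1) ^ x) < (\<Sum>x\<leftarrow>g'. (k + 1) ^ x)"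
    have "I \<subseteq> {1..length (butlast \<mu>)}" using I by simp
    then have "hsym \<mu> I r \<in> Inv (butlast \<mu>)"
      using hsym_closed hsym_butlast by metis
    then have "(p * hsym \<mu> I r) * hlast \<mu> g' \<in> W"
      by (intro hi g' hi' Inv_mult p)
    then show "hsym \<mu> I r * hlast \<mu> g' \<in> {f. p * f \<in> W}" by (simp add: mult_ac)
  next
    fix r f assume "A < r" "f \<in> Inv \<mu>"
    then show "hsym \<mu> I r * f \<in> {f. p * f \<in> W}" using ideal_u by simp
  qed (use g h_closed in \<open>auto simp: hsym_neg l_def Inv_one cp.span_zero distrib_left
      intro: Inv_mult cp.span_add dest: cp.span_neg\<close>)
  show ?thesis
  proof (cases "A < s")
    case True
    then show ?thesis by (rule ideal_u) (rule hlast_Inv[OF ne])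
  next
    case False
    define i where "i = nat (A - s)"
    have "i < l" "A - int i = s"
      using s False unfolding i_def l_def A_def q_def m_def by linarith+
    then show ?thesis using straighten[of i] by simp
  qed
qed

lemma sorted_case:
  assumes g: "sorted_wrt (\<ge>) g" "length g = k"
    and hi: "\<And>g' p. length g' = k \<Longrightarrow>
      sum_list g < sum_list g' \<or> sum_list g = sum_list g' \<and>
        (\<Sum>x\<leftarrow>g. (k + 1) ^ x) < (\<Sum>x\<leftarrow>g'. (k + 1) ^ x) \<Longrightarrow>
      p \<in> Inv (butlast \<mu>) \<Longrightarrow> p * hlast \<mu> g' \<in> W"
    and small: "\<And>x. x \<in> set g \<Longrightarrow> int x \<le> int (lam ! 0) - int k"
    and p: "p \<in> Inv (butlast \<mu>)"
  shows "p * hlast \<mu> g \<in> W"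
proof (cases "{1..lam ! (n - 1)} \<subseteq> col_set g")
  case False
  \<comment> \<open>Some column of full length is not chosen. For all first blocks together, A is k
    - \<open>?q\<close>, whereas l is larger than that because fewer than \<open>?q\<close> columns
    are chosen up to \<open>?q\<close>. So degree 0 is admissible in \<open>key\<close>, where the
    generator is replaced by 1.\<close>
  let ?I = "{1..n - 1}" and ?q = "lam ! (n - 1)"
  have "card (col_set g \<inter> {1..?q}) < card {1..?q}"
    using False by (intro psubset_card_mono) auto
  then have c: "card (col_set g \<inter> {1..?q}) < ?q" by simp
  have take: "lam = take (n - 1) lam @ [?q]"
    using take_Suc_conv_app_nth[of "n - 1" lam] lam_props(1) n_pos by simp
  have "d = sum_list (take (n - 1) lam) + ?q"
    by (subst lam_props(3)[symmetric], subst take) simp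
  moreover have "(\<Sum>i\<in>?I. int (\<mu> ! (i - 1))) = int d - int k"
  proof -
    have "(\<Sum>i\<in>?I. int (\<mu> ! (i - 1))) = (\<Sum>i = 0..<n - 1. int (\<mu> ! i))"
      by (rule sum.reindex_bij_witness[of _ "\<lambda>i. i + 1" "\<lambda>i. i - 1"]) auto
    also have "\<dots> = (\<Sum>i = 0..<n - 1. int (butlast \<mu> ! i))"
      by (intro sum.cong) (auto simp: nth_butlast)
    also have "\<dots> = int (sum_list (butlast \<mu>))" by (simp add: sum_list_sum_nth)
    finally show ?thesis using sum_list_butlast[OF ne] \<mu> by simp
  qed
  ultimately have A0: "int (sum_list (take (n - 1) lam)) - (\<Sum>i\<in>?I. int (\<mu> ! (i - 1))) = int k - int ?q"
    by simp
  have "0 > int (sum_list (take (card ?I) lam)) - (\<Sum>i\<in>?I. int (\<mu> ! (i - 1)))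
      - int (k - card (col_set g \<inter> {1..lam ! card ?I}))"
  proof -
    have "int k - int (card (col_set g \<inter> {1..?q})) \<le> int (k - card (col_set g \<inter> {1..?q}))" by linarith
    then show ?thesis using c A0 by simp
  qed
  from key[OF g hi order_refl p this] have "p * (hsym \<mu> ?I 0 * hlast \<mu> g) \<in> W" .
  moreover have "hsym \<mu> ?I 0 = 1"
    unfolding hsym_def by (rule complete_sym_zero) (simp add: finite_block)
  ultimately show ?thesis by simp
next
  case True
  define lam' where "lam' = removed_shape lam g"
  have C: "col_set g \<subseteq> {1..lam ! 0}"
  proof
    fix c assume "c \<in> col_set g"
    then obtain a where a: "a < k" "c = g ! a + (k - a)" using g(2) by (auto simp: col_set_def)
    have "int (g ! a) \<le> int (lam ! 0) - int k" using small a(1) g(2) by simp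
    then show "c \<in> {1..lam ! 0}" using a by auto
  qed
  have "lam' \<in> Part (n - 1) (d - k)"
    unfolding lam'_def using removed_shape_Part[OF lam _ g(1) C True] n_pos g(2) by simp
  then have pspan: "p \<in> cp.span (tab_h (butlast \<mu>) ` Col lam' (butlast \<mu>) \<union> ideal_I lam' (butlast \<mu>))"
    using IH p by blast
  have ideal: "f * hlast \<mu> g \<in> W" if "f \<in> ideal_I lam' (butlast \<mu>)" for f
    using that[unfolded ideal_I_eq_span]
  proof (induction f rule: cp.span_induct_alt)
    case base
    then show ?case by (simp add: cp.span_zero)
  next
    case (step c x y)
    then obtain p' u where x: "x = p' * u" "p' \<in> Inv (butlast \<mu>)" "u \<in> ideal_gens lam' (butlast \<mu>)"
      by blast
    then obtain I r where u: "u = hsym (butlast \<mu>) I r" and I: "I \<subseteq> {1..length (butlast \<mu>)}"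
      and r: "r > int (sum_list (take (card I) lam')) - (\<Sum>i\<in>I. int (butlast \<mu> ! (i - 1)))"
      by (auto simp: ideal_gens_def)
    have I': "I \<subseteq> {1..n - 1}" using I by simp
    have "card I \<le> n - 1" using card_mono[OF _ I'] by simp
    then have m: "card I < length lam" using lam_props(1) n_pos by linarith
    \<comment> \<open>All chosen columns are columns of \<lambda>, so the number beyond
      \<open>lam ! card I\<close> is both the window length in \<open>key\<close> and the loss in
      \<open>sum_removed_shape\<close>.\<close>
    have "col_set g = (col_set g \<inter> {1..lam ! card I}) \<union> (col_set g \<inter> {lam ! card I<..lam ! 0})"
    proof -
      have "lam ! card I \<le> lam ! 0"
        using lam_props(2) m by (cases "card I") (auto simp: sorted_wrt_iff_nth_less)
      then show ?thesis using C by auto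
    qed
    then have "card (col_set g) = card ((col_set g \<inter> {1..lam ! card I}) \<union> (col_set g \<inter> {lam ! card I<..lam ! 0}))"
      by (rule arg_cong)
    also have "\<dots> = card (col_set g \<inter> {1..lam ! card I}) + card (col_set g \<inter> {lam ! card I<..lam ! 0})"
      by (rule card_Un_disjoint) auto
    finally have "k - card (col_set g \<inter> {1..lam ! card I}) = card (col_set g \<inter> {lam ! card I<..lam ! 0})"
      using card_col_set[OF g(1)] g(2) by simp
    moreover have "(\<Sum>i\<in>I. int (butlast \<mu> ! (i - 1))) = (\<Sum>i\<in>I. int (\<mu> ! (i - 1)))"
    proof (intro sum.cong refl)
      fix i assume "i \<in> I"
      then have "i \<in> {1..n - 1}" using I' by blast
      then have "i - 1 < length (butlast \<mu>)" by auto
      then show "int (butlast \<mu> ! (i - 1)) = int (\<mu> ! (i - 1))" by (simp add: nth_butlast)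
    qed
    ultimately have "r > int (sum_list (take (card I) lam)) - (\<Sum>i\<in>I. int (\<mu> ! (i - 1)))
        - int (k - card (col_set g \<inter> {1..lam ! card I}))"
      using r sum_removed_shape[OF lam_props(2) m, of g] by (simp add: lam'_def)
    from key[OF g hi I' x(2) this] have "x * hlast \<mu> g \<in> W"
      unfolding x(1) u hsym_butlast[OF I] by (simp add: mult_ac)
    then have "const c * (x * hlast \<mu> g) + y * hlast \<mu> g \<in> W"
      by (intro cp.span_add cp.span_scale step.IH)
    then show ?case by (simp add: algebra_simps)
  qed
  from pspan show ?thesis
  proof (induction p rule: cp.span_induct_alt)
    case base
    then show ?case by (simp add: cp.span_zero)
  next
    case (step c x y)
    have "x * hlast \<mu> g \<in> W"
    proof (cases "x \<in> ideal_I lam' (butlast \<mu>)")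
      case True
      then show ?thesis by (rule ideal)
    next
      case False
      then obtain S where S: "S \<in> Col lam' (butlast \<mu>)" "x = tab_h (butlast \<mu>) S"
        using step.hyps by blast
      then obtain T where "T \<in> Col lam \<mu>" "tab_h \<mu> T = x * hlast \<mu> g"
        using tab_h_restore_entry[OF lam ne g C True] unfolding lam'_def by blast
      then show ?thesis by (metis UnI1 cp.span_base image_eqI)
    qed
    then have "const c * (x * hlast \<mu> g) + y * hlast \<mu> g \<in> W"
      by (intro cp.span_add cp.span_scale step.IH)
    then show ?case by (simp add: algebra_simps)
  qed
qed

text \<open>Products with a part beyond \<open>lam ! 0 - k\<close> are settled at once. The
  remaining lists have bounded degree and weight, so the distances to these bounds decrease and the
  passage to higher products terminates.\<close>

lemma all_hlast:
  assumes "length g = k" "p \<in> Inv (butlast \<mu>)"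
  shows "p * hlast \<mu> g \<in> W"
  using assms
proof (induction g arbitrary: p rule: wf_induct_rule[OF wf_measures[of
      "[\<lambda>g. k * lam ! 0 - sum_list g, \<lambda>g. k * (k + 1) ^ (lam ! 0) - (\<Sum>x\<leftarrow>g. (k + 1) ^ x)]"]])
  case (1 g)
  have p\<mu>: "p \<in> Inv \<mu>" if "p \<in> Inv (butlast \<mu>)" for p by (rule Inv_butlast[OF that ne])
  show ?case
  proof (cases "\<exists>x\<in>set g. int x > int (lam ! 0) - int k")
    case True
    then show ?thesis using big_entry[OF p\<mu>[OF "1.prems"(2)]] by blast
  next
    case False
    define g0 where "g0 = rev (sort g)"
    have mset: "mset g0 = mset g" by (simp add: g0_def)
    have g0: "sorted_wrt (\<ge>) g0" "length g0 = k"
      using "1.prems"(1) by (simp_all add: g0_def sorted_wrt_rev)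
    have sums: "sum_list g0 = sum_list g" "(\<Sum>x\<leftarrow>g0. (k + 1) ^ x) = (\<Sum>x\<leftarrow>g. (k + 1) ^ x)"
      using sum_list_map_mset_eq[OF mset, of "\<lambda>x. x"] sum_list_map_mset_eq[OF mset] by simp_all
    have "p * hlast \<mu> g0 \<in> W"
    proof (rule sorted_case[OF g0])
      fix x assume "x \<in> set g0"
      then show "int x \<le> int (lam ! 0) - int k"
        using False mset_eq_setD[OF mset] by auto
    next
      fix g' p' assume g': "length g' = k" and p': "p' \<in> Inv (butlast \<mu>)"
        and hi: "sum_list g0 < sum_list g' \<or> sum_list g0 = sum_list g' \<and>
          (\<Sum>x\<leftarrow>g0. (k + 1) ^ x) < (\<Sum>x\<leftarrow>g'. (k + 1) ^ x)"
      show "p' * hlast \<mu> g' \<in> W"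
      proof (cases "\<exists>x\<in>set g'. int x > int (lam ! 0) - int k")
        case True
        then show ?thesis using big_entry[OF p\<mu>[OF p']] by blast
      next
        case F: False
        have le: "x \<le> lam ! 0" if "x \<in> set g'" for x using F that by force
        have "sum_list g' \<le> k * lam ! 0"
          using sum_list_mono[of g' "\<lambda>x. x" "\<lambda>_. lam ! 0"] le g' by (simp add: sum_list_triv)
        moreover have "(\<Sum>x\<leftarrow>g'. (k + 1) ^ x) \<le> k * (k + 1) ^ (lam ! 0)"
          using sum_list_mono[of g' "\<lambda>x. (k + 1) ^ x" "\<lambda>_. (k + 1) ^ (lam ! 0)"]
            power_increasing[OF le, of _ "k + 1"] g' by (simp add: sum_list_triv)
        ultimately have "k * lam ! 0 - sum_list g' < k * lam ! 0 - sum_list g \<or>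
            k * lam ! 0 - sum_list g' = k * lam ! 0 - sum_list g \<and>
            k * (k + 1) ^ (lam ! 0) - (\<Sum>x\<leftarrow>g'. (k + 1) ^ x)
              < k * (k + 1) ^ (lam ! 0) - (\<Sum>x\<leftarrow>g. (k + 1) ^ x)"
          using hi unfolding sums by linarith
        then show ?thesis
          by (intro "1.IH" g' p') simp
      qed
    qed (rule "1.prems")
    then show ?thesis by (simp only: hlast_mset[OF mset])
  qed
qed

lemma Inv_W: "Inv \<mu> \<subseteq> W"
proof
  fix f assume "f \<in> Inv \<mu>"
  then have "f \<in> cp.span {q * hlast \<mu> g | q g. q \<in> Inv (butlast \<mu>) \<and> length g = k}"
    by (rule Inv_span_hlast[OF ne])
  moreover have "{q * hlast \<mu> g | q g. q \<in> Inv (butlast \<mu>) \<and> length g = k} \<subseteq> W"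
    using all_hlast by blast
  ultimately show "f \<in> W" using cp.span_minimal[OF _ cp.subspace_span] by blast
qed

end

theorem Inv_spanned:
  assumes "lam \<in> Part n d" "\<mu> \<in> Comp n d"
  shows "Inv \<mu> \<subseteq> cp.span (tab_h \<mu> ` Col lam \<mu> \<union> ideal_I lam \<mu>)"
  using assms
proof (induction n arbitrary: lam \<mu> d)
  case 0
  then have [simp]: "lam = []" "\<mu> = []" by (auto simp: Part_def Comp_def)
  have "[] \<in> Col [] []" by (auto simp: Col_def boxes_def young_diagram_def)
  then have one: "1 \<in> tab_h \<mu> ` Col lam \<mu> \<union> ideal_I lam \<mu>"
    by (auto simp: tab_h_Nil intro!: image_eqI[of _ _ "[]"])
  show ?case
  proof
    fix p assume "p \<in> Inv \<mu>"
    then have "p = const (Poly_Mapping.lookup p 0) * 1" using Pol_0[of p] by (simp add: Inv_iff)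
    then show "p \<in> cp.span (tab_h \<mu> ` Col lam \<mu> \<union> ideal_I lam \<mu>)"
      using cp.span_scale[OF cp.span_base[OF one]] by metis
  qed
next
  case (Suc n)
  then have len: "length \<mu> = Suc n" "sum_list \<mu> = d" by (auto simp: Comp_def)
  then have ne: "\<mu> \<noteq> []" by auto
  interpret spanning_step lam \<mu> d
  proof
    show "\<mu> \<noteq> []" by (rule ne)
    show "lam \<in> Part (length \<mu>) d" "sum_list \<mu> = d" using Suc.prems len by simp_all
    fix lam' assume "lam' \<in> Part (length \<mu> - 1) (d - last \<mu>)"
    moreover have "butlast \<mu> \<in> Comp n (d - last \<mu>)"
      using sum_list_butlast[OF ne] len by (simp add: Comp_def)
    ultimately show "Inv (butlast \<mu>) \<subseteq> cp.span (tab_h (butlast \<mu>) ` Col lam' (butlast \<mu>) \<union> ideal_I lam' (butlast \<mu>))"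
      using len by (intro Suc.IH[where d = "d - last \<mu>"]) simp_all
  qed
  show ?case by (rule Inv_W)
qed

section \<open>Evaluation and homogeneous components\<close>

definition mon_val :: "(nat \<Rightarrow> complex) \<Rightarrow> (nat \<Rightarrow>\<^sub>0 nat) \<Rightarrow> complex" where
  "mon_val z m = (\<Prod>i\<in>Poly_Mapping.keys m. z i ^ Poly_Mapping.lookup m i)"

definition ev :: "(nat \<Rightarrow> complex) \<Rightarrow> cpoly \<Rightarrow> complex" where
  "ev z p = (\<Sum>m\<in>Poly_Mapping.keys p. Poly_Mapping.lookup p m * mon_val z m)"

lemma mon_val_superset:
  assumes "finite A" "Poly_Mapping.keys m \<subseteq> A"
  shows "mon_val z m = (\<Prod>i\<in>A. z i ^ Poly_Mapping.lookup m i)"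
  unfolding mon_val_def
  by (rule prod.mono_neutral_left) (use assms in \<open>auto simp: in_keys_iff\<close>)

lemma mon_val_add: "mon_val z (m + m') = mon_val z m * mon_val z m'"
proof -
  let ?A = "Poly_Mapping.keys m \<union> Poly_Mapping.keys m'"
  have "mon_val z (m + m') = (\<Prod>i\<in>?A. z i ^ Poly_Mapping.lookup (m + m') i)"
    by (rule mon_val_superset) (auto dest: subsetD[OF Poly_Mapping.keys_add])
  also have "\<dots> = mon_val z m * mon_val z m'"
    by (subst (1 2) mon_val_superset[of ?A]) (auto simp: lookup_add power_add prod.distrib)
  finally show ?thesis .
qed

lemma ev_superset:
  assumes "finite K" "Poly_Mapping.keys p \<subseteq> K"
  shows "ev z p = (\<Sum>m\<in>K. Poly_Mapping.lookup p m * mon_val z m)"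
  unfolding ev_def
  by (rule sum.mono_neutral_left) (use assms in \<open>auto simp: in_keys_iff\<close>)

lemma ev_add: "ev z (p + q) = ev z p + ev z q"
proof -
  let ?K = "Poly_Mapping.keys p \<union> Poly_Mapping.keys q"
  have "ev z (p + q) = (\<Sum>m\<in>?K. Poly_Mapping.lookup (p + q) m * mon_val z m)"
    by (rule ev_superset) (auto dest: subsetD[OF Poly_Mapping.keys_add])
  also have "\<dots> = ev z p + ev z q"
    by (subst (1 2) ev_superset[of ?K]) (auto simp: lookup_add distrib_right sum.distrib)
  finally show ?thesis .
qed

lemma ev_zero: "ev z 0 = 0"
  by (simp add: ev_def)

lemma ev_sum: "ev z (sum f A) = (\<Sum>i\<in>A. ev z (f i))"
  by (induction A rule: infinite_finite_induct) (simp_all add: ev_zero ev_add)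

lemma ev_single: "ev z (Poly_Mapping.single m c) = c * mon_val z m"
  by (simp add: ev_def)

lemma ev_mult: "ev z (p * q) = ev z p * ev z q"
proof -
  have "p * q = (\<Sum>m\<in>Poly_Mapping.keys p. Poly_Mapping.single m (Poly_Mapping.lookup p m))
      * (\<Sum>m\<in>Poly_Mapping.keys q. Poly_Mapping.single m (Poly_Mapping.lookup q m))"
    by (simp only: sum_singles)
  also have "\<dots> = (\<Sum>m\<in>Poly_Mapping.keys p. \<Sum>m'\<in>Poly_Mapping.keys q.
      Poly_Mapping.single (m + m') (Poly_Mapping.lookup p m * Poly_Mapping.lookup q m'))"
    by (simp only: sum_product mult_single)
  finally have "ev z (p * q) = (\<Sum>m\<in>Poly_Mapping.keys p. \<Sum>m'\<in>Poly_Mapping.keys q.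
      Poly_Mapping.lookup p m * Poly_Mapping.lookup q m' * (mon_val z m * mon_val z m'))"
    by (simp only: ev_sum ev_single mon_val_add)
  then show ?thesis unfolding ev_def sum_product by (simp add: mult_ac)
qed

lemma ev_const: "ev z (const c) = c"
  by (simp add: const_def ev_single mon_val_def)

lemma ev_one: "ev z 1 = 1"
  using ev_const[of z 1] by (simp add: const_one)

lemma ev_var: "ev z (var i) = z i"
  by (simp add: var_def ev_single mon_val_def)

lemma ev_prod: "ev z (prod f A) = (\<Prod>i\<in>A. ev z (f i))"
  by (induction A rule: infinite_finite_induct) (simp_all add: ev_one ev_mult)

lemma ev_uminus: "ev z (- p) = - ev z p"
  using ev_add[of z p "- p"] by (simp add: ev_zero eq_neg_iff_add_eq_0 add.commute)

lemma ev_diff: "ev z (p - q) = ev z p - ev z q"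
  using ev_add[of z p "- q"] by (simp add: ev_uminus)

section \<open>Degrees and homogeneous components\<close>

definition mdeg :: "(nat \<Rightarrow>\<^sub>0 nat) \<Rightarrow> nat" where
  "mdeg m = (\<Sum>i\<in>Poly_Mapping.keys m. Poly_Mapping.lookup m i)"

lemma mdeg_superset:
  assumes "finite A" "Poly_Mapping.keys m \<subseteq> A"
  shows "mdeg m = (\<Sum>i\<in>A. Poly_Mapping.lookup m i)"
  unfolding mdeg_def
  by (rule sum.mono_neutral_left) (use assms in \<open>auto simp: in_keys_iff\<close>)

lemma mdeg_add: "mdeg (m + m') = mdeg m + mdeg m'"
proof -
  let ?A = "Poly_Mapping.keys m \<union> Poly_Mapping.keys m'"
  have "mdeg (m + m') = (\<Sum>i\<in>?A. Poly_Mapping.lookup (m + m') i)"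
    by (rule mdeg_superset) (auto dest: subsetD[OF Poly_Mapping.keys_add])
  also have "\<dots> = mdeg m + mdeg m'"
    by (subst (1 2) mdeg_superset[of ?A]) (auto simp: lookup_add sum.distrib)
  finally show ?thesis .
qed

lemma mdeg_map_key:
  assumes "bij \<sigma>"
  shows "mdeg (Poly_Mapping.map_key \<sigma> m) = mdeg m"
proof -
  have "bij_betw \<sigma> (\<sigma> -` Poly_Mapping.keys m) (Poly_Mapping.keys m)"
    using assms by (auto simp: bij_betw_def bij_is_surj surj_image_vimage_eq intro: inj_on_subset[OF bij_is_inj])
  then have "(\<Sum>i\<in>\<sigma> -` Poly_Mapping.keys m. Poly_Mapping.lookup m (\<sigma> i)) = mdeg m"
    unfolding mdeg_def by (rule sum.reindex_bij_betw)
  then show ?thesis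
    using assms by (simp add: mdeg_def keys_map_key bij_is_inj map_key_perm)
qed

definition homog :: "nat \<Rightarrow> cpoly \<Rightarrow> bool" where
  "homog s p \<longleftrightarrow> (\<forall>m\<in>Poly_Mapping.keys p. mdeg m = s)"

text \<open>The inequality is strict so that degree bound 0 leaves only the zero polynomial, the
  base of the induction in \<open>filtered\<close>.\<close>

definition deg_less :: "nat \<Rightarrow> cpoly \<Rightarrow> bool" where
  "deg_less s p \<longleftrightarrow> (\<forall>m\<in>Poly_Mapping.keys p. mdeg m < s)"

definition hcomp :: "nat \<Rightarrow> cpoly \<Rightarrow> cpoly" where
  "hcomp s p = (\<Sum>m\<in>{m\<in>Poly_Mapping.keys p. mdeg m = s}. Poly_Mapping.single m (Poly_Mapping.lookup p m))"

lemma lookup_hcomp: "Poly_Mapping.lookup (hcomp s p) m = (if mdeg m = s then Poly_Mapping.lookup p m else 0)"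
proof -
  have "Poly_Mapping.lookup (hcomp s p) m
      = (\<Sum>i\<in>{m\<in>Poly_Mapping.keys p. mdeg m = s}. if i = m then Poly_Mapping.lookup p i else 0)"
    unfolding hcomp_def lookup_sum by (intro sum.cong) (auto simp: lookup_single when_def)
  then show ?thesis by (auto simp: in_keys_iff)
qed

lemma lookup_const_mult: "Poly_Mapping.lookup (const c * p) m = c * Poly_Mapping.lookup p m"
proof -
  have "const c * p = (\<Sum>m\<in>Poly_Mapping.keys p. Poly_Mapping.single m (c * Poly_Mapping.lookup p m))"
    by (subst (1) sum_singles[symmetric]) (simp add: sum_distrib_left const_def mult_single)
  also have "Poly_Mapping.lookup \<dots> m = (\<Sum>i\<in>Poly_Mapping.keys p. if i = m then c * Poly_Mapping.lookup p i else 0)"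
    unfolding lookup_sum by (intro sum.cong) (auto simp: lookup_single when_def)
  also have "\<dots> = c * Poly_Mapping.lookup p m" by (auto simp: in_keys_iff)
  finally show ?thesis .
qed

lemma hcomp_add: "hcomp s (p + q) = hcomp s p + hcomp s q"
  by (rule poly_mapping_eqI) (simp add: lookup_hcomp lookup_add)

lemma hcomp_zero: "hcomp s 0 = 0"
  by (rule poly_mapping_eqI) (simp add: lookup_hcomp)

lemma hcomp_scale: "hcomp s (const c * p) = const c * hcomp s p"
  by (rule poly_mapping_eqI) (simp add: lookup_hcomp lookup_const_mult)

lemma hcomp_sum: "hcomp s (sum f A) = (\<Sum>i\<in>A. hcomp s (f i))"
  by (induction A rule: infinite_finite_induct) (simp_all add: hcomp_zero hcomp_add)

lemma hcomp_homog: "homog t p \<Longrightarrow> hcomp s p = (if s = t then p else 0)"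
  by (rule poly_mapping_eqI) (auto simp: lookup_hcomp homog_def in_keys_iff)

lemma homog_hcomp: "homog s (hcomp s p)"
  by (auto simp: homog_def in_keys_iff lookup_hcomp split: if_splits)

lemma hcomp_Inv:
  assumes "p \<in> Inv \<mu>"
  shows "hcomp s p \<in> Inv \<mu>"
  unfolding Inv_iff
proof (intro conjI ballI)
  show "hcomp s p \<in> Pol (sum_list \<mu>)"
    using assms by (auto simp: Inv_iff Pol_def in_keys_iff[of _ "hcomp s p"] in_keys_iff[of _ p] lookup_hcomp split: if_splits)
  fix \<sigma> assume \<sigma>: "\<sigma> \<in> young_subgroup \<mu>"
  have b: "bij \<sigma>" by (rule young_subgroup_bij[OF \<sigma>])
  have "Poly_Mapping.lookup (permute_vars \<sigma> p) m = Poly_Mapping.lookup p m" for m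
    using assms \<sigma> by (simp add: Inv_iff)
  then show "permute_vars \<sigma> (hcomp s p) = hcomp s p"
    by (intro poly_mapping_eqI) (simp add: lookup_permute_vars[OF b] lookup_hcomp mdeg_map_key[OF b])
qed

lemma homog_mult: "homog s p \<Longrightarrow> homog t q \<Longrightarrow> homog (s + t) (p * q)"
  unfolding homog_def using keys_mult[of p q] by (fastforce simp: mdeg_add)

lemma homog_one: "homog 0 1"
  by (simp add: homog_def mdeg_def)

lemma homog_single: "homog (mdeg m) (Poly_Mapping.single m c)"
  by (simp add: homog_def)

lemma deg_less_add: "deg_less s p \<Longrightarrow> deg_less s q \<Longrightarrow> deg_less s (p + q)"
  unfolding deg_less_def using Poly_Mapping.keys_add[of p q] by blast

lemma deg_less_uminus: "deg_less s p \<Longrightarrow> deg_less s (- p)"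
  by (simp add: deg_less_def in_keys_iff)

lemma deg_less_diff: "deg_less s p \<Longrightarrow> deg_less s q \<Longrightarrow> deg_less s (p - q)"
  using deg_less_add[of s p "- q"] deg_less_uminus[of s q] by simp

lemma deg_less_zero: "deg_less s 0"
  by (simp add: deg_less_def)

lemma deg_less_scale: "deg_less s p \<Longrightarrow> deg_less s (const c * p)"
  by (auto simp: deg_less_def in_keys_iff lookup_const_mult)

lemma deg_less_sum: "(\<And>i. i \<in> A \<Longrightarrow> deg_less s (f i)) \<Longrightarrow> deg_less s (sum f A)"
  by (induction A rule: infinite_finite_induct) (auto simp: deg_less_zero deg_less_add)

lemma homog_mult_deg_less: "homog s p \<Longrightarrow> deg_less t q \<Longrightarrow> deg_less (s + t) (p * q)"
  unfolding homog_def deg_less_def using keys_mult[of p q] by (fastforce simp: mdeg_add)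

lemma homog_deg_less: "homog s p \<Longrightarrow> s < t \<Longrightarrow> deg_less t p"
  by (auto simp: homog_def deg_less_def)

lemma deg_less_Suc: "deg_less (Suc s) p \<Longrightarrow> deg_less s (p - hcomp s p)"
  by (force simp: deg_less_def in_keys_iff lookup_minus lookup_hcomp less_Suc_eq split: if_splits)

lemma hcomp_mult_homog:
  assumes g: "homog r g"
  shows "hcomp s (p * g) = (if r \<le> s then hcomp (s - r) p * g else 0)"
proof -
  let ?c = "\<lambda>m. Poly_Mapping.single m (Poly_Mapping.lookup p m)"
  have p: "p = (\<Sum>m\<in>Poly_Mapping.keys p. ?c m)" by (simp only: sum_singles)
  have summand: "hcomp s (?c m * g) = (if r \<le> s then hcomp (s - r) (?c m) * g else 0)" for m
    using hcomp_homog[OF homog_mult[OF homog_single[of m "Poly_Mapping.lookup p m"] g], of s]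
      hcomp_homog[OF homog_single[of m "Poly_Mapping.lookup p m"], of "s - r"]
    by auto
  have "hcomp s (p * g) = (\<Sum>m\<in>Poly_Mapping.keys p. hcomp s (?c m * g))"
    by (subst p) (simp add: sum_distrib_right hcomp_sum)
  also have "\<dots> = (if r \<le> s then (\<Sum>m\<in>Poly_Mapping.keys p. hcomp (s - r) (?c m)) * g else 0)"
    by (simp add: summand sum_distrib_right)
  also have "(\<Sum>m\<in>Poly_Mapping.keys p. hcomp (s - r) (?c m)) = hcomp (s - r) p"
    by (subst (2) p) (simp add: hcomp_sum)
  finally show ?thesis .
qed

lemma ex_deg_less: "\<exists>s. deg_less s p"
proof -
  have "deg_less (Suc (Max (mdeg ` Poly_Mapping.keys p))) p"
    by (auto simp: deg_less_def less_Suc_eq_le)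
  then show ?thesis by blast
qed

lemma homog_complete_sym:
  assumes "finite A"
  shows "homog (nat r) (complete_sym A r)"
  unfolding homog_def
proof
  fix m assume "m \<in> Poly_Mapping.keys (complete_sym A r)"
  then have m: "Poly_Mapping.keys m \<subseteq> A \<and> int (\<Sum>k\<in>A. Poly_Mapping.lookup m k) = r"
    by (simp add: in_keys_iff lookup_complete_sym[OF assms] split: if_splits)
  then show "mdeg m = nat r" using mdeg_superset[OF assms, of m] by linarith
qed

lemma homog_hsym: "finite I \<Longrightarrow> homog (nat r) (hsym \<mu> I r)"
  unfolding hsym_def by (rule homog_complete_sym) (simp add: finite_block)

lemma homog_prod: "(\<And>i. i \<in> A \<Longrightarrow> \<exists>s. homog s (f i)) \<Longrightarrow> \<exists>s. homog s (prod f A)"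
proof (induction A rule: infinite_finite_induct)
  case (insert a A)
  obtain s where "homog s (prod f A)" using insert by auto
  moreover obtain t where "homog t (f a)" using insert.prems by auto
  ultimately show ?case using insert.hyps homog_mult by (metis prod.insert)
qed (use homog_one in auto)

lemma tab_h_homog: "\<exists>s. homog s (tab_h \<mu> T)"
proof (induction \<mu> arbitrary: T rule: rev_induct)
  case Nil
  show ?case using homog_one by (auto simp: tab_h_Nil)
next
  case (snoc k \<mu>)
  obtain s where "homog s (tab_h \<mu> (remove_entry (length (\<mu> @ [k])) T))" using snoc.IH by blast
  moreover obtain t where "homog t (\<Prod>i = 1..k. hsym (\<mu> @ [k]) {length (\<mu> @ [k])}
      (gamma_part (length (\<mu> @ [k])) k T i))"
    using homog_prod[of "{1..k}" "\<lambda>i. hsym (\<mu> @ [k]) {length (\<mu> @ [k])} (gamma_part (length (\<mu> @ [k])) k T i)"]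
      homog_hsym by blast
  ultimately show ?case
    by (subst tab_h_rec) (auto dest: homog_mult)
qed

section \<open>Points attached to tableaux\<close>

definition cols_with :: "tableau \<Rightarrow> nat \<Rightarrow> nat set" where
  "cols_with T i = {c. c < length T \<and> i \<in> set (T ! c)}"

lemma finite_cols_with: "finite (cols_with T i)"
  by (simp add: cols_with_def)

text \<open>Columns are strictly increasing, so each occurrence of an entry lies in a column of its
  own.\<close>

lemma card_cols_with:
  assumes "T \<in> Col lam \<mu>" "i \<in> {1..length \<mu>}"
  shows "card (cols_with T i) = \<mu> ! (i - 1)"
proof -
  have srt: "sorted_wrt (<) cc" if "cc \<in> set T" for cc using assms(1) that by (simp add: Col_def)
  have cnt: "count_list cc i = (if i \<in> set cc then 1 else 0)" if "cc \<in> set T" for cc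
  proof -
    have "distinct cc" using srt[OF that] by (simp add: strict_sorted_iff)
    then show ?thesis by (induction cc) auto
  qed
  have "\<mu> ! (i - 1) = count_list (concat T) i" using assms by (simp add: Col_def)
  also have "\<dots> = (\<Sum>cc\<leftarrow>T. if i \<in> set cc then 1 else 0)"
    unfolding count_list_concat by (intro arg_cong[of _ _ sum_list] map_cong refl cnt)
  also have "\<dots> = (\<Sum>c = 0..<length T. if i \<in> set (T ! c) then 1 else 0)"
    by (subst sum_list_sum_nth) (auto intro!: sum.cong)
  also have "\<dots> = card (cols_with T i)"
    by (simp add: sum.If_cases cols_with_def Int_def conj_commute)
  finally show ?thesis by simp
qed

lemma card_block: "j \<in> {1..length \<mu>} \<Longrightarrow> card (block \<mu> j) = \<mu> ! (j - 1)"
proof -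
  assume j: "j \<in> {1..length \<mu>}"
  have "block \<mu> j = {sum_list (take (j - 1) \<mu>) + 1..sum_list (take j \<mu>)}"
    by (auto simp: block_def)
  moreover have "sum_list (take j \<mu>) = sum_list (take (j - 1) \<mu>) + \<mu> ! (j - 1)"
    using j take_Suc_conv_app_nth[of "j - 1" \<mu>] by (cases j) auto
  ultimately show ?thesis by simp
qed

text \<open>Block i and the set of columns containing i both have \<open>\<mu> ! (i - 1)\<close>
  elements, and bijections on disjoint blocks glue. The order within a block is arbitrary, as
  invariants do not see it.\<close>

lemma ex_tab_point:
  assumes T: "T \<in> Col lam \<mu>"
  shows "\<exists>z :: nat \<Rightarrow> complex. \<forall>i\<in>{1..length \<mu>}. bij_betw z (block \<mu> i) (of_nat ` cols_with T i)"
proof -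
  have "\<exists>f :: nat \<Rightarrow> complex. bij_betw f (block \<mu> i) (of_nat ` cols_with T i)" if "i \<in> {1..length \<mu>}" for i
  proof -
    have "card (of_nat ` cols_with T i :: complex set) = card (cols_with T i)"
      by (intro card_image) (simp add: inj_on_def)
    then show ?thesis
      using that card_block[OF that] card_cols_with[OF T that]
      by (intro finite_same_card_bij finite_block finite_imageI finite_cols_with) simp
  qed
  then obtain f :: "nat \<Rightarrow> nat \<Rightarrow> complex"
    where f: "\<And>i. i \<in> {1..length \<mu>} \<Longrightarrow> bij_betw (f i) (block \<mu> i) (of_nat ` cols_with T i)"
    by metis
  define z where "z b = f (SOME i. 1 \<le> i \<and> b \<in> block \<mu> i) b" for b
  have "z b = f i b" if "i \<in> {1..length \<mu>}" "b \<in> block \<mu> i" for i b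
  proof -
    have "1 \<le> (SOME i. 1 \<le> i \<and> b \<in> block \<mu> i) \<and> b \<in> block \<mu> (SOME i. 1 \<le> i \<and> b \<in> block \<mu> i)"
      by (rule someI[of "\<lambda>i. 1 \<le> i \<and> b \<in> block \<mu> i" i]) (use that in auto)
    then have "(SOME i. 1 \<le> i \<and> b \<in> block \<mu> i) = i"
      using block_disjoint[of _ i \<mu>] that by fastforce
    then show ?thesis by (simp add: z_def)
  qed
  then have "bij_betw z (block \<mu> i) (of_nat ` cols_with T i)" if "i \<in> {1..length \<mu>}" for i
    using f[OF that] that by (subst bij_betw_cong[of _ _ "f i"]) auto
  then show ?thesis by blast
qed

definition tab_point :: "nat list \<Rightarrow> tableau \<Rightarrow> nat \<Rightarrow> complex" where
  "tab_point \<mu> T = (SOME z. \<forall>i\<in>{1..length \<mu>}. bij_betw z (block \<mu> i) (of_nat ` cols_with T i))"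

lemma tab_point:
  "T \<in> Col lam \<mu> \<Longrightarrow> i \<in> {1..length \<mu>} \<Longrightarrow>
    bij_betw (tab_point \<mu> T) (block \<mu> i) (of_nat ` cols_with T i)"
  using someI_ex[OF ex_tab_point] unfolding tab_point_def by blast

section \<open>Separation of tableaux and interpolation at their points\<close>

lemma Col_eqI:
  assumes T: "T \<in> Col lam \<mu>" and S: "S \<in> Col lam \<mu>"
    and eq: "\<And>i. i \<in> {1..length \<mu>} \<Longrightarrow> cols_with T i = cols_with S i"
  shows "T = S"
proof -
  have len: "c < length T \<longleftrightarrow> c < length S" for c
  proof -
    have ne: "c < length U \<longleftrightarrow> 0 < length lam \<and> c < lam ! 0" if U: "U \<in> Col lam \<mu>" for U
    proof -
      have "0 < length (U ! c)" if "c < length U"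
      proof -
        have "U ! c \<in> set U" using that by simp
        then have "U ! c \<noteq> []" using U by (metis (no_types, lifting) Col_def mem_Collect_eq)
        then show ?thesis by simp
      qed
      then show ?thesis using Col_columns[OF U, of 0 c] by blast
    qed
    show ?thesis using ne[OF T] ne[OF S] by simp
  qed
  then have lens: "length T = length S" by (metis less_irrefl linorder_neqE_nat)
  show ?thesis
  proof (rule nth_equalityI[OF lens])
    fix c assume c: "c < length T"
    have sub: "set (U ! c) \<subseteq> {1..length \<mu>}" if "U \<in> Col lam \<mu>" "c < length U" for U
      using Col_entries[OF that(1) nth_mem[OF that(2)]] by blast
    have "x \<in> set (T ! c) \<longleftrightarrow> x \<in> set (S ! c)" for x
    proof (cases "x \<in> {1..length \<mu>}")
      case True
      from eq[OF this] show ?thesis using c lens by (auto simp: cols_with_def)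
    next
      case False
      then show ?thesis using sub[OF T c] sub[OF S] c lens by auto
    qed
    then have "set (T ! c) = set (S ! c)" by blast
    moreover have "sorted_wrt (<) (T ! c)" "sorted_wrt (<) (S ! c)"
      using T S c lens by (simp_all add: Col_def)
    ultimately show "T ! c = S ! c"
      by (intro strict_sorted_equal)
  qed
qed

lemma finite_Col: "finite (Col lam \<mu>)"
proof -
  let ?N = "if lam = [] then 0 else lam ! 0"
  let ?C = "{cc. set cc \<subseteq> {1..length \<mu>} \<and> length cc \<le> length lam}"
  have "Col lam \<mu> \<subseteq> {T. set T \<subseteq> ?C \<and> length T \<le> ?N}"
  proof
    fix T assume T: "T \<in> Col lam \<mu>"
    have "cc \<in> ?C" if cc: "cc \<in> set T" for cc
    proof -
      obtain c where c: "c < length T" "cc = T ! c" using cc by (metis in_set_conv_nth)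
      have "length cc \<le> length lam"
      proof (rule ccontr)
        assume "\<not> ?thesis"
        then show False using Col_columns[OF T, of "length lam" c] c by simp
      qed
      then show ?thesis using Col_entries[OF T cc] by blast
    qed
    moreover have "length T \<le> ?N"
    proof (cases "length T")
      case (Suc c)
      then have "T ! c \<in> set T" by simp
      then have "T ! c \<noteq> []" using T by (metis (no_types, lifting) Col_def mem_Collect_eq)
      then show ?thesis using Col_columns[OF T, of 0 c] Suc by auto
    qed simp
    ultimately show "T \<in> {T. set T \<subseteq> ?C \<and> length T \<le> ?N}" by blast
  qed
  moreover have "finite {T. set T \<subseteq> ?C \<and> length T \<le> ?N}"
    by (intro finite_lists_length_le) simp
  ultimately show ?thesis by (rule finite_subset)
qed

text \<open>The product of all x - c over the variables x of one block is symmetric in that block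
  and vanishes exactly at the points having c among their coordinates there.\<close>

lemma separating:
  assumes T0: "T0 \<in> Col lam \<mu>" and T: "T \<in> Col lam \<mu>" and neq: "T \<noteq> T0"
  shows "\<exists>f\<in>Inv \<mu>. ev (tab_point \<mu> T) f = 0 \<and> ev (tab_point \<mu> T0) f \<noteq> 0"
proof -
  obtain i where i: "i \<in> {1..length \<mu>}" "cols_with T i \<noteq> cols_with T0 i"
    using Col_eqI[OF T T0] neq by blast
  have "card (cols_with T i) = card (cols_with T0 i)"
    using card_cols_with[OF T i(1)] card_cols_with[OF T0 i(1)] by simp
  \<comment> \<open>Two different finite sets of equal size are not included in each other, so c can
    be taken from the tableau at which f has to vanish.\<close>
  then have "\<not> cols_with T i \<subseteq> cols_with T0 i"
    using i(2) card_subset_eq[OF finite_cols_with, of "cols_with T i" T0 i] by blast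
  then obtain c where c: "c \<in> cols_with T i" "c \<notin> cols_with T0 i" by blast
  define f where "f = (\<Prod>b\<in>block \<mu> i. var b + const (- of_nat c))"
  have ev: "ev z f = (\<Prod>b\<in>block \<mu> i. z b - of_nat c)" for z
    by (simp add: f_def ev_prod ev_add ev_var ev_const)
  have "f \<in> Inv \<mu>"
    unfolding Inv_iff
  proof (intro conjI ballI)
    have "(\<Prod>b\<in>B. var b + const (- of_nat c)) \<in> Pol (sum_list \<mu>)" if "B \<subseteq> {1..sum_list \<mu>}" for B
      using finite_subset[OF that] that
    proof (induction B rule: infinite_finite_induct)
      case (insert b B)
      have "var b \<in> Pol (sum_list \<mu>)" using insert.prems by (auto simp: Pol_def var_def)
      then show ?case using insert by (simp add: Pol_mult Pol_add const_in_Pol)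
    next
      case empty
      show ?case using const_in_Pol[of 1] by (simp add: const_one)
    qed simp
    then show "f \<in> Pol (sum_list \<mu>)" unfolding f_def using block_subset[OF i(1)] by blast
    fix \<sigma> assume \<sigma>: "\<sigma> \<in> young_subgroup \<mu>"
    have b: "bij \<sigma>" by (rule young_subgroup_bij[OF \<sigma>])
    have img: "\<sigma> ` block \<mu> i = block \<mu> i" using \<sigma> i(1) unfolding young_subgroup_def by blast
    have "permute_vars \<sigma> f = (\<Prod>b\<in>block \<mu> i. var (\<sigma> b) + const (- of_nat c))"
      unfolding f_def
      by (simp add: permute_vars_prod[OF b] permute_vars_add[OF b] permute_vars_var[OF b] permute_vars_const[OF b])
    also have "\<dots> = f"
      unfolding f_def
    proof (rule prod.reindex_bij_betw)
      show "bij_betw \<sigma> (block \<mu> i) (block \<mu> i)"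
        using img b by (auto simp: bij_betw_def intro: inj_on_subset[OF bij_is_inj])
    qed
    finally show "permute_vars \<sigma> f = f" .
  qed
  moreover have "ev (tab_point \<mu> T) f = 0"
  proof -
    have img: "tab_point \<mu> T ` block \<mu> i = of_nat ` cols_with T i"
      by (rule bij_betw_imp_surj_on[OF tab_point[OF T i(1)]])
    have "of_nat c \<in> tab_point \<mu> T ` block \<mu> i"
      unfolding img using c(1) by (rule imageI)
    then obtain b where b: "b \<in> block \<mu> i" "tab_point \<mu> T b = of_nat c" by (metis imageE)
    show ?thesis unfolding ev
      by (intro prod_zero finite_block bexI[of _ b]) (simp_all add: b)
  qed
  moreover have "ev (tab_point \<mu> T0) f \<noteq> 0"
  proof -
    have "tab_point \<mu> T0 b \<noteq> of_nat c" if "b \<in> block \<mu> i" for b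
    proof
      assume "tab_point \<mu> T0 b = of_nat c"
      then have "of_nat c \<in> (of_nat ` cols_with T0 i :: complex set)"
        using tab_point[OF T0 i(1)] that by (metis bij_betwE)
      then show False using c(2) by auto
    qed
    then show ?thesis unfolding ev by (simp add: finite_block)
  qed
  ultimately show ?thesis by blast
qed

text \<open>Lagrange interpolation, with the separating invariants in place of linear
  factors.\<close>

lemma interpolation:
  assumes T0: "T0 \<in> Col lam \<mu>"
  shows "\<exists>f\<in>Inv \<mu>. \<forall>T\<in>Col lam \<mu>. ev (tab_point \<mu> T) f = (if T = T0 then 1 else 0)"
proof -
  obtain f where f: "\<And>T. T \<in> Col lam \<mu> - {T0} \<Longrightarrow>
      f T \<in> Inv \<mu> \<and> ev (tab_point \<mu> T) (f T) = 0 \<and> ev (tab_point \<mu> T0) (f T) \<noteq> 0"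
    using separating[OF T0] by (metis DiffE singletonI)
  define F where "F = (\<Prod>T\<in>Col lam \<mu> - {T0}. f T)"
  have fin: "finite (Col lam \<mu> - {T0})" using finite_Col by blast
  have F: "F \<in> Inv \<mu>" unfolding F_def using f by (intro Inv_prod) blast
  have z: "ev (tab_point \<mu> T) F = 0" if "T \<in> Col lam \<mu>" "T \<noteq> T0" for T
    unfolding F_def ev_prod using that f[of T] by (intro prod_zero fin) auto
  have nz: "ev (tab_point \<mu> T0) F \<noteq> 0"
    unfolding F_def ev_prod using f fin by simp
  have "const (1 / ev (tab_point \<mu> T0) F) * F \<in> Inv \<mu>" by (intro Inv_mult F const_closed)
  moreover have "\<forall>T\<in>Col lam \<mu>. ev (tab_point \<mu> T) (const (1 / ev (tab_point \<mu> T0) F) * F)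
      = (if T = T0 then 1 else 0)"
    using z nz by (simp add: ev_mult ev_const)
  ultimately show ?thesis by blast
qed

section \<open>Independence\<close>

definition ev_fps :: "(nat \<Rightarrow> complex) \<Rightarrow> cpoly fps \<Rightarrow> complex fps" where
  "ev_fps z F = Abs_fps (\<lambda>r. ev z (fps_nth F r))"

lemma ev_fps_mult: "ev_fps z (F * G) = ev_fps z F * ev_fps z G"
  by (rule fps_ext) (simp add: ev_fps_def fps_mult_nth ev_sum ev_mult)

lemma ev_fps_one: "ev_fps z 1 = 1"
  by (rule fps_ext) (simp add: ev_fps_def ev_one ev_zero)

lemma ev_fps_prod: "ev_fps z (prod F A) = (\<Prod>a\<in>A. ev_fps z (F a))"
  by (induction A rule: infinite_finite_induct) (simp_all add: ev_fps_one ev_fps_mult)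

lemma ev_fps_linear: "ev_fps z (1 - fps_const p * fps_X) = 1 - fps_const (ev z p) * fps_X"
  by (rule fps_ext) (auto simp: ev_fps_def ev_one ev_zero ev_diff ev_uminus fps_X_def)

lemma ev_fps_Hgf:
  assumes "finite A"
  shows "ev_fps z (Hgf A) * (\<Prod>a\<in>A. 1 - fps_const (z a) * fps_X) = 1"
proof -
  have "ev_fps z (Hgf A * (\<Prod>a\<in>A. 1 - fps_const (var a) * fps_X)) = 1"
    by (simp add: Hgf_prod[OF assms] ev_fps_one)
  then show ?thesis
    by (simp add: ev_fps_mult ev_fps_prod ev_fps_linear ev_var)
qed

lemma Col_first_row:
  assumes U: "U \<in> Col lam \<mu>" and c: "c < length U"
  shows "0 < length lam \<and> c < lam ! 0"
proof -
  have "U ! c \<in> set U" using c by simp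
  then have "U ! c \<noteq> []" using U by (metis (no_types, lifting) Col_def mem_Collect_eq)
  then show ?thesis using Col_columns[OF U, of 0 c] c by blast
qed

text \<open>The boxes of the first m rows, counted by columns. The total size serves as a bound for
  the number of columns that makes sense for the empty shape as well.\<close>

lemma sum_card_columns:
  assumes "m \<le> length lam"
  shows "(\<Sum>c<sum_list lam. card {a. a < m \<and> c < lam ! a}) = sum_list (take m lam)"
proof -
  have "(\<Sum>c<sum_list lam. card {a. a < m \<and> c < lam ! a})
      = (\<Sum>c<sum_list lam. \<Sum>a<m. if c < lam ! a then 1 else 0)"
    by (intro sum.cong refl) (simp add: sum.If_cases Int_def lessThan_def)
  also have "\<dots> = (\<Sum>a<m. \<Sum>c<sum_list lam. if c < lam ! a then 1 else 0)"
    by (rule sum.swap)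
  also have "\<dots> = (\<Sum>a<m. lam ! a)"
  proof (intro sum.cong refl)
    fix a assume "a \<in> {..<m}"
    then have "lam ! a \<in> set lam" using assms by simp
    then have "lam ! a \<le> sum_list lam" by (rule member_le_sum_list) simp
    then have "{..<sum_list lam} \<inter> {c. c < lam ! a} = {..<lam ! a}" by auto
    then show "(\<Sum>c<sum_list lam. if c < lam ! a then 1 else 0) = lam ! a"
      by (simp add: sum.If_cases)
  qed
  also have "\<dots> = sum_list (take m lam)"
    using assms by (subst sum_list_sum_nth) (auto simp: atLeast0LessThan min_absorb2 intro!: sum.cong)
  finally show ?thesis .
qed

text \<open>Multiplying the generating function of the \<open>hsym \<mu> I\<close> by this polynomial cancels all its poles
  at each of the points attached to the tableaux of shape \<open>lam\<close>.\<close>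

definition clearing :: "nat list \<Rightarrow> nat \<Rightarrow> complex fps" where
  "clearing lam m = (\<Prod>c<sum_list lam. (1 - fps_const (of_nat c) * fps_X) ^ card {a. a < m \<and> c < lam ! a})"

text \<open>At the point of T, column c contributes a pole of order the number of elements of I it
  contains. This is at most m and at most the column length, hence at most the exponent in
  \<open>clearing\<close>. What remains is a polynomial whose degree is bounded by the number of
  boxes in the first m rows minus the sum of the \<open>\<mu>\<^sub>i\<close>, i in I.\<close>

lemma clearing_vanish:
  assumes T: "T \<in> Col lam \<mu>" and I: "I \<subseteq> {1..length \<mu>}" and len: "length lam = length \<mu>"
    and r: "int r > int (sum_list (take (card I) lam)) - (\<Sum>i\<in>I. int (\<mu> ! (i - 1)))"
  shows "fps_nth (clearing lam (card I) * ev_fps (tab_point \<mu> T) (Hgf (\<Union>i\<in>I. block \<mu> i))) r = 0"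
proof -
  define z where "z = tab_point \<mu> T"
  define N m where "N = sum_list lam" and "m = card I"
  define F :: "complex \<Rightarrow> complex fps" where "F x = 1 - fps_const x * fps_X" for x
  define w where "w c = card {a. a < m \<and> c < lam ! a}" for c
  define e where "e c = card {i\<in>I. c \<in> cols_with T i}" for c
  have finI: "finite I" using I finite_subset by blast
  have mlen: "m \<le> length lam" unfolding m_def len using card_mono[OF _ I] by simp
  have colsN: "cols_with T i \<subseteq> {..<N}" for i
  proof
    fix c assume "c \<in> cols_with T i"
    then have "0 < length lam \<and> c < lam ! 0" using Col_first_row[OF T, of c] by (simp add: cols_with_def)
    moreover from this have "lam ! 0 \<le> N" unfolding N_def by (intro member_le_sum_list) simp_all
    ultimately show "c \<in> {..<N}" by simp
  qed
  have "(\<Prod>b\<in>(\<Union>i\<in>I. block \<mu> i). F (z b)) = (\<Prod>i\<in>I. \<Prod>b\<in>block \<mu> i. F (z b))"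
  proof (rule prod.UNION_disjoint)
    show "\<forall>i\<in>I. \<forall>j\<in>I. i \<noteq> j \<longrightarrow> block \<mu> i \<inter> block \<mu> j = {}"
    proof (intro ballI impI block_disjoint)
      fix i j assume "i \<in> I" "j \<in> I"
      then show "1 \<le> i" "1 \<le> j" using I by auto
    qed
  qed (simp_all add: finI finite_block)
  also have "\<dots> = (\<Prod>i\<in>I. \<Prod>c<N. if c \<in> cols_with T i then F (of_nat c) else 1)"
  proof (rule prod.cong[OF refl])
    fix i assume "i \<in> I"
    then have i: "i \<in> {1..length \<mu>}" using I by blast
    have "(\<Prod>b\<in>block \<mu> i. F (z b)) = (\<Prod>x\<in>of_nat ` cols_with T i. F x)"
      unfolding z_def by (rule prod.reindex_bij_betw[OF tab_point[OF T i]])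
    also have "\<dots> = (\<Prod>c\<in>cols_with T i. F (of_nat c))"
      by (subst prod.reindex) (auto simp: inj_on_def)
    also have "\<dots> = (\<Prod>c<N. if c \<in> cols_with T i then F (of_nat c) else 1)"
      using colsN[of i] by (simp add: prod.inter_restrict[symmetric] Int_absorb1)
    finally show "(\<Prod>b\<in>block \<mu> i. F (z b)) = (\<Prod>c<N. if c \<in> cols_with T i then F (of_nat c) else 1)" .
  qed
  also have "\<dots> = (\<Prod>c<N. \<Prod>i\<in>I. if c \<in> cols_with T i then F (of_nat c) else 1)"
    by (rule prod.swap)
  also have "\<dots> = (\<Prod>c<N. F (of_nat c) ^ e c)"
    by (intro prod.cong refl) (simp add: prod.If_cases finI e_def Int_def)
  finally have prodB: "(\<Prod>b\<in>(\<Union>i\<in>I. block \<mu> i). F (z b)) = (\<Prod>c<N. F (of_nat c) ^ e c)" .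
  have ew: "e c \<le> w c" for c
  proof (cases "c < length T")
    case True
    have "e c \<le> m" unfolding e_def m_def by (rule card_mono[OF finI]) auto
    moreover have "e c \<le> length (T ! c)"
    proof -
      have "e c \<le> card (set (T ! c))"
        unfolding e_def by (rule card_mono) (auto simp: cols_with_def)
      then show ?thesis using card_length[of "T ! c"] by linarith
    qed
    moreover have "{a. a < m \<and> c < lam ! a} = {..<min m (length (T ! c))}"
      using Col_columns[OF T, of _ c] True mlen by force
    ultimately show ?thesis by (simp add: w_def)
  next
    case False
    then show ?thesis by (simp add: e_def cols_with_def)
  qed
  have "clearing lam (card I) = (\<Prod>c<N. F (of_nat c) ^ w c)"
    by (simp add: clearing_def N_def w_def F_def m_def)
  also have "\<dots> = (\<Prod>c<N. F (of_nat c) ^ (w c - e c) * F (of_nat c) ^ e c)"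
    using ew by (intro prod.cong refl) (simp add: power_add[symmetric])
  also have "\<dots> = (\<Prod>c<N. F (of_nat c) ^ (w c - e c)) * (\<Prod>b\<in>(\<Union>i\<in>I. block \<mu> i). F (z b))"
    by (simp add: prod.distrib prodB)
  finally have "clearing lam (card I) * ev_fps z (Hgf (\<Union>i\<in>I. block \<mu> i))
      = (\<Prod>c<N. F (of_nat c) ^ (w c - e c)) * (ev_fps z (Hgf (\<Union>i\<in>I. block \<mu> i))
        * (\<Prod>b\<in>(\<Union>i\<in>I. block \<mu> i). F (z b)))"
    by (simp only: mult_ac)
  also have "\<dots> = (\<Prod>c<N. F (of_nat c) ^ (w c - e c))"
    unfolding F_def using ev_fps_Hgf[of "\<Union>i\<in>I. block \<mu> i" z] finI by (simp add: finite_block)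
  \<comment> \<open>The powers become a product over pairs, so that the degree is bounded by the
    number of pairs.\<close>
  also have "\<dots> = (\<Prod>c<N. \<Prod>t<w c - e c. F (of_nat c))" by simp
  also have "\<dots> = (\<Prod>(c, t)\<in>(SIGMA c:{..<N}. {..<w c - e c}). F (of_nat c))"
    by (rule prod.Sigma) auto
  also have "\<dots> = (\<Prod>x\<in>(SIGMA c:{..<N}. {..<w c - e c}). 1 - fps_const (of_nat (fst x)) * fps_X)"
    by (intro prod.cong refl) (auto simp: F_def)
  finally have eq: "clearing lam (card I) * ev_fps z (Hgf (\<Union>i\<in>I. block \<mu> i))
      = (\<Prod>x\<in>(SIGMA c:{..<N}. {..<w c - e c}). 1 - fps_const (of_nat (fst x)) * fps_X)" .
  have "int (card (SIGMA c:{..<N}. {..<w c - e c})) = (\<Sum>c<N. int (w c) - int (e c))"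
    using ew by (simp add: of_nat_diff)
  also have "\<dots> = int (\<Sum>c<N. w c) - int (\<Sum>c<N. e c)" by (simp add: sum_subtractf)
  also have "(\<Sum>c<N. w c) = sum_list (take m lam)"
    unfolding w_def N_def by (rule sum_card_columns[OF mlen])
  also have "(\<Sum>c<N. e c) = (\<Sum>i\<in>I. \<mu> ! (i - 1))"
  proof -
    have "(\<Sum>c<N. e c) = (\<Sum>c<N. \<Sum>i\<in>I. if c \<in> cols_with T i then 1 else 0)"
      by (intro sum.cong refl) (simp add: sum.If_cases finI e_def Int_def)
    also have "\<dots> = (\<Sum>i\<in>I. \<Sum>c<N. if c \<in> cols_with T i then 1 else 0)" by (rule sum.swap)
    also have "\<dots> = (\<Sum>i\<in>I. \<mu> ! (i - 1))"
    proof (rule sum.cong[OF refl])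
      fix i assume "i \<in> I"
      then have i: "i \<in> {1..length \<mu>}" using I by blast
      have "{..<N} \<inter> {c. c \<in> cols_with T i} = cols_with T i" using colsN[of i] by auto
      then show "(\<Sum>c<N. if c \<in> cols_with T i then 1 else 0) = \<mu> ! (i - 1)"
        using card_cols_with[OF T i] by (simp add: sum.If_cases)
    qed
    finally show ?thesis .
  qed
  finally have card: "int (card (SIGMA c:{..<N}. {..<w c - e c}))
      = int (sum_list (take m lam)) - int (\<Sum>i\<in>I. \<mu> ! (i - 1))" .
  have "int (card (SIGMA c:{..<N}. {..<w c - e c})) < int r"
    unfolding card using r by (simp add: m_def)
  then have "card (SIGMA c:{..<N}. {..<w c - e c}) < r" by (simp only: of_nat_less_iff)
  then show ?thesis
    unfolding z_def[symmetric] eq by (intro fps_nth_prod_linear) auto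
qed

text \<open>\<open>clearing\<close> depends on \<lambda> and the size of I but not on the tableau,
  so one coefficient of its product with the generating function vanishes at all points. Its
  constant term 1 makes the generator the leading form.\<close>

lemma gen_deform:
  assumes g: "g \<in> ideal_gens lam \<mu>" and len: "length lam = length \<mu>"
  shows "\<exists>r. \<exists>g'\<in>Inv \<mu>. homog r g \<and> deg_less r (g' - g) \<and> (\<forall>T\<in>Col lam \<mu>. ev (tab_point \<mu> T) g' = 0)"
proof -
  obtain I ri where gI: "g = hsym \<mu> I ri" and I: "I \<subseteq> {1..length \<mu>}"
    and ri: "ri > int (sum_list (take (card I) lam)) - (\<Sum>i\<in>I. int (\<mu> ! (i - 1)))"
    using g by (auto simp: ideal_gens_def)
  have finI: "finite I" using I finite_subset by blast
  show ?thesis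
  \<comment> \<open>The bound in \<open>ideal_gens\<close> may be negative; generators of negative
    degree are zero and deform trivially.\<close>
  proof (cases "ri < 0")
    case True
    then have "g = 0" by (simp add: gI hsym_neg)
    then show ?thesis
      by (intro exI[of _ 0] bexI[of _ 0]) (auto simp: homog_def deg_less_zero ev_zero Inv_zero)
  next
    case False
    define r where "r = nat ri"
    have ri_r: "ri = int r" using False by (simp add: r_def)
    let ?Q = "clearing lam (card I)"
    define g' where "g' = (\<Sum>j = 0..r. const (fps_nth ?Q j) * hsym \<mu> I (int (r - j)))"
    have Q0: "fps_nth ?Q 0 = 1"
    proof -
      have "fps_nth (\<Prod>c\<in>C. f c ^ e c) 0 = 1" if "\<And>c. fps_nth (f c) 0 = (1::complex)" for C f and e :: "nat \<Rightarrow> nat"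
        by (induction C rule: infinite_finite_induct) (simp_all add: that fps_power_zeroth)
      then show ?thesis unfolding clearing_def by simp
    qed
    have "g' \<in> Inv \<mu>" unfolding g'_def by (intro Inv_sum Inv_mult const_closed hsym_closed I)
    moreover have "homog r g" unfolding gI ri_r using homog_hsym[OF finI, of "int r" \<mu>] by simp
    moreover have "deg_less r (g' - g)"
    proof -
      have "g' = g + (\<Sum>j = Suc 0..r. const (fps_nth ?Q j) * hsym \<mu> I (int (r - j)))"
        unfolding g'_def by (subst sum.atLeast_Suc_atMost) (simp_all add: Q0 const_one gI ri_r)
      moreover have "deg_less r (\<Sum>j = Suc 0..r. const (fps_nth ?Q j) * hsym \<mu> I (int (r - j)))"
      proof (intro deg_less_sum deg_less_scale)
        fix j assume "j \<in> {Suc 0..r}"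
        then have "r - j < r" by auto
        moreover have "homog (r - j) (hsym \<mu> I (int (r - j)))"
          using homog_hsym[OF finI, of "int (r - j)" \<mu>] by (simp only: nat_int)
        ultimately show "deg_less r (hsym \<mu> I (int (r - j)))"
          using homog_deg_less by blast
      qed
      ultimately show ?thesis by simp
    qed
    moreover have "ev (tab_point \<mu> T) g' = 0" if T: "T \<in> Col lam \<mu>" for T
    proof -
      have "ev (tab_point \<mu> T) g'
          = fps_nth (?Q * ev_fps (tab_point \<mu> T) (Hgf (\<Union>i\<in>I. block \<mu> i))) r"
        by (simp add: g'_def ev_sum ev_mult ev_const fps_mult_nth ev_fps_def Hgf_nth hsym_def)
      also have "\<dots> = 0" by (rule clearing_vanish[OF T I len]) (use ri ri_r in simp)
      finally show ?thesis .
    qed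
    ultimately show ?thesis by blast
  qed
qed

text \<open>The ideal consists of leading forms of invariants vanishing at the points.\<close>

lemma ideal_deform:
  assumes j: "j \<in> ideal_I lam \<mu>" and len: "length lam = length \<mu>"
  shows "\<exists>j'\<in>Inv \<mu>. deg_less s (j' - hcomp s j) \<and> (\<forall>T\<in>Col lam \<mu>. ev (tab_point \<mu> T) j' = 0)"
  using j[unfolded ideal_I_eq_span]
proof (induction j rule: cp.span_induct_alt)
  case base
  show ?case
    by (intro bexI[of _ 0]) (simp_all add: hcomp_zero deg_less_zero ev_zero Inv_zero)
next
  case (step c x y)
  obtain y' where y': "y' \<in> Inv \<mu>" "deg_less s (y' - hcomp s y)"
    "\<And>T. T \<in> Col lam \<mu> \<Longrightarrow> ev (tab_point \<mu> T) y' = 0"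
    using step.IH by blast
  obtain p g where x: "x = p * g" and p: "p \<in> Inv \<mu>" and g: "g \<in> ideal_gens lam \<mu>"
    using step.hyps by blast
  obtain r g' where g': "g' \<in> Inv \<mu>" "homog r g" "deg_less r (g' - g)"
    "\<And>T. T \<in> Col lam \<mu> \<Longrightarrow> ev (tab_point \<mu> T) g' = 0"
    using gen_deform[OF g len] by blast
  \<comment> \<open>As g is homogeneous of degree r, only the component of degree s - r of p
    contributes to degree s.\<close>
  define x' where "x' = (if r \<le> s then hcomp (s - r) p * g' else 0)"
  have x'_Inv: "x' \<in> Inv \<mu>" by (simp add: x'_def Inv_zero Inv_mult hcomp_Inv p g')
  have x'_ev: "ev (tab_point \<mu> T) x' = 0" if "T \<in> Col lam \<mu>" for T
    using g'(4)[OF that] by (simp add: x'_def ev_mult ev_zero)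
  have x'_deg: "deg_less s (x' - hcomp s x)"
  proof (cases "r \<le> s")
    case True
    have "hcomp s x = hcomp (s - r) p * g"
      by (simp only: x hcomp_mult_homog[OF g'(2)] True if_True)
    then have "x' - hcomp s x = hcomp (s - r) p * (g' - g)"
      by (simp add: x'_def True right_diff_distrib)
    then show ?thesis
      using homog_mult_deg_less[OF homog_hcomp g'(3), of "s - r" p] True by simp
  next
    case False
    then show ?thesis by (simp add: x x'_def hcomp_mult_homog[OF g'(2)] deg_less_zero)
  qed
  have "(const c * x' + y') - hcomp s (const c * x + y)
      = const c * (x' - hcomp s x) + (y' - hcomp s y)"
    unfolding hcomp_add hcomp_scale by (simp add: algebra_simps)
  then have "deg_less s ((const c * x' + y') - hcomp s (const c * x + y))"
    by (simp only: deg_less_add deg_less_scale x'_deg y'(2))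
  moreover have "const c * x' + y' \<in> Inv \<mu>" by (intro Inv_add Inv_mult const_closed x'_Inv y')
  moreover have "ev (tab_point \<mu> T) (const c * x' + y') = 0" if "T \<in> Col lam \<mu>" for T
    using x'_ev[OF that] y'(3)[OF that] by (simp add: ev_add ev_mult)
  ultimately show ?case by blast
qed

section \<open>Comparison of the spanning family with the interpolation basis\<close>

locale tab_independence =
  fixes n d :: nat and lam \<mu> :: "nat list"
  assumes lam: "lam \<in> Part n d" and \<mu>: "\<mu> \<in> Comp n d"
begin

abbreviation "X \<equiv> Col lam \<mu>"

lemma len: "length lam = length \<mu>"
  using lam \<mu> by (simp add: Part_def Comp_def)

definition dp :: "tableau \<Rightarrow> cpoly" where
  "dp S = (SOME f. f \<in> Inv \<mu> \<and> (\<forall>T\<in>X. ev (tab_point \<mu> T) f = (if T = S then 1 else 0)))"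

lemma dp:
  assumes "S \<in> X"
  shows "dp S \<in> Inv \<mu>" "T \<in> X \<Longrightarrow> ev (tab_point \<mu> T) (dp S) = (if T = S then 1 else 0)"
  using someI_ex[of "\<lambda>f. f \<in> Inv \<mu> \<and> (\<forall>T\<in>X. ev (tab_point \<mu> T) f = (if T = S then 1 else 0))"]
    interpolation[OF assms] unfolding dp_def by blast+

text \<open>Interpolation at the points stands in for restriction to them.\<close>

definition L :: "cpoly \<Rightarrow> cpoly" where
  "L p = (\<Sum>T\<in>X. const (ev (tab_point \<mu> T) p) * dp T)"

lemma L_add: "L (p + q) = L p + L q"
  by (simp add: L_def ev_add const_add distrib_right sum.distrib)

lemma L_scale: "L (const c * p) = const c * L p"
  unfolding L_def sum_distrib_left
  by (intro sum.cong refl) (simp only: ev_mult ev_const const_mult mult.assoc)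

lemma L_vanish: "(\<And>T. T \<in> X \<Longrightarrow> ev (tab_point \<mu> T) p = 0) \<Longrightarrow> L p = 0"
  by (simp add: L_def const_zero)

lemma L_zero: "L 0 = 0"
  by (rule L_vanish) (simp add: ev_zero)

lemma L_dp:
  assumes "S \<in> X"
  shows "L (dp S) = dp S"
proof -
  have "L (dp S) = (\<Sum>T\<in>X. if T = S then dp T else 0)"
    unfolding L_def using dp(2)[OF assms] by (intro sum.cong) (auto simp: const_one const_zero)
  then show ?thesis using assms finite_Col by simp
qed

lemma L_span: "x \<in> cp.span S \<Longrightarrow> L x \<in> cp.span (L ` S)"
proof (induction x rule: cp.span_induct_alt)
  case base
  show ?case by (simp add: L_zero cp.span_zero)
next
  case (step c x y)
  have "L x \<in> cp.span (L ` S)" by (intro cp.span_base imageI step.hyps)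
  then have "const c * L x + L y \<in> cp.span (L ` S)"
    by (intro cp.span_add cp.span_scale step.IH)
  then show ?case by (simp add: L_add L_scale)
qed

text \<open>Evaluation at the point of S annihilates the span of the other interpolating invariants,
  but not \<open>dp S\<close>.\<close>

lemma dp_indep: "cp.independent (dp ` X)" and dp_inj: "inj_on dp X"
proof -
  show "inj_on dp X"
  proof (rule inj_onI)
    fix S T assume "S \<in> X" "T \<in> X" "dp S = dp T"
    then show "S = T" using dp(2)[of S S] dp(2)[of T S] by (auto split: if_splits)
  qed
  show "cp.independent (dp ` X)"
    unfolding cp.dependent_def
  proof
    assume "\<exists>a\<in>dp ` X. a \<in> cp.span (dp ` X - {a})"
    then obtain S where S: "S \<in> X" "dp S \<in> cp.span (dp ` X - {dp S})" by blast
    have "ev (tab_point \<mu> S) x = 0" if "x \<in> cp.span (dp ` X - {dp S})" for x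
      using that
    proof (induction x rule: cp.span_induct_alt)
      case (step c x y)
      then obtain T where "T \<in> X" "x = dp T" "T \<noteq> S" by blast
      then have "ev (tab_point \<mu> S) x = 0" using dp(2)[of T S] S(1) by simp
      then show ?case using step.IH by (simp add: ev_add ev_mult)
    qed (rule ev_zero)
    from this[OF S(2)] show False using dp(2)[OF S(1) S(1)] by simp
  qed
qed

text \<open>A choice of degree. It is arbitrary only if the polynomial is zero, which is homogeneous
  of every degree.\<close>

definition dg :: "tableau \<Rightarrow> nat" where
  "dg T = (SOME s. homog s (tab_h \<mu> T))"

lemma dg: "homog (dg T) (tab_h \<mu> T)"
  unfolding dg_def by (rule someI_ex[OF tab_h_homog])

definition E :: "tableau \<Rightarrow> cpoly" where
  "E T = L (tab_h \<mu> T)"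

lemma hcomp_span:
  "x \<in> cp.span (tab_h \<mu> ` X) \<Longrightarrow> hcomp s x \<in> cp.span (tab_h \<mu> ` {T\<in>X. dg T = s})"
proof (induction x rule: cp.span_induct_alt)
  case base
  show ?case by (simp add: hcomp_zero cp.span_zero)
next
  case (step c x y)
  then obtain T where T: "T \<in> X" "x = tab_h \<mu> T" by blast
  have "hcomp s x \<in> cp.span (tab_h \<mu> ` {T\<in>X. dg T = s})"
    using T by (auto simp: hcomp_homog[OF dg] cp.span_zero intro!: cp.span_base)
  then show ?case
    unfolding hcomp_add hcomp_scale by (intro cp.span_add cp.span_scale step.IH)
qed

text \<open>Spanning writes f as x + j with j in the ideal. In top degree s the component of j is
  the leading form of an invariant that vanishes at the points, so on the points f agrees with the
  component of x up to an invariant of degree below s. Keeping the degree bound on the tableaux is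
  what \<open>tab_h_independent\<close> relies on.\<close>

lemma filtered:
  assumes "deg_less s f" "f \<in> Inv \<mu>"
  shows "L f \<in> cp.span (E ` {T\<in>X. dg T < s})"
  using assms
proof (induction s arbitrary: f)
  case 0
  then have "Poly_Mapping.keys f = {}" by (auto simp: deg_less_def)
  then have "f = 0" by simp
  then show ?case by (simp add: L_zero cp.span_zero)
next
  case (Suc s)
  have "f \<in> cp.span (tab_h \<mu> ` X \<union> ideal_I lam \<mu>)"
    using Inv_spanned[OF lam \<mu>] Suc.prems(2) by blast
  then obtain x j where f: "f = x + j" and x: "x \<in> cp.span (tab_h \<mu> ` X)" and j: "j \<in> ideal_I lam \<mu>"
    unfolding cp.span_Un cp.span_eq_iff[THEN iffD2, OF ideal_I_subspace] by blast
  obtain j' where j': "j' \<in> Inv \<mu>" "deg_less s (j' - hcomp s j)"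
    "\<And>T. T \<in> X \<Longrightarrow> ev (tab_point \<mu> T) j' = 0"
    using ideal_deform[OF j len, of s] by blast
  \<comment> \<open>Since f = x + j, the components of degree s cancel and induction applies to
    y.\<close>
  define y where "y = f - hcomp s x - j'"
  have xInv: "x \<in> Inv \<mu>"
    using f Suc.prems(2) ideal_I_Inv[OF j] Inv_diff[of f \<mu> j] by simp
  have "y \<in> Inv \<mu>" unfolding y_def by (intro Inv_diff Suc.prems hcomp_Inv xInv j')
  moreover have "deg_less s y"
  proof -
    have "y = (f - hcomp s f) - (j' - hcomp s j)"
      by (simp add: y_def f hcomp_add)
    then show ?thesis
      using deg_less_diff[OF deg_less_Suc[OF Suc.prems(1)] j'(2)] by simp
  qed
  ultimately have "L y \<in> cp.span (E ` {T\<in>X. dg T < s})" by (intro Suc.IH)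
  then have 1: "L y \<in> cp.span (E ` {T\<in>X. dg T < Suc s})"
    by (rule subsetD[OF cp.span_mono, rotated]) auto
  have "L (hcomp s x) \<in> cp.span (L ` tab_h \<mu> ` {T\<in>X. dg T = s})"
    by (intro L_span hcomp_span x)
  then have 2: "L (hcomp s x) \<in> cp.span (E ` {T\<in>X. dg T < Suc s})"
    by (rule subsetD[OF cp.span_mono, rotated]) (auto simp: E_def)
  have "f = y + hcomp s x + j'" by (simp add: y_def)
  then have "L f = L y + L (hcomp s x) + L j'" by (simp only: L_add)
  also have "L j' = 0" by (rule L_vanish) (rule j'(3))
  finally show ?case using cp.span_add[OF 1 2] by simp
qed

text \<open>The \<open>E T\<close> span the independent \<open>dp T\<close>, which are as many, so none of them is redundant.\<close>

lemma E_not_in_span: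
  assumes S: "S \<in> X"
  shows "E S \<notin> cp.span (E ` (X - {S}))"
proof
  assume ES: "E S \<in> cp.span (E ` (X - {S}))"
  have "E ` X \<subseteq> cp.span (E ` (X - {S}))"
  proof (rule image_subsetI)
    fix T assume "T \<in> X"
    then show "E T \<in> cp.span (E ` (X - {S}))"
      using ES by (cases "T = S") (auto intro: cp.span_base)
  qed
  then have sub: "cp.span (E ` X) \<subseteq> cp.span (E ` (X - {S}))"
    by (rule cp.span_minimal) (rule cp.subspace_span)
  have "dp ` X \<subseteq> cp.span (E ` X)"
  proof (rule image_subsetI)
    fix T assume T: "T \<in> X"
    obtain s where "deg_less s (dp T)" using ex_deg_less by blast
    then have "L (dp T) \<in> cp.span (E ` {T\<in>X. dg T < s})" by (rule filtered) (rule dp(1)[OF T])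
    then have "L (dp T) \<in> cp.span (E ` X)" by (rule subsetD[OF cp.span_mono, rotated]) auto
    then show "dp T \<in> cp.span (E ` X)" by (simp only: L_dp[OF T])
  qed
  then have "dp ` X \<subseteq> cp.span (E ` (X - {S}))" using sub by (rule subset_trans)
  moreover have "finite (E ` (X - {S}))" using finite_Col by blast
  ultimately have "card (dp ` X) \<le> card (E ` (X - {S}))"
    using cp.independent_span_bound[OF _ dp_indep] by blast
  also have "\<dots> \<le> card (X - {S})" by (rule card_image_le) (use finite_Col in blast)
  also have "\<dots> < card X" using S finite_Col by (intro psubset_card_mono) auto
  finally show False by (simp add: card_image[OF dp_inj])
qed

text \<open>In the degree s of \<open>tab_h \<mu> S\<close>, the component of the relation agrees on
  the points with an invariant of lower degree, which by \<open>filtered\<close> involves only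
  tableaux of degree below s. Thus \<open>a S\<close> times \<open>E S\<close> is a combination of
  elements belonging to other tableaux.\<close>

lemma tab_h_independent:
  assumes x: "(\<Sum>T\<in>X. const (a T) * tab_h \<mu> T) \<in> ideal_I lam \<mu>" and S: "S \<in> X"
  shows "a S = 0"
proof (rule ccontr)
  assume aS: "a S \<noteq> 0"
  define x where "x = (\<Sum>T\<in>X. const (a T) * tab_h \<mu> T)"
  define s where "s = dg S"
  define Y where "Y = {T\<in>X. dg T = s}"
  have Y: "finite Y" "S \<in> Y" using finite_Col S by (simp_all add: Y_def s_def)
  have hx: "hcomp s x = (\<Sum>T\<in>Y. const (a T) * tab_h \<mu> T)"
  proof -
    have "hcomp s x = (\<Sum>T\<in>X. if dg T = s then const (a T) * tab_h \<mu> T else 0)"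
      unfolding x_def hcomp_sum by (intro sum.cong refl) (simp add: hcomp_scale hcomp_homog[OF dg])
    also have "\<dots> = (\<Sum>T\<in>Y. const (a T) * tab_h \<mu> T)"
      unfolding Y_def by (rule sum.inter_filter[symmetric]) (rule finite_Col)
    finally show ?thesis .
  qed
  have xInv: "x \<in> Inv \<mu>" using ideal_I_Inv x by (simp add: x_def)
  obtain j' where j': "j' \<in> Inv \<mu>" "deg_less s (j' - hcomp s x)"
    "\<And>T. T \<in> X \<Longrightarrow> ev (tab_point \<mu> T) j' = 0"
    using ideal_deform[OF x len, of s] unfolding x_def by blast
  let ?V = "cp.span (E ` (X - {S}))"
  have "L (j' - hcomp s x) \<in> cp.span (E ` {T\<in>X. dg T < s})"
    by (rule filtered[OF j'(2)]) (intro Inv_diff j' hcomp_Inv xInv)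
  then have 1: "L (j' - hcomp s x) \<in> ?V"
    by (rule subsetD[OF cp.span_mono, rotated]) (auto simp: s_def)
  have "L j' = L (j' - hcomp s x) + L (hcomp s x)"
    by (simp add: L_add[symmetric])
  moreover have "L j' = 0" by (rule L_vanish) (rule j'(3))
  ultimately have "L (hcomp s x) = - L (j' - hcomp s x)" by (simp add: eq_neg_iff_add_eq_0 add.commute)
  then have 2: "L (hcomp s x) \<in> ?V" using cp.span_neg[OF 1] by simp
  have L_sum: "L (\<Sum>T\<in>B. const (a T) * tab_h \<mu> T) = (\<Sum>T\<in>B. const (a T) * E T)" for B
    by (induction B rule: infinite_finite_induct) (simp_all add: L_zero L_add L_scale E_def)
  have "L (hcomp s x) = const (a S) * E S + (\<Sum>T\<in>Y - {S}. const (a T) * E T)"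
    unfolding hx L_sum by (rule sum.remove[OF Y])
  then have "const (a S) * E S = L (hcomp s x) - (\<Sum>T\<in>Y - {S}. const (a T) * E T)" by simp
  moreover have "(\<Sum>T\<in>Y - {S}. const (a T) * E T) \<in> ?V"
    by (intro cp.span_sum cp.span_scale cp.span_base imageI) (auto simp: Y_def)
  ultimately have "const (a S) * E S \<in> ?V" using cp.span_diff[OF 2] by simp
  then have "const (1 / a S) * (const (a S) * E S) \<in> ?V" by (rule cp.span_scale)
  then have "E S \<in> ?V"
    using aS by (simp add: mult.assoc[symmetric] const_mult[symmetric] const_one)
  then show False using E_not_in_span[OF S] by contradiction
qed

end

section \<open>The basis\<close>

lemma alg_C_sel:
  "carrier (alg_C lam \<mu>) = carrier (invariants \<mu> Quot ideal_I lam \<mu>)"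
  "add (alg_C lam \<mu>) = add (invariants \<mu> Quot ideal_I lam \<mu>)"
  "zero (alg_C lam \<mu>) = zero (invariants \<mu> Quot ideal_I lam \<mu>)"
  "smult (alg_C lam \<mu>) c A = to_C lam \<mu> (const c) \<otimes>\<^bsub>invariants \<mu> Quot ideal_I lam \<mu>\<^esub> A"
  by (simp_all add: alg_C_def Let_def)

lemma to_C_hom: "ring_hom_ring (invariants \<mu>) (invariants \<mu> Quot ideal_I lam \<mu>) (to_C lam \<mu>)"
proof -
  interpret I: ideal "ideal_I lam \<mu>" "invariants \<mu>" by (rule ideal_I_ideal)
  show ?thesis using I.rcos_ring_hom_ring by (simp add: to_C_def[abs_def])
qed

lemma to_C_carrier: "carrier (alg_C lam \<mu>) = to_C lam \<mu> ` Inv \<mu>"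
  unfolding alg_C_sel by (auto simp: FactRing_def A_RCOSETS_def' to_C_def)

lemma to_C_add:
  "f \<in> Inv \<mu> \<Longrightarrow> g \<in> Inv \<mu> \<Longrightarrow> to_C lam \<mu> f \<oplus>\<^bsub>alg_C lam \<mu>\<^esub> to_C lam \<mu> g = to_C lam \<mu> (f + g)"
  by (simp only: alg_C_sel ring_hom_add[OF ring_hom_ring.homh[OF to_C_hom], symmetric] invariants_sel)

lemma to_C_smult:
  "f \<in> Inv \<mu> \<Longrightarrow> c \<odot>\<^bsub>alg_C lam \<mu>\<^esub> to_C lam \<mu> f = to_C lam \<mu> (const c * f)"
  by (simp only: alg_C_sel const_closed ring_hom_mult[OF ring_hom_ring.homh[OF to_C_hom], symmetric]
      invariants_sel)

lemma to_C_eq_zero_iff: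
  assumes f: "f \<in> Inv \<mu>"
  shows "to_C lam \<mu> f = \<zero>\<^bsub>alg_C lam \<mu>\<^esub> \<longleftrightarrow> f \<in> ideal_I lam \<mu>"
proof -
  interpret I: ideal "ideal_I lam \<mu>" "invariants \<mu>" by (rule ideal_I_ideal)
  have zero: "\<zero>\<^bsub>alg_C lam \<mu>\<^esub> = ideal_I lam \<mu>" by (simp add: alg_C_sel FactRing_def)
  show ?thesis
    unfolding zero to_C_def
    using I.a_rcos_const[of f] I.a_rcos_self[OF f] by auto
qed

lemma alg_C_abelian_group: "abelian_group (alg_C lam \<mu>)"
proof -
  interpret V: vectorspace class_ring "alg_C lam \<mu>" by (rule alg_C_vectorspace)
  show ?thesis by unfold_locales
qed

lemma to_C_eq_iff:
  assumes f: "f \<in> Inv \<mu>" and g: "g \<in> Inv \<mu>"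
  shows "to_C lam \<mu> f = to_C lam \<mu> g \<longleftrightarrow> f - g \<in> ideal_I lam \<mu>"
proof
  interpret G: abelian_group "alg_C lam \<mu>" by (rule alg_C_abelian_group)
  have fg: "f - g \<in> Inv \<mu>" by (rule Inv_diff[OF f g])
  have sum: "to_C lam \<mu> (f - g) \<oplus>\<^bsub>alg_C lam \<mu>\<^esub> to_C lam \<mu> g = to_C lam \<mu> f"
    using to_C_add[OF fg g] by simp
  have carr: "to_C lam \<mu> f' \<in> carrier (alg_C lam \<mu>)" if "f' \<in> Inv \<mu>" for f'
    using that by (simp add: to_C_carrier)
  {
    assume "f - g \<in> ideal_I lam \<mu>"
    then have "to_C lam \<mu> (f - g) = \<zero>\<^bsub>alg_C lam \<mu>\<^esub>" by (simp add: to_C_eq_zero_iff[OF fg])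
    then show "to_C lam \<mu> f = to_C lam \<mu> g"
      using sum carr[OF g] by simp
  next
    assume "to_C lam \<mu> f = to_C lam \<mu> g"
    then have "to_C lam \<mu> (f - g) = \<zero>\<^bsub>alg_C lam \<mu>\<^esub>"
      using sum carr[OF g] carr[OF fg] by (metis G.l_zero G.add.right_cancel G.zero_closed)
    then show "f - g \<in> ideal_I lam \<mu>" by (simp add: to_C_eq_zero_iff[OF fg])
  }
qed

lemma to_C_finsum:
  assumes "finite A" "\<And>x. x \<in> A \<Longrightarrow> f x \<in> Inv \<mu>"
  shows "finsum (alg_C lam \<mu>) (\<lambda>x. to_C lam \<mu> (f x)) A = to_C lam \<mu> (sum f A)"
  using assms
proof (induction A rule: finite_induct)
  interpret G: abelian_group "alg_C lam \<mu>" by (rule alg_C_abelian_group)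
  case empty
  show ?case
    using to_C_eq_zero_iff[OF Inv_zero, of lam] cp.subspace_0[OF ideal_I_subspace] by simp
next
  interpret G: abelian_group "alg_C lam \<mu>" by (rule alg_C_abelian_group)
  case (insert a A)
  then have "finsum (alg_C lam \<mu>) (\<lambda>x. to_C lam \<mu> (f x)) (insert a A)
      = to_C lam \<mu> (f a) \<oplus>\<^bsub>alg_C lam \<mu>\<^esub> finsum (alg_C lam \<mu>) (\<lambda>x. to_C lam \<mu> (f x)) A"
    by (intro G.finsum_insert) (auto simp: to_C_carrier)
  also have "\<dots> = to_C lam \<mu> (f a + sum f A)"
    using insert by (simp add: to_C_add Inv_sum)
  finally show ?case using insert by simp
qed

text \<open>The combination is indexed by A and not by the image, so coefficients belong to tableaux
  even where f takes a value repeatedly.\<close>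

lemma cp_span_finite_image:
  assumes "x \<in> cp.span (f ` A)" "finite A"
  shows "\<exists>b. x = (\<Sum>i\<in>A. const (b i) * f i)"
  using assms(1)
proof (induction x rule: cp.span_induct_alt)
  case base
  show ?case by (intro exI[of _ "\<lambda>_. 0"]) (simp add: const_zero)
next
  case (step c x y)
  then obtain b i where y: "y = (\<Sum>i\<in>A. const (b i) * f i)" and i: "i \<in> A" "x = f i" by blast
  have rest: "(\<Sum>j\<in>A - {i}. const ((b(i := b i + c)) j) * f j) = (\<Sum>j\<in>A - {i}. const (b j) * f j)"
    by (intro sum.cong) auto
  have "(\<Sum>j\<in>A. const ((b(i := b i + c)) j) * f j)
      = const (b i + c) * f i + (\<Sum>j\<in>A - {i}. const (b j) * f j)"
    unfolding sum.remove[OF assms(2) i(1)] rest by simp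
  also have "\<dots> = const c * x + y"
    unfolding y sum.remove[OF assms(2) i(1)] i(2) by (simp add: const_add distrib_right)
  finally show ?case by (intro exI[of _ "b(i := b i + c)"]) (rule sym)
qed

theorem theorem3p2:
  fixes n d :: nat and lam \<mu> :: "nat list"
  assumes "lam \<in> Part n d"
    and "\<mu> \<in> Comp n d"
  shows "inj_on (\<lambda>T. to_C lam \<mu> (tab_h \<mu> T)) (Col lam \<mu>)
    \<and> vectorspace.basis class_ring (alg_C lam \<mu>) ((\<lambda>T. to_C lam \<mu> (tab_h \<mu> T)) ` Col lam \<mu>)"
proof
  interpret tab_independence n d lam \<mu> by unfold_locales (rule assms)+
  interpret V: vectorspace class_ring "alg_C lam \<mu>" by (rule alg_C_vectorspace)
  interpret G: abelian_group "alg_C lam \<mu>" by (rule alg_C_abelian_group)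
  define \<phi> where "\<phi> = (\<lambda>T. to_C lam \<mu> (tab_h \<mu> T))"
  have inj: "inj_on \<phi> X"
  proof (rule inj_onI, rule ccontr)
    fix S T assume S: "S \<in> X" and T: "T \<in> X" and eq: "\<phi> S = \<phi> T" and ne: "S \<noteq> T"
    \<comment> \<open>Two tableaux with the same class would give a relation with the coefficients 1
      and -1.\<close>
    define a where "a U = (if U = S then 1 else if U = T then - 1 else 0 :: complex)" for U
    have "(\<Sum>U\<in>X. const (a U) * tab_h \<mu> U) = (\<Sum>U\<in>{S, T}. const (a U) * tab_h \<mu> U)"
      by (rule sum.mono_neutral_right) (use S T finite_Col in \<open>auto simp: a_def const_zero\<close>)
    also have "\<dots> = tab_h \<mu> S + const (- 1) * tab_h \<mu> T"
      using ne by (simp add: a_def const_one)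
    also have "const (- 1) = - 1"
      using const_add[of 1 "- 1"] by (simp add: const_zero const_one eq_neg_iff_add_eq_0 add.commute)
    finally have "(\<Sum>U\<in>X. const (a U) * tab_h \<mu> U) = tab_h \<mu> S - tab_h \<mu> T" by simp
    moreover have "tab_h \<mu> S - tab_h \<mu> T \<in> ideal_I lam \<mu>"
      using eq to_C_eq_iff[OF tab_h_Inv tab_h_Inv] by (simp add: \<phi>_def)
    ultimately have "a S = 0" using tab_h_independent[of a S] S by simp
    then show False by (simp add: a_def)
  qed
  then show "inj_on (\<lambda>T. to_C lam \<mu> (tab_h \<mu> T)) X" by (simp add: \<phi>_def)
  have fin: "finite (\<phi> ` X)" using finite_Col by blast
  have carr: "\<phi> ` X \<subseteq> carrier (alg_C lam \<mu>)"
    by (auto simp: \<phi>_def to_C_carrier tab_h_Inv)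
  have lincomb: "V.lincomb a (\<phi> ` X) = to_C lam \<mu> (\<Sum>T\<in>X. const (a (\<phi> T)) * tab_h \<mu> T)" for a
  proof -
    have "V.lincomb a (\<phi> ` X) = finsum (alg_C lam \<mu>) (\<lambda>T. a (\<phi> T) \<odot>\<^bsub>alg_C lam \<mu>\<^esub> \<phi> T) X"
      unfolding V.lincomb_def using carr inj by (intro V.finsum_reindex) auto
    also have "\<dots> = finsum (alg_C lam \<mu>) (\<lambda>T. to_C lam \<mu> (const (a (\<phi> T)) * tab_h \<mu> T)) X"
      by (simp add: \<phi>_def to_C_smult tab_h_Inv)
    also have "\<dots> = to_C lam \<mu> (\<Sum>T\<in>X. const (a (\<phi> T)) * tab_h \<mu> T)"
      by (rule to_C_finsum[OF finite_Col]) (intro Inv_mult const_closed tab_h_Inv)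
    finally show ?thesis .
  qed
  have "V.lin_indpt (\<phi> ` X)"
  proof (rule V.finite_lin_indpt2[OF fin carr], rule ballI)
    fix a v assume "V.lincomb a (\<phi> ` X) = \<zero>\<^bsub>alg_C lam \<mu>\<^esub>" and "v \<in> \<phi> ` X"
    then obtain S where S: "S \<in> X" "v = \<phi> S"
      and "(\<Sum>T\<in>X. const (a (\<phi> T)) * tab_h \<mu> T) \<in> ideal_I lam \<mu>"
      unfolding lincomb
      using to_C_eq_zero_iff[of "\<Sum>T\<in>X. const (a (\<phi> T)) * tab_h \<mu> T" \<mu> lam]
      by (auto intro!: Inv_sum Inv_mult const_closed tab_h_Inv)
    then have "a (\<phi> S) = 0" using tab_h_independent[of "\<lambda>T. a (\<phi> T)" S] by blast
    then show "a v = \<zero>\<^bsub>class_ring\<^esub>" by (simp add: S)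
  qed
  moreover have "V.span (\<phi> ` X) = carrier (alg_C lam \<mu>)"
  proof
    show "V.span (\<phi> ` X) \<subseteq> carrier (alg_C lam \<mu>)" by (rule V.span_is_subset2[OF carr])
    show "carrier (alg_C lam \<mu>) \<subseteq> V.span (\<phi> ` X)"
    proof
      fix v assume "v \<in> carrier (alg_C lam \<mu>)"
      then obtain f where f: "f \<in> Inv \<mu>" "v = to_C lam \<mu> f" by (auto simp: to_C_carrier)
      have "f \<in> cp.span (tab_h \<mu> ` X \<union> ideal_I lam \<mu>)"
        using Inv_spanned[OF assms] f(1) by blast
      then obtain x j where xj: "f = x + j" "x \<in> cp.span (tab_h \<mu> ` X)" "j \<in> ideal_I lam \<mu>"
        unfolding cp.span_Un cp.span_eq_iff[THEN iffD2, OF ideal_I_subspace] by blast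
      obtain b where b: "x = (\<Sum>T\<in>X. const (b T) * tab_h \<mu> T)"
        using cp_span_finite_image[OF xj(2) finite_Col] by blast
      \<comment> \<open>\<open>V.lincomb\<close> takes coefficients on classes; injectivity of
        \<open>\<phi>\<close> transports those given on tableaux.\<close>
      define a where "a v = b (inv_into X \<phi> v)" for v
      have "x = (\<Sum>T\<in>X. const (a (\<phi> T)) * tab_h \<mu> T)"
        unfolding b a_def using inj by (intro sum.cong) simp_all
      then have "V.lincomb a (\<phi> ` X) = to_C lam \<mu> x" by (simp add: lincomb)
      also have "\<dots> = v"
      proof -
        have "x \<in> Inv \<mu>" unfolding b by (intro Inv_sum Inv_mult const_closed tab_h_Inv)
        moreover have "x - f \<in> ideal_I lam \<mu>"
          using cp.subspace_neg[OF ideal_I_subspace xj(3)] by (simp add: xj(1))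
        ultimately show ?thesis using to_C_eq_iff[of x \<mu> f lam] f by simp
      qed
      finally show "v \<in> V.span (\<phi> ` X)"
        unfolding V.finite_span[OF fin carr] by auto
    qed
  qed
  ultimately show "V.basis ((\<lambda>T. to_C lam \<mu> (tab_h \<mu> T)) ` X)"
    unfolding V.basis_def \<phi>_def[symmetric] using carr by blast
qed

end
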